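(* Let $p\in(2,\infty)$, $P_0,P_1\in\mathbf{R}^2$, and $L>0$ be such that $\frac{L}{p-1}<|P_1-P_0|<L$. Let $N\in\mathbf{N}$ and let $\gamma\in\mathcal{A}_{\mathrm{pin}}(P_0,P_1,L)$ be an $N$-loop alternating flat-core $p$-elastica. Then $\gamma$ is a local minimizer of $\mathcal{B}_p$ in $\mathcal{A}_{\mathrm{pin}}(P_0,P_1,L)$.
   Context: $\mathbf{N}=\{1,2,\dots\}$ and $e_1,e_2$ is the canonical basis of $\mathbf{R}^2$. **Energy and admissible class.** $W^{2,p}_{\mathrm{arc}}(0,L;\mathbf{R}^2):=\{\gamma\in W^{2,p}(0,L;\mathbf{R}^2):|\gamma'|\equiv1\}$. The $p$-bending energy is $\mathcal{B}_p[\gamma]:=\int_\gamma|k|^p\,ds$, with $k$ the signed curvature and $s$ the arclength parameter. $\mathcal{A}_{\mathrm{pin}}(P_0,P_1,L):=\{\gamma\in W^{2,p}_{\mathrm{arc}}(0,L;\mathbf{R}^2):\gamma(0)=P_0,\ \gamma(L)=P_1\}$, equipped with the $W^{2,p}$-Sobolev metric. A curve $\gamma\in\mathcal{A}_{\mathrm{pin}}$ is a local minimizer of $\mathcal{B}_p$ in $\mathcal{A}_{\mathrm{pin}}$ if $\mathcal{B}_p[\eta]\ge\mathcal{B}_p[\gamma]$ for all $\eta\in\mathcal{A}_{\mathrm{pin}}$ in some neighborhood of $\gamma$. **Special functions ($p>2$).** Let $\mathrm{F}_{1,p}(x,1):=\int_0^x|\cos\phi|^{-2/p}\,d\phi$ for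 $x\in\mathbf{R}$, $\mathrm{K}_p(1)=\mathrm{K}_{1,p}(1):=\int_0^{\pi/2}(\cos\phi)^{-2/p}\,d\phi<\infty$, and let $\mathrm{am}_{1,p}(\cdot,1)$ be the inverse function of $\mathrm{F}_{1,p}(\cdot,1)$. The $p$-hyperbolic secant is $\mathrm{sech}_p\,x:=|\cos\mathrm{am}_{1,p}(x,1)|^{\frac2p-1}\cos\mathrm{am}_{1,p}(x,1)$ for $x\in(-\mathrm{K}_p(1),\mathrm{K}_p(1))$ and $\mathrm{sech}_p\,x:=0$ otherwise; the $p$-hyperbolic tangent is $\tanh_p x:=\int_0^x(\mathrm{sech}_p\,t)^p\,dt$. **Building blocks.** For $\sigma\in\{+,-\}$, the loop $\gamma_b^{\pm}:[-\mathrm{K}_p(1),\mathrm{K}_p(1)]\to\mathbf{R}^2$ is $$\gamma_b^{\pm}(s)=\Big(2\tanh_p s-s,\ \mp\tfrac{p}{p-1}(\mathrm{sech}_p\,s)^{p-1}\Big),$$ and for $\Lambda\ge0$ the segment $\gamma_\ell^{\Lambda}:[0,\Lambda]\to\mathbf{R}^2$ is $\gamma_\ell^{\Lambda}(s)=(-s,0)$. **Concatenation.** For $\gamma_j:[a_j,b_j]\to\mathbf{R}^2$ with $\Lambda_j:=b_j-a_j\ge0$, $(\gamma_1\oplus\gamma_2):[0,\Lambda_1+\Lambda_2]\to\mathbf{R}^2$ is given by $\gamma_1(s+a_1)$ for $s\in[0,\Lambda_1]$ and by $\gamma_2(s+a_2-\Lambda_1)+\gamma_1(b_1)-\gamma_2(a_2)$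 for $s\in[\Lambda_1,\Lambda_1+\Lambda_2]$; inductively $\bigoplus_{j=1}^N\gamma_j:=(\gamma_1\oplus\cdots\oplus\gamma_{N-1})\oplus\gamma_N$. **Alternating flat-core.** Let $p>2$, $\frac{1}{p-1}L<|P_1-P_0|<L$, $N\in\mathbf{N}$ and $r:=\frac{|P_0-P_1|}{L}$. A curve $\gamma\in\mathcal{A}_{\mathrm{pin}}(P_0,P_1,L)$ is an $N$-loop alternating flat-core $p$-elastica if, up to similarity (translation, rotation, reflection, dilation) and reparametrization (so that it is parametrized by arclength on $[0,L]$), $\gamma$ is given by $$\gamma_{\mathrm{flat}}:=\Big(\bigoplus_{j=1}^N\big(\gamma_\ell^{L_j}\oplus\gamma_b^{\sigma_j}\big)\Big)\oplus\gamma_\ell^{L_{N+1}}$$ for some $(\sigma_1,\dots,\sigma_N)\in\{+,-\}^N$ and some strictly positive numbers $L_1,\dots,L_{N+1}\in(0,\infty)$ satisfying $$\sum_{j=1}^{N+1}L_j=2N\,\frac{r-\frac1{p-1}}{1-r}\,\mathrm{K}_p(1).$$ *)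

theory Defs
  imports "HOL-Analysis.Analysis"
begin

section \<open>Sobolev curves on a bounded interval\<close>

definition test_function :: "real \<Rightarrow> (real \<Rightarrow> real) \<Rightarrow> bool" where
  "test_function L \<phi> \<longleftrightarrow>
     (\<forall>n x. (deriv ^^ n) \<phi> differentiable (at x)) \<and>
     (\<exists>K. compact K \<and> K \<subseteq> {0<..<L} \<and> (\<forall>x. x \<notin> K \<longrightarrow> \<phi> x = 0))"

definition locally_integrable :: "real \<Rightarrow> (real \<Rightarrow> real^2) \<Rightarrow> bool" where
  "locally_integrable L f \<longleftrightarrow>
     (\<forall>K. compact K \<and> K \<subseteq> {0<..<L} \<longrightarrow> set_integrable lebesgue K f)"

definition has_weak_deriv :: "real \<Rightarrow> (real \<Rightarrow> real^2) \<Rightarrow> (real \<Rightarrow> real^2) \<Rightarrow> bool" where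
  "has_weak_deriv L f g \<longleftrightarrow> locally_integrable L f \<and> locally_integrable L g \<and>
     (\<forall>\<phi>. test_function L \<phi> \<longrightarrow>
        (LINT x|lebesgue_on {0<..<L}. deriv \<phi> x *\<^sub>R f x) =
        - (LINT x|lebesgue_on {0<..<L}. \<phi> x *\<^sub>R g x))"

text \<open>A representative of the weak derivative; it is determined almost everywhere on \<open>(0,L)\<close>.\<close>

definition weak_deriv :: "real \<Rightarrow> (real \<Rightarrow> real^2) \<Rightarrow> real \<Rightarrow> real^2" where
  "weak_deriv L f = (SOME g. has_weak_deriv L f g)"

definition Lp :: "real \<Rightarrow> real \<Rightarrow> (real \<Rightarrow> real^2) set" where
  "Lp p L = {f. f \<in> borel_measurable (lebesgue_on {0<..<L}) \<and>
                integrable (lebesgue_on {0<..<L}) (\<lambda>x. norm (f x) powr p)}"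

definition Lp_norm :: "real \<Rightarrow> real \<Rightarrow> (real \<Rightarrow> real^2) \<Rightarrow> real" where
  "Lp_norm p L f = (LINT x|lebesgue_on {0<..<L}. norm (f x) powr p) powr (1/p)"

text \<open>Elements of \<open>W\<^sup>2\<^sup>,\<^sup>p(0,L)\<close> are represented by their continuous representative on
  \<open>[0,L]\<close>, so that boundary values are point values. Values outside \<open>[0,L]\<close> play no role.\<close>

definition W2p :: "real \<Rightarrow> real \<Rightarrow> (real \<Rightarrow> real^2) set" where
  "W2p p L = {\<gamma>. continuous_on {0..L} \<gamma> \<and> \<gamma> \<in> Lp p L \<and>
     (\<exists>v\<in>Lp p L. \<exists>w\<in>Lp p L. has_weak_deriv L \<gamma> v \<and> has_weak_deriv L v w)}"

definition W2p_norm :: "real \<Rightarrow> real \<Rightarrow> (real \<Rightarrow> real^2) \<Rightarrow> real" where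
  "W2p_norm p L f = Lp_norm p L f + Lp_norm p L (weak_deriv L f)
                    + Lp_norm p L (weak_deriv L (weak_deriv L f))"

definition W2p_arc :: "real \<Rightarrow> real \<Rightarrow> (real \<Rightarrow> real^2) set" where
  "W2p_arc p L = {\<gamma> \<in> W2p p L. AE s in lebesgue_on {0<..<L}. norm (weak_deriv L \<gamma> s) = 1}"

section \<open>Bending energy, admissible curves, local minimizers\<close>

text \<open>Signed curvature \<open>det(\<gamma>', \<gamma>'')\<close> of a curve parametrized by arclength.\<close>

definition curvature :: "real \<Rightarrow> (real \<Rightarrow> real^2) \<Rightarrow> real \<Rightarrow> real" where
  "curvature L \<gamma> s =
     (let v = weak_deriv L \<gamma> s; w = weak_deriv L (weak_deriv L \<gamma>) s
      in v$1 * w$2 - v$2 * w$1)"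

definition bending_energy :: "real \<Rightarrow> real \<Rightarrow> (real \<Rightarrow> real^2) \<Rightarrow> real" where
  "bending_energy p L \<gamma> = (LINT s|lebesgue_on {0<..<L}. \<bar>curvature L \<gamma> s\<bar> powr p)"

definition A_pin :: "real \<Rightarrow> real^2 \<Rightarrow> real^2 \<Rightarrow> real \<Rightarrow> (real \<Rightarrow> real^2) set" where
  "A_pin p P0 P1 L = {\<gamma> \<in> W2p_arc p L. \<gamma> 0 = P0 \<and> \<gamma> L = P1}"

definition local_minimizer :: "real \<Rightarrow> real^2 \<Rightarrow> real^2 \<Rightarrow> real \<Rightarrow> (real \<Rightarrow> real^2) \<Rightarrow> bool" where
  "local_minimizer p P0 P1 L \<gamma> \<longleftrightarrow> \<gamma> \<in> A_pin p P0 P1 L \<and>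
     (\<exists>\<epsilon>>0. \<forall>\<eta>\<in>A_pin p P0 P1 L.
        W2p_norm p L (\<lambda>s. \<eta> s - \<gamma> s) < \<epsilon> \<longrightarrow> bending_energy p L \<eta> \<ge> bending_energy p L \<gamma>)"

section \<open>The degenerate p-elliptic functions (modulus 1)\<close>

text \<open>Since \<open>0 powr a = 0\<close>, the integrand of \<open>F1p\<close> is \<open>0\<close> rather than \<open>\<infinity>\<close> at the zeros of the
  cosine, which form a null set. For \<open>p > 2\<close> it is locally integrable and \<open>F1p p\<close> is a bijection of
  the real line.\<close>

definition F1p :: "real \<Rightarrow> real \<Rightarrow> real" where
  "F1p p x = (LBINT \<phi>=0..x. \<bar>cos \<phi>\<bar> powr (-2/p))"

definition Kp :: "real \<Rightarrow> real" where
  "Kp p = (LBINT \<phi>=0..pi/2. cos \<phi> powr (-2/p))"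

definition am1p :: "real \<Rightarrow> real \<Rightarrow> real" where
  "am1p p = inv (F1p p)"

definition sechp :: "real \<Rightarrow> real \<Rightarrow> real" where
  "sechp p x = (if x \<in> {- Kp p<..<Kp p}
                then \<bar>cos (am1p p x)\<bar> powr (2/p - 1) * cos (am1p p x) else 0)"

definition tanhp :: "real \<Rightarrow> real \<Rightarrow> real" where
  "tanhp p x = (LBINT t=0..x. sechp p t powr p)"

section \<open>Parametrized arcs and concatenation\<close>

text \<open>The triple \<open>(a, b, g)\<close> stands for the curve \<open>g\<close> restricted to \<open>[a,b]\<close>.\<close>

type_synonym arc = "real \<times> real \<times> (real \<Rightarrow> real^2)"

fun arc_concat :: "arc \<Rightarrow> arc \<Rightarrow> arc" (infixl "\<oplus>" 65) where
  "(a1, b1, g1) \<oplus> (a2, b2, g2) =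
     (0, (b1 - a1) + (b2 - a2),
      \<lambda>s. if s \<le> b1 - a1 then g1 (s + a1)
          else g2 (s + a2 - (b1 - a1)) + g1 b1 - g2 a2)"

text \<open>\<open>arc_Concat c N\<close> is \<open>c 1 \<oplus> \<dots> \<oplus> c N\<close>; the value at \<open>N = 0\<close> is a dummy.\<close>

fun arc_Concat :: "(nat \<Rightarrow> arc) \<Rightarrow> nat \<Rightarrow> arc" where
  "arc_Concat c 0 = (0, 0, \<lambda>_. 0)"
| "arc_Concat c (Suc 0) = c 1"
| "arc_Concat c (Suc (Suc n)) = arc_Concat c (Suc n) \<oplus> c (Suc (Suc n))"

section \<open>Alternating flat-core p-elasticae\<close>

text \<open>A sign in \<open>{+,-}\<close> is encoded as \<open>\<sigma> \<in> {1, -1}\<close>.\<close>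

definition loop :: "real \<Rightarrow> real \<Rightarrow> arc" where
  "loop p \<sigma> = (- Kp p, Kp p,
     \<lambda>s. vector [2 * tanhp p s - s, - \<sigma> * (p / (p - 1)) * sechp p s powr (p - 1)])"

definition segment :: "real \<Rightarrow> arc" where
  "segment \<Lambda> = (0, \<Lambda>, \<lambda>s. vector [- s, 0])"

definition flat_arc :: "real \<Rightarrow> nat \<Rightarrow> (nat \<Rightarrow> real) \<Rightarrow> (nat \<Rightarrow> real) \<Rightarrow> arc" where
  "flat_arc p N \<sigma> l =
     arc_Concat (\<lambda>j. segment (l j) \<oplus> loop p (\<sigma> j)) N \<oplus> segment (l (N + 1))"

text \<open>The curve \<open>g\<close> below lives on \<open>[0,\<Lambda>]\<close> and has unit speed, so its image under a similarity
  is brought to arclength parametrization on \<open>[0,L]\<close> by the reparametrization \<open>s \<mapsto> (\<Lambda>/L) s\<close>.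
  A reversal of orientation need not be listed separately: traversing \<open>g\<close> backwards and reflecting
  the first coordinate gives, up to translation, the flat core with \<open>\<sigma>\<close> and \<open>l\<close> in reversed order.\<close>

definition alternating_flat_core ::
    "real \<Rightarrow> real^2 \<Rightarrow> real^2 \<Rightarrow> real \<Rightarrow> nat \<Rightarrow> (real \<Rightarrow> real^2) \<Rightarrow> bool" where
  "alternating_flat_core p P0 P1 L N \<gamma> \<longleftrightarrow> \<gamma> \<in> A_pin p P0 P1 L \<and>
     (\<exists>\<sigma> l. (\<forall>j\<in>{1..N}. \<sigma> j \<in> {1, -1}) \<and> (\<forall>j\<in>{1..N+1}. l j > 0) \<and>
        (let r = norm (P0 - P1) / L
         in (\<Sum>j=1..N+1. l j) = 2 * real N * ((r - 1 / (p - 1)) / (1 - r)) * Kp p) \<and>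
        (case flat_arc p N \<sigma> l of (_, \<Lambda>, g) \<Rightarrow>
          \<exists>c Q b. c > 0 \<and> orthogonal_transformation Q \<and>
            (\<forall>s\<in>{0..L}. \<gamma> s = c *\<^sub>R Q (g (\<Lambda> / L * s)) + b)))"

end

theory Submission
  imports Defs
begin

text \<open>Write \<open>V\<close> for the unit tangent of an admissible curve, \<open>q\<close> for the direction opposite to the
  segments and \<open>z = V \<bullet> q\<close>. On admissible curves \<open>\<integral> z\<close> is fixed by the endpoints, so the bending
  energy may be replaced by \<open>E = \<integral> |k|\<^sup>p + (p - 1) \<mu>\<^sup>p (1 + z) / 2\<close>, where \<open>2 / \<mu>\<close> is the
  dilation factor of the flat core. By Young's inequality
  \<open>E \<ge> p \<mu>\<^sup>p\<^sup>-\<^sup>1 \<integral> ((1 + z) / 2)\<^sup>1\<^sup>-\<^sup>1\<^sup>/\<^sup>p |k|\<close>, with equality on flat cores, and since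
  \<open>|z'| = |k| (1 - z\<^sup>2)\<^sup>1\<^sup>/\<^sup>2\<close> the right-hand side over a piece is at least \<open>|G(z(b)) - G(z(a))|\<close> for an
  explicit increasing \<open>G\<close> with \<open>G(-1) = 0\<close>. A curve that is \<open>C\<^sup>1\<close>-close to a flat core still attains
  \<open>V = q\<close> near the middle of each loop, so the loop \<open>[a, b]\<close> costs at least
  \<open>2 G(1) - G(z(a)) - G(z(b))\<close>. It remains to see that each segment \<open>[a, b]\<close> costs at least
  \<open>G(z(a)) + G(z(b))\<close>. This is clear if \<open>V = - q\<close> somewhere on it. Otherwise, if \<open>y > 0\<close> is the minimum
  of \<open>(1 + z) / 2\<close>, the second term of \<open>E\<close> contributes at least \<open>(p - 1) \<mu>\<^sup>p y\<close> per unit length, while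
  the loss in the calibration is only \<open>o(1) y\<close> as \<open>z \<rightarrow> -1\<close>; this is where \<open>p > 2\<close> enters. Summing
  up, the terms at the break points cancel and \<open>E \<ge> 2 N G(1)\<close>, the value at the flat core.\<close>

section \<open>Indefinite integrals\<close>

text \<open>The pieces cannot be compared one by one. A competitor need not have
  \<open>V = - q\<close> at the break points, and then the bound for a loop falls short of
  \<open>2 G(1)\<close> by the values of \<open>G\<close> there. The adjacent segments must repay
  the shortfall; they can, because their lengths are strictly positive while closeness makes the
  margin that this requires arbitrarily small. The value of \<open>\<mu>\<close> is forced by the
  equality case of Young's inequality, \<open>|k| = \<mu> X^(1/p)\<close> with
  \<open>X = (1 + z) / 2\<close>. On a loop dilated by \<open>1 / \<nu>\<close> and with the cosine
  taken of the amplitude, \<open>X = cos^2\<close> and \<open>|k| = 2 \<nu> cos^(2/p)\<close>, so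
  \<open>\<mu> = 2 \<nu>\<close>. The density of \<open>G\<close> is unbounded at
  \<open>z = 1\<close>, the value taken in the middle of every loop, and a chain rule for continuous
  weights does not apply there. It is regularized by a parameter \<open>\<delta>\<close> that only
  lowers it, so the pointwise Young bound survives. The energy of the core is never evaluated: it is
  the limit, as \<open>\<delta>\<close> tends to 0, of a lower bound valid for all close
  competitors.\<close>

lemma sigma_finite_lebesgue: "sigma_finite_measure (lebesgue :: real measure)"
proof
  obtain A :: "real set set" where "countable A" "A \<subseteq> sets lborel" "\<Union>A = space lborel"
    "\<forall>a\<in>A. emeasure lborel a \<noteq> \<infinity>"
    using lborel.sigma_finite_countable by blast
  then show "\<exists>A. countable A \<and> A \<subseteq> sets (lebesgue::real measure) \<and> \<Union>A = space lebesgue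
      \<and> (\<forall>a\<in>A. emeasure lebesgue a \<noteq> \<infinity>)"
    by (intro exI[of _ A]) (auto simp: subset_eq sets_completionI_sets)
qed

text \<open>Closed intervals form an intersection-stable generator of the Borel sets, so vanishing
  of the integral spreads from intervals to Borel sets and then, up to null sets, to Lebesgue sets,
  where \<open>sigma_finite_measure.density_zero\<close> applies.\<close>

lemma AE_zero_if_integral_intervals_zero_Icc:
  fixes f :: "real \<Rightarrow> 'b::euclidean_space"
  assumes f: "f absolutely_integrable_on {a..b}"
    and 0: "\<And>s t. a \<le> s \<Longrightarrow> s \<le> t \<Longrightarrow> t \<le> b \<Longrightarrow> integral {s..t} f = 0"
  shows "AE x in lebesgue. x \<in> {a..b} \<longrightarrow> f x = 0"
proof -
  define g where "g x = indicator {a..b} x *\<^sub>R f x" for x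
  have g: "integrable lebesgue g"
    using f by (simp add: g_def[abs_def] set_integrable_def)
  have set_g: "set_integrable lebesgue A g" if "A \<in> sets lebesgue" for A
    unfolding set_integrable_def using integrable_mult_indicator[OF that g] .
  have cbox: "(LINT x:{c..d}|lebesgue. g x) = 0" for c d
  proof -
    have "(LINT x:{c..d}|lebesgue. g x) = integral {c..d} g"
      by (rule set_lebesgue_integral_eq_integral) (rule set_g, simp)
    also have "\<dots> = integral ({max a c..min b d}) f"
    proof -
      have "g = (\<lambda>x. if x \<in> {a..b} then f x else 0)"
        by (auto simp: g_def fun_eq_iff)
      then have "integral {c..d} g = integral ({c..d} \<inter> {a..b}) f"
        by (simp only: Henstock_Kurzweil_Integration.integral_restrict_Int Int_commute)
      then show ?thesis by (simp add: Int_commute)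
    qed
    also have "\<dots> = 0"
      by (cases "max a c \<le> min b d") (use 0 in auto)
    finally show ?thesis .
  qed
  \<comment> \<open>The complement case of the induction below needs the integral over the whole
    line.\<close>
  have total: "(LINT x|lebesgue. g x) = 0"
  proof -
    have "(LINT x|lebesgue. g x) = (LINT x:{a..b}|lebesgue. g x)"
      by (auto simp: set_lebesgue_integral_def g_def indicator_def intro!: Bochner_Integration.integral_cong)
    then show ?thesis using cbox by simp
  qed
  have borel: "(LINT x:A|lebesgue. g x) = 0" if "A \<in> sets (borel::real measure)" for A
  proof -
    have eq: "sets (borel::real measure) = sigma_sets UNIV (range (\<lambda>(a::real, b). {a..b}))"
      by (simp add: borel_eq_atLeastAtMost)
    have leb: "X \<in> sets lebesgue" if "X \<in> sigma_sets UNIV (range (\<lambda>(a::real, b). {a..b}))" for X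
      using that unfolding eq[symmetric] by (simp add: sets_completionI_sets)
    have "Int_stable (range (\<lambda>(a::real, b). {a..b}))"
      by (auto simp: Int_stable_def)
    moreover have "range (\<lambda>(a::real, b). {a..b}) \<subseteq> Pow UNIV" by simp
    moreover have "A \<in> sigma_sets UNIV (range (\<lambda>(a::real, b). {a..b}))"
      using that by (simp add: eq)
    ultimately show ?thesis
    proof (induction rule: sigma_sets_induct_disjoint)
      case (compl A)
      then have A: "A \<in> sets lebesgue" by (intro leb)
      have "UNIV - A \<in> sets lebesgue" using sets.compl_sets[OF A] by simp
      then have "(LINT x:A \<union> (UNIV - A)|lebesgue. g x) = (LINT x:A|lebesgue. g x) + (LINT x:UNIV - A|lebesgue. g x)"
        using A by (intro set_integral_Un set_g) auto
      then show ?case using compl(2) total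
        by (simp add: set_lebesgue_integral_def)
    next
      case (union A)
      have A: "A i \<in> sets lebesgue" for i using union(2) by (intro leb) auto
      then have "(\<Union>i. A i) \<in> sets lebesgue" by blast
      then have "(LINT x:(\<Union>i. A i)|lebesgue. g x) = (\<Sum>i. LINT x:A i|lebesgue. g x)"
        using A union(1) by (intro lebesgue_integral_countable_add set_g)
          (auto simp: disjoint_family_on_def)
      then show ?case using union(3) by simp
    next
      case (basic A)
      then show ?case using cbox by auto
    next
      case empty
      show ?case by (simp add: set_lebesgue_integral_def)
    qed
  qed
  have "AE x in lebesgue. g x = 0"
  proof (rule sigma_finite_measure.density_zero[OF sigma_finite_lebesgue g])
    fix A :: "real set" assume "A \<in> sets lebesgue"
    then obtain S N N' where A: "A = S \<union> N" "S \<in> sets lborel" "N \<subseteq> N'" "N' \<in> null_sets lborel"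
      by (auto elim: sets_completionE)
    have "N' \<in> null_sets lebesgue" using A(4) null_sets_completionI by blast
    then have "AE x in lebesgue. x \<notin> N'" by (rule AE_not_in)
    then have "(LINT x:A|lebesgue. g x) = (LINT x:S|lebesgue. g x)"
      using \<open>A \<in> sets lebesgue\<close> A g
      unfolding set_lebesgue_integral_def
      by (intro integral_cong_AE borel_measurable_integrable[OF integrable_mult_indicator])
         (auto intro: sets_completionI_sets simp: indicator_def)
    with borel A(2) show "(LINT x:A|lebesgue. g x) = 0" by simp
  qed
  then show ?thesis
    by eventually_elim (auto simp: g_def indicator_def split: if_splits)
qed

text \<open>Weak derivatives are a priori only locally integrable, hence the open interval; it is
  exhausted by countably many closed ones.\<close>

lemma AE_zero_if_integral_intervals_zero:
  fixes f :: "real \<Rightarrow> 'b::euclidean_space"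
  assumes f: "\<And>s t. a < s \<Longrightarrow> s \<le> t \<Longrightarrow> t < b \<Longrightarrow> f absolutely_integrable_on {s..t}"
    and 0: "\<And>s t. a < s \<Longrightarrow> s \<le> t \<Longrightarrow> t < b \<Longrightarrow> integral {s..t} f = 0"
  shows "AE x in lebesgue. x \<in> {a<..<b} \<longrightarrow> f x = 0"
proof -
  have "AE x in lebesgue. x \<in> {a + 1/Suc n..b - 1/Suc n} \<longrightarrow> f x = 0" for n
  proof (cases "a + 1/Suc n \<le> b - 1/Suc n")
    case True
    have "1 / Suc n > (0::real)" by simp
    then have *: "a < a + 1/Suc n" "b - 1/Suc n < b" by linarith+
    show ?thesis
      using * True by (intro AE_zero_if_integral_intervals_zero_Icc f 0) linarith+
  qed auto
  then have "AE x in lebesgue. \<forall>n. x \<in> {a + 1/Suc n..b - 1/Suc n} \<longrightarrow> f x = 0"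
    by (subst AE_all_countable) blast
  then show ?thesis
  proof eventually_elim
    case (elim x)
    show ?case
    proof
      assume x: "x \<in> {a<..<b}"
      then have "min (x - a) (b - x) > 0" by auto
      then obtain n where "1 / Suc n < min (x - a) (b - x)" by (metis nat_approx_posE)
      with x have "x \<in> {a + 1/Suc n..b - 1/Suc n}" by auto
      with elim show "f x = 0" by blast
    qed
  qed
qed

section \<open>Chain and product rules for indefinite integrals\<close>

lemma continuous_on_indefinite_integral:
  fixes z \<zeta> :: "real \<Rightarrow> real"
  assumes "\<zeta> absolutely_integrable_on {a..b}"
    and "\<And>s. s \<in> {a..b} \<Longrightarrow> z s = z a + integral {a..s} \<zeta>"
  shows "continuous_on {a..b} z"
proof -
  have "continuous_on {a..b} (\<lambda>s. z a + integral {a..s} \<zeta>)"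
    using assms(1) by (intro continuous_intros indefinite_integral_continuous_1)
      (auto simp: absolutely_integrable_on_def)
  then show ?thesis using assms(2) by (metis (no_types, lifting) continuous_on_eq)
qed

lemma integral_increment:
  fixes z \<zeta> :: "real \<Rightarrow> real"
  assumes \<zeta>: "\<zeta> absolutely_integrable_on {a..b}"
    and z: "\<And>s. s \<in> {a..b} \<Longrightarrow> z s = z a + integral {a..s} \<zeta>"
    and st: "a \<le> s" "s \<le> t" "t \<le> b"
  shows "integral {s..t} \<zeta> = z t - z s"
proof -
  have "\<zeta> integrable_on {a..t}" 
    using \<zeta> st by (meson absolutely_integrable_on_def absolutely_integrable_on_subinterval atLeastatMost_subset_iff order_refl)
  then have "integral {a..s} \<zeta> + integral {s..t} \<zeta> = integral {a..t} \<zeta>"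
    using st by (intro Henstock_Kurzweil_Integration.integral_combine) auto
  then show ?thesis using z[of s] z[of t] st by auto
qed

lemma absolutely_integrable_continuous_mult:
  fixes g \<zeta> :: "real \<Rightarrow> real"
  assumes "\<zeta> absolutely_integrable_on {a..b}" "continuous_on {a..b} g"
  shows "(\<lambda>s. g s * \<zeta> s) absolutely_integrable_on {a..b}"
  by (rule absolutely_integrable_bounded_measurable_product_real)
     (use assms in \<open>auto intro!: continuous_imp_measurable_on_sets_lebesgue compact_imp_bounded compact_continuous_image\<close>)

lemma MVT_within:
  fixes \<Psi> \<psi> :: "real \<Rightarrow> real"
  assumes "u < v" and d: "\<And>y. y \<in> {u..v} \<Longrightarrow> (\<Psi> has_real_derivative \<psi> y) (at y within {u..v})"
  shows "\<exists>y. u < y \<and> y < v \<and> \<Psi> v - \<Psi> u = (v - u) * \<psi> y"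
proof -
  have "continuous_on {u..v} \<Psi>" using d by (rule DERIV_continuous_on)
  moreover have "(\<Psi> has_derivative (*) (\<psi> y)) (at y)" if "u < y" "y < v" for y
    using d[of y] that at_within_Icc_at[OF that] unfolding has_field_derivative_def by simp
  ultimately obtain y where "u < y" "y < v" "\<Psi> v - \<Psi> u = \<psi> y * (v - u)"
    using mvt[OF \<open>u < v\<close>, of \<Psi> "\<lambda>y. (*) (\<psi> y)"] by blast
  then show ?thesis by (auto simp: mult.commute)
qed

text \<open>A mean value argument on short intervals replaces the theory of absolutely continuous
  functions.\<close>

lemma chain_rule_indefinite_integral:
  fixes z \<zeta> \<psi> \<Psi> :: "real \<Rightarrow> real"
  assumes \<zeta>: "\<zeta> absolutely_integrable_on {a..b}" and ab: "a \<le> b"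
    and z: "\<And>s. s \<in> {a..b} \<Longrightarrow> z s = z a + integral {a..s} \<zeta>"
    and \<Psi>: "\<And>y. y \<in> {c..d} \<Longrightarrow> (\<Psi> has_real_derivative \<psi> y) (at y within {c..d})"
    and \<psi>: "continuous_on {c..d} \<psi>" and zcd: "z ` {a..b} \<subseteq> {c..d}"
  shows "(\<lambda>s. \<psi> (z s) * \<zeta> s) absolutely_integrable_on {a..b}"
    and "integral {a..b} (\<lambda>s. \<psi> (z s) * \<zeta> s) = \<Psi> (z b) - \<Psi> (z a)"
proof -
  have cz: "continuous_on {a..b} z" by (rule continuous_on_indefinite_integral[OF \<zeta> z])
  have cpz: "continuous_on {a..b} (\<lambda>s. \<psi> (z s))"
    by (rule continuous_on_compose2[OF \<psi> cz zcd])
  show ai: "(\<lambda>s. \<psi> (z s) * \<zeta> s) absolutely_integrable_on {a..b}"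
    by (rule absolutely_integrable_continuous_mult[OF \<zeta> cpz])
  have sub: "g integrable_on {s..t}" if "g absolutely_integrable_on {a..b}" "a \<le> s" "t \<le> b" for g :: "real \<Rightarrow> real" and s t
    using that by (meson absolutely_integrable_on_def absolutely_integrable_on_subinterval atLeastatMost_subset_iff)
  have asub: "(\<lambda>x. \<bar>\<zeta> x\<bar>) absolutely_integrable_on {a..b}"
    using \<zeta> by (simp add: set_integrable_abs)
  \<comment> \<open>\<open>D\<close> is the defect of the claimed formula. It is additive over
    adjacent intervals, so a bound by \<open>e\<close> times the integral of
    \<open>\<bar>\<zeta>\<bar>\<close> on short intervals extends to \<open>{a..b}\<close>.\<close>
  define D where "D s t = \<Psi> (z t) - \<Psi> (z s) - integral {s..t} (\<lambda>s. \<psi> (z s) * \<zeta> s)" for s t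
  have Dadd: "D s u = D s t + D t u" if "a \<le> s" "s \<le> t" "t \<le> u" "u \<le> b" for s t u
    using Henstock_Kurzweil_Integration.integral_combine[OF that(2,3) sub[OF ai]] that by (simp add: D_def)
  have "\<bar>D a b\<bar> \<le> e * integral {a..b} (\<lambda>x. \<bar>\<zeta> x\<bar>)" if e: "e > 0" for e
  proof -
    have "uniformly_continuous_on {a..b} (\<lambda>s. \<psi> (z s))"
      by (rule compact_uniformly_continuous[OF cpz]) simp
    then obtain \<delta> where \<delta>: "\<delta> > 0"
      "\<And>s t. s \<in> {a..b} \<Longrightarrow> t \<in> {a..b} \<Longrightarrow> dist t s < \<delta> \<Longrightarrow> dist (\<psi> (z t)) (\<psi> (z s)) < e"
      unfolding uniformly_continuous_on_def using e by metis
    have loc: "\<bar>D s t\<bar> \<le> e * integral {s..t} (\<lambda>x. \<bar>\<zeta> x\<bar>)" if st: "a \<le> s" "s \<le> t" "t \<le> b" "t - s < \<delta>" for s t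
    proof -
      \<comment> \<open>The mean value theorem yields a value \<open>y\<close> between
        \<open>z s\<close> and \<open>z t\<close>, and the intermediate value theorem makes it a
        value of \<open>z\<close> on \<open>{s..t}\<close>. Uniform continuity of
        \<open>\<psi>\<close> along \<open>z\<close> then makes the integrand of the defect
        small.\<close>
      have "\<exists>r\<in>{s..t}. \<Psi> (z t) - \<Psi> (z s) = \<psi> (z r) * (z t - z s)"
      proof (cases "z s = z t")
        case False
        have czst: "continuous_on {s..t} z" using cz st by (auto intro: continuous_on_subset)
        have zin: "z s \<in> {c..d}" "z t \<in> {c..d}"
          using zcd st by (meson atLeastAtMost_iff image_subset_iff order_trans)+
        have mvt': "\<exists>y. min (z s) (z t) \<le> y \<and> y \<le> max (z s) (z t) \<and> \<Psi> (z t) - \<Psi> (z s) = \<psi> y * (z t - z s)"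
        proof -
          let ?m = "min (z s) (z t)" and ?M = "max (z s) (z t)"
          have "?m < ?M" using False by auto
          have d: "(\<Psi> has_real_derivative \<psi> y) (at y within {?m..?M})" if "y \<in> {?m..?M}" for y
            using DERIV_subset[OF \<Psi>, of y "{?m..?M}"] that zin by (auto simp: min_def max_def split: if_splits)
          obtain y where y: "?m < y" "y < ?M" "\<Psi> ?M - \<Psi> ?m = (?M - ?m) * \<psi> y"
            using MVT_within[OF \<open>?m < ?M\<close> d] by auto
          then show ?thesis
            by (intro exI[of _ y]) (auto simp: min_def max_def algebra_simps split: if_splits)
        qed
        then obtain y where y: "min (z s) (z t) \<le> y" "y \<le> max (z s) (z t)" "\<Psi> (z t) - \<Psi> (z s) = \<psi> y * (z t - z s)"
          by auto
        have "\<exists>r\<ge>s. r \<le> t \<and> z r = y"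
        proof (cases "z s \<le> z t")
          case True then show ?thesis using IVT'[of z s y t] y czst st by (auto simp: min_def max_def)
        next
          case False then show ?thesis using IVT2'[of z t y s] y czst st by (auto simp: min_def max_def)
        qed
        with y show ?thesis by auto
      qed (use st in auto)
      then obtain r where r: "r \<in> {s..t}" "\<Psi> (z t) - \<Psi> (z s) = \<psi> (z r) * (z t - z s)" by blast
      have "D s t = integral {s..t} (\<lambda>x. (\<psi> (z r) - \<psi> (z x)) * \<zeta> x)"
      proof -
        have "integral {s..t} (\<lambda>x. (\<psi> (z r) - \<psi> (z x)) * \<zeta> x)
            = integral {s..t} (\<lambda>x. \<psi> (z r) * \<zeta> x) - integral {s..t} (\<lambda>x. \<psi> (z x) * \<zeta> x)"
          using sub[OF ai, of s t] integrable_on_cmult_left[OF sub[OF \<zeta>, of s t], of "\<psi> (z r)"] st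
          by (subst Henstock_Kurzweil_Integration.integral_diff[symmetric]) (simp_all add: left_diff_distrib)
        then show ?thesis
          using integral_increment[OF \<zeta> z st(1-3)] r by (simp add: D_def)
      qed
      also have "\<bar>\<dots>\<bar> \<le> integral {s..t} (\<lambda>x. e * \<bar>\<zeta> x\<bar>)"
      proof -
        have "norm (integral {s..t} (\<lambda>x. (\<psi> (z r) - \<psi> (z x)) * \<zeta> x)) \<le> integral {s..t} (\<lambda>x. e * \<bar>\<zeta> x\<bar>)"
        proof (rule integral_norm_bound_integral)
          have "(\<lambda>x. \<psi> (z r) * \<zeta> x - \<psi> (z x) * \<zeta> x) integrable_on {s..t}"
            using sub[OF ai, of s t] integrable_on_cmult_left[OF sub[OF \<zeta>, of s t], of "\<psi> (z r)"] st
            by (intro integrable_diff) auto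
          then show "(\<lambda>x. (\<psi> (z r) - \<psi> (z x)) * \<zeta> x) integrable_on {s..t}"
            by (simp add: left_diff_distrib)
          show "(\<lambda>x. e * \<bar>\<zeta> x\<bar>) integrable_on {s..t}"
            using integrable_on_cmult_left[OF sub[OF asub, of s t], of e] st by simp
          fix x assume x: "x \<in> {s..t}"
          then have "dist (\<psi> (z r)) (\<psi> (z x)) < e"
            using r st by (intro \<delta>) (auto simp: dist_real_def)
          then show "norm ((\<psi> (z r) - \<psi> (z x)) * \<zeta> x) \<le> e * \<bar>\<zeta> x\<bar>"
            by (auto simp: dist_real_def abs_mult intro!: mult_right_mono)
        qed
        then show ?thesis by simp
      qed
      finally show ?thesis by simp
    qed
    \<comment> \<open>The interval is exhausted in steps of \<open>\<delta>/2\<close>; half of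
      \<open>\<delta>\<close> leaves room for the strict inequality in \<open>loc\<close>.\<close>
    have "\<forall>s. a \<le> s \<longrightarrow> s \<le> b \<longrightarrow> s \<le> a + n * (\<delta>/2) \<longrightarrow> \<bar>D a s\<bar> \<le> e * integral {a..s} (\<lambda>x. \<bar>\<zeta> x\<bar>)" for n :: nat
    proof (induction n)
      case 0
      then show ?case by (auto simp: D_def dest!: antisym)
    next
      case (Suc n)
      show ?case
      proof (intro allI impI)
        fix s assume s: "a \<le> s" "s \<le> b" "s \<le> a + real (Suc n) * (\<delta>/2)"
        define r where "r = max a (s - \<delta>/2)"
        have r: "a \<le> r" "r \<le> s" "s - r < \<delta>" using \<delta>(1) s by (auto simp: r_def)
        have "r \<le> a + n * (\<delta>/2)" using s(1,3) \<delta>(1) unfolding r_def of_nat_Suc distrib_right by (intro max.boundedI) auto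
        then have "\<bar>D a r\<bar> \<le> e * integral {a..r} (\<lambda>x. \<bar>\<zeta> x\<bar>)" using Suc r s by auto
        moreover have "\<bar>D r s\<bar> \<le> e * integral {r..s} (\<lambda>x. \<bar>\<zeta> x\<bar>)" using loc r s by auto
        moreover have "integral {a..r} (\<lambda>x. \<bar>\<zeta> x\<bar>) + integral {r..s} (\<lambda>x. \<bar>\<zeta> x\<bar>) = integral {a..s} (\<lambda>x. \<bar>\<zeta> x\<bar>)"
          using r s sub[OF asub, of a s] by (intro Henstock_Kurzweil_Integration.integral_combine) auto
        ultimately show "\<bar>D a s\<bar> \<le> e * integral {a..s} (\<lambda>x. \<bar>\<zeta> x\<bar>)"
          using Dadd[of a r s] r s abs_triangle_ineq[of "D a r" "D r s"] distrib_left[of e "integral {a..r} (\<lambda>x. \<bar>\<zeta> x\<bar>)" "integral {r..s} (\<lambda>x. \<bar>\<zeta> x\<bar>)"]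
            by simp
      qed
    qed
    moreover obtain n :: nat where "(b - a) / (\<delta>/2) \<le> n" using real_arch_simple by blast
    then have "b \<le> a + n * (\<delta>/2)" using \<delta>(1) by (simp add: field_simps)
    ultimately show ?thesis using ab by blast
  qed
  then have *: "\<bar>D a b\<bar> \<le> e * integral {a..b} (\<lambda>x. \<bar>\<zeta> x\<bar>)" if "e > 0" for e using that by blast
  have "D a b = 0"
  proof (rule ccontr)
    assume "D a b \<noteq> 0"
    have I: "integral {a..b} (\<lambda>x. \<bar>\<zeta> x\<bar>) \<ge> 0" by (intro integral_nonneg sub[OF asub]) auto
    \<comment> \<open>Makes \<open>e\<close> times the integral strictly smaller than the defect;
      the summand 1 covers a vanishing integral.\<close>
    define e where "e = \<bar>D a b\<bar> / (2 * (integral {a..b} (\<lambda>x. \<bar>\<zeta> x\<bar>) + 1))"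
    have "e > 0" using \<open>D a b \<noteq> 0\<close> I by (simp add: e_def)
    then have "e * integral {a..b} (\<lambda>x. \<bar>\<zeta> x\<bar>) < e * (2 * (integral {a..b} (\<lambda>x. \<bar>\<zeta> x\<bar>) + 1))"
      using I by simp
    also have "\<dots> = \<bar>D a b\<bar>" using I by (simp add: e_def)
    finally show False using *[OF \<open>e > 0\<close>] by linarith
  qed
  then show "integral {a..b} (\<lambda>s. \<psi> (z s) * \<zeta> s) = \<Psi> (z b) - \<Psi> (z a)" by (simp add: D_def)
qed

text \<open>Polarization: the chain rule for \<open>y^2 / 2\<close> is applied to \<open>f\<close>,
  \<open>g\<close> and \<open>f + g\<close>.\<close>

lemma product_rule_indefinite_integral:
  fixes f g f' g' :: "real \<Rightarrow> real"
  assumes f': "f' absolutely_integrable_on {a..b}" and g': "g' absolutely_integrable_on {a..b}" and ab: "a \<le> b"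
    and f: "\<And>s. s \<in> {a..b} \<Longrightarrow> f s = f a + integral {a..s} f'"
    and g: "\<And>s. s \<in> {a..b} \<Longrightarrow> g s = g a + integral {a..s} g'"
  shows "(\<lambda>s. f s * g' s + g s * f' s) absolutely_integrable_on {a..b}"
    and "integral {a..b} (\<lambda>s. f s * g' s + g s * f' s) = f b * g b - f a * g a"
proof -
  have cf: "continuous_on {a..b} f" by (rule continuous_on_indefinite_integral[OF f' f])
  have cg: "continuous_on {a..b} g" by (rule continuous_on_indefinite_integral[OF g' g])
  have sq: "integral {a..b} (\<lambda>s. h s * h' s) = (h b)\<^sup>2 / 2 - (h a)\<^sup>2 / 2"
    if h': "h' absolutely_integrable_on {a..b}" and h: "\<And>s. s \<in> {a..b} \<Longrightarrow> h s = h a + integral {a..s} h'" for h h' :: "real \<Rightarrow> real"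
  proof -
    have "bounded (h ` {a..b})"
      by (intro compact_imp_bounded compact_continuous_image continuous_on_indefinite_integral[OF h' h]) auto
    then obtain B where B: "\<forall>x\<in>{a..b}. \<bar>h x\<bar> \<le> B"
      unfolding bounded_iff by (metis imageI real_norm_def)
    have "h ` {a..b} \<subseteq> {-B..B}"
    proof (rule image_subsetI)
      fix x assume "x \<in> {a..b}"
      with B have "\<bar>h x\<bar> \<le> B" by blast
      then show "h x \<in> {-B..B}" by auto
    qed
    moreover have "((\<lambda>y. y\<^sup>2 / 2) has_real_derivative y) (at y within {-B..B})" for y
      by (auto intro!: derivative_eq_intros)
    ultimately show ?thesis
      using chain_rule_indefinite_integral(2)[OF h' ab h, of "-B" B "\<lambda>y. y\<^sup>2/2" "\<lambda>y. y"] by simp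
  qed
  show ai: "(\<lambda>s. f s * g' s + g s * f' s) absolutely_integrable_on {a..b}"
    by (intro set_integral_add absolutely_integrable_continuous_mult f' g' cf cg)
  have fg: "(\<lambda>s. f' s + g' s) absolutely_integrable_on {a..b}" using f' g' by (rule set_integral_add)
  have *: "f s + g s = f a + g a + integral {a..s} (\<lambda>x. f' x + g' x)" if "s \<in> {a..b}" for s
  proof -
    have "f' integrable_on {a..s}" "g' integrable_on {a..s}"
      using f' g' that by (meson absolutely_integrable_on_def absolutely_integrable_on_subinterval atLeastatMost_subset_iff atLeastAtMost_iff order_refl)+
    then show ?thesis using f[OF that] g[OF that]
      by (simp add: Henstock_Kurzweil_Integration.integral_add)
  qed
  have i: "(\<lambda>s. f s * f' s) integrable_on {a..b}" "(\<lambda>s. g s * g' s) integrable_on {a..b}"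
    "(\<lambda>s. f s * g' s + g s * f' s) integrable_on {a..b}"
    using absolutely_integrable_continuous_mult[OF f' cf] absolutely_integrable_continuous_mult[OF g' cg] ai
    by (auto simp: absolutely_integrable_on_def)
  have "integral {a..b} (\<lambda>s. (f s + g s) * (f' s + g' s)) =
      integral {a..b} (\<lambda>s. (f s * f' s + g s * g' s) + (f s * g' s + g s * f' s))"
    by (simp add: algebra_simps)
  also have "\<dots> = integral {a..b} (\<lambda>s. f s * f' s) + integral {a..b} (\<lambda>s. g s * g' s)
      + integral {a..b} (\<lambda>s. f s * g' s + g s * f' s)"
    using i by (simp add: Henstock_Kurzweil_Integration.integral_add integrable_add)
  finally have "(f b + g b)\<^sup>2 / 2 - (f a + g a)\<^sup>2 / 2 =
      ((f b)\<^sup>2 / 2 - (f a)\<^sup>2 / 2) + ((g b)\<^sup>2 / 2 - (g a)\<^sup>2 / 2)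
      + integral {a..b} (\<lambda>s. f s * g' s + g s * f' s)"
    using sq[where h="\<lambda>s. f s + g s", OF fg *] sq[OF f' f] sq[OF g' g] by simp
  then show "integral {a..b} (\<lambda>s. f s * g' s + g s * f' s) = f b * g b - f a * g a"
    unfolding power2_sum add_divide_distrib by simp
qed

section \<open>Weak derivatives\<close>

text \<open>\<open>k = 0\<close> is the classical smooth cutoff. The denominators
  \<open>x ^ k\<close> are included because differentiation produces them, which keeps the family
  closed up to linear combinations.\<close>

definition exp_inv :: "nat \<Rightarrow> real \<Rightarrow> real" where
  "exp_inv k x = (if x > 0 then exp (- (1 / x)) / x ^ k else 0)"

lemma exp_inv_limit: "(exp_inv k \<longlongrightarrow> 0) (at 0)"
proof -
  have "((\<lambda>x. (inverse x) ^ k / exp (inverse x)) \<longlongrightarrow> (0::real)) (at_right 0)"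
    by (rule filterlim_compose[OF tendsto_power_div_exp_0 filterlim_inverse_at_top_right])
  moreover have "\<forall>\<^sub>F x in at_right 0. (inverse x) ^ k / exp (inverse x) = exp_inv k x"
    by (rule eventually_at_right_less[THEN eventually_mono])
       (simp add: exp_inv_def exp_minus divide_inverse power_inverse mult.commute)
  ultimately have "(exp_inv k \<longlongrightarrow> 0) (at_right 0)"
    by (rule Lim_transform_eventually)
  moreover have "(exp_inv k \<longlongrightarrow> 0) (at_left 0)"
  proof -
    have "\<forall>\<^sub>F x in at_left 0. 0 = exp_inv k x"
      unfolding eventually_at_filter by (simp add: exp_inv_def)
    with tendsto_const show ?thesis by (rule Lim_transform_eventually)
  qed
  ultimately show ?thesis by (simp add: filterlim_split_at)
qed

lemma exp_inv_deriv:
  "(exp_inv k has_real_derivative (exp_inv (k + 2) x - real k * exp_inv (k + 1) x)) (at x)"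
proof (cases x "0::real" rule: linorder_cases)
  case less
  have "((\<lambda>x. 0) has_real_derivative 0) (at x)" by simp
  then have "(exp_inv k has_real_derivative 0) (at x)"
    by (rule has_field_derivative_transform_within_open[where S="{..<0}"]) (use less in \<open>auto simp: exp_inv_def\<close>)
  then show ?thesis using less by (simp add: exp_inv_def)
next
  case equal
  \<comment> \<open>At 0 the difference quotient is again a member of the family, so
    \<open>exp_inv_limit\<close> settles both sides at once.\<close>
  have "(\<lambda>h. (exp_inv k (0 + h) - exp_inv k 0) / h) = exp_inv (Suc k)"
    by (auto simp: exp_inv_def fun_eq_iff)
  then have "(exp_inv k has_real_derivative 0) (at 0)"
    using exp_inv_limit[of "Suc k"] by (simp add: DERIV_def)
  then show ?thesis using equal by (simp add: exp_inv_def)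
next
  case greater
  define P where "P = x ^ k"
  have P: "P \<noteq> 0" using greater by (simp add: P_def)
  have 1: "((\<lambda>x. exp (- (1 / x))) has_real_derivative exp (- (1 / x)) / (x * x)) (at x)"
    using greater by (auto intro!: derivative_eq_intros simp: power2_eq_square)
  have "((\<lambda>x. x ^ k) has_real_derivative real k * x ^ (k - 1)) (at x)"
    using DERIV_pow[of k x] by auto
  moreover have "real k * x ^ (k - 1) = real k * P / x"
    using greater by (cases k) (auto simp: P_def)
  ultimately have 2: "((\<lambda>x. x ^ k) has_real_derivative real k * P / x) (at x)" by metis
  have "((\<lambda>x. exp (- (1 / x)) / x ^ k) has_real_derivative
      (exp (- (1 / x)) / (x * x) * P - exp (- (1 / x)) * (real k * P / x)) / (P * P)) (at x)"
    using DERIV_divide[OF 1 2] P by (simp add: P_def)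
  also have "(exp (- (1 / x)) / (x * x) * P - exp (- (1 / x)) * (real k * P / x)) / (P * P)
     = exp (- (1 / x)) / (P * (x * x)) - real k * (exp (- (1 / x)) / (P * x))"
    using greater P by (simp add: divide_simps) (simp add: algebra_simps)
  also have "\<dots> = exp_inv (k + 2) x - real k * exp_inv (k + 1) x"
    using greater by (simp add: exp_inv_def P_def power2_eq_square mult.commute mult.left_commute)
  finally have "((\<lambda>x. exp (- (1 / x)) / x ^ k) has_real_derivative
      (exp_inv (k + 2) x - real k * exp_inv (k + 1) x)) (at x)" .
  then show ?thesis
    by (rule has_field_derivative_transform_within_open[where S="{0<..}"]) (use greater in \<open>auto simp: exp_inv_def\<close>)
qed

text \<open>A class of smooth functions that is closed under differentiation, so that iterated
  derivatives need never be computed.\<close>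

inductive exp_inv_alg :: "(real \<Rightarrow> real) \<Rightarrow> bool" where
  base: "exp_inv_alg (\<lambda>x. exp_inv k (c * x + d))"
| const: "exp_inv_alg (\<lambda>x. c)"
| add: "exp_inv_alg f \<Longrightarrow> exp_inv_alg g \<Longrightarrow> exp_inv_alg (\<lambda>x. f x + g x)"
| mult: "exp_inv_alg f \<Longrightarrow> exp_inv_alg g \<Longrightarrow> exp_inv_alg (\<lambda>x. f x * g x)"

lemma exp_inv_alg_deriv:
  "exp_inv_alg f \<Longrightarrow> \<exists>f'. exp_inv_alg f' \<and> (\<forall>x. (f has_real_derivative f' x) (at x))"
proof (induction rule: exp_inv_alg.induct)
  case (base k c d)
  have "((\<lambda>x. exp_inv k (c * x + d)) has_real_derivative
      c * exp_inv (k + 2) (c * x + d) + (- real k * c) * exp_inv (k + 1) (c * x + d)) (at x)" for x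
    by (rule DERIV_chain2[OF exp_inv_deriv, THEN DERIV_cong])
       (auto intro!: derivative_eq_intros simp: algebra_simps)
  moreover have "exp_inv_alg (\<lambda>x. c * exp_inv (k + 2) (c * x + d) + (- real k * c) * exp_inv (k + 1) (c * x + d))"
    by (intro exp_inv_alg.intros)
  ultimately show ?case by blast
next
  case (const c)
  show ?case by (intro exI[of _ "\<lambda>x. 0"]) (auto intro: exp_inv_alg.intros)
next
  case (add f g)
  then obtain f' g' where "exp_inv_alg f'" "exp_inv_alg g'"
    "\<And>x. (f has_real_derivative f' x) (at x)" "\<And>x. (g has_real_derivative g' x) (at x)" by blast
  then show ?case
    by (intro exI[of _ "\<lambda>x. f' x + g' x"]) (auto intro: exp_inv_alg.intros derivative_intros)
next
  case (mult f g)
  then obtain f' g' where "exp_inv_alg f'" "exp_inv_alg g'"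
    "\<And>x. (f has_real_derivative f' x) (at x)" "\<And>x. (g has_real_derivative g' x) (at x)" by blast
  with mult.hyps show ?case
    by (intro exI[of _ "\<lambda>x. f' x * g x + g' x * f x"]) (auto intro: exp_inv_alg.intros DERIV_mult)
qed

lemma exp_inv_alg_iterate: "exp_inv_alg f \<Longrightarrow> exp_inv_alg ((deriv ^^ n) f)"
proof (induction n)
  case (Suc n)
  then obtain f' where "exp_inv_alg f'" "\<And>x. ((deriv ^^ n) f has_real_derivative f' x) (at x)"
    using exp_inv_alg_deriv by blast
  then have "deriv ((deriv ^^ n) f) = f'" by (auto simp: fun_eq_iff intro: DERIV_imp_deriv)
  then show ?case using \<open>exp_inv_alg f'\<close> by simp
qed simp

lemma exp_inv_alg_smooth:
  assumes "exp_inv_alg f" shows "(deriv ^^ n) f differentiable (at x)"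
  using exp_inv_alg_deriv[OF exp_inv_alg_iterate[OF assms, of n]]
  using real_differentiable_def by blast

lemma exp_inv_alg_continuous: "exp_inv_alg f \<Longrightarrow> continuous_on S f"
  using exp_inv_alg_deriv by (meson DERIV_isCont continuous_at_imp_continuous_on)

lemma exp_inv_alg_test_function:
  assumes "exp_inv_alg \<phi>" "0 < s" "t < L" "\<And>x. x \<notin> {s..t} \<Longrightarrow> \<phi> x = 0"
  shows "test_function L \<phi>"
  unfolding test_function_def
  using assms by (auto simp: exp_inv_alg_smooth intro!: exI[of _ "{s..t}"])

text \<open>These functions stay below 1 and tend pointwise to the indicator of
  \<open>{s<..<t}\<close> as \<open>n\<close> grows. This lets test function identities pass to
  intervals by dominated convergence, without mollification.\<close>

definition bump :: "real \<Rightarrow> real \<Rightarrow> nat \<Rightarrow> real \<Rightarrow> real" where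
  "bump s t n x = exp_inv 0 (real (Suc n) * (x - s)) * exp_inv 0 (real (Suc n) * (t - x))"

lemma bump_alg: "exp_inv_alg (bump s t n)"
proof -
  have "bump s t n = (\<lambda>x. exp_inv 0 (real (Suc n) * x + - real (Suc n) * s)
      * exp_inv 0 (- real (Suc n) * x + real (Suc n) * t))"
    by (simp add: bump_def fun_eq_iff algebra_simps)
  then show ?thesis by (simp only:) (intro exp_inv_alg.intros)
qed

lemma bump_eq_0: "x \<notin> {s<..<t} \<Longrightarrow> bump s t n x = 0"
  by (auto simp: bump_def exp_inv_def zero_less_mult_iff)

lemma bump_pos: "x \<in> {s<..<t} \<Longrightarrow> bump s t n x > 0"
  by (auto simp: bump_def exp_inv_def)

lemma exp_inv_0_bounds: "0 \<le> exp_inv 0 x" "exp_inv 0 x \<le> 1"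
  by (auto simp: exp_inv_def)

lemma bump_bounds: "0 \<le> bump s t n x" "bump s t n x \<le> 1"
  by (auto simp: bump_def exp_inv_0_bounds mult_le_one)

lemma bump_tendsto:
  assumes "x \<in> {s<..<t}"
  shows "(\<lambda>n. bump s t n x) \<longlonglongrightarrow> 1"
proof -
  have *: "(\<lambda>n. exp_inv 0 (real (Suc n) * u)) \<longlonglongrightarrow> 1" if "u > 0" for u
  proof -
    have "(\<lambda>n. exp (- (inverse (real (Suc n)) / u))) \<longlonglongrightarrow> exp (- (0 / u))"
      by (intro tendsto_intros LIMSEQ_inverse_real_of_nat) (use that in auto)
    moreover have "exp (- (inverse (real (Suc n)) / u)) = exp_inv 0 (real (Suc n) * u)" for n
      using that by (simp add: exp_inv_def field_simps zero_less_mult_iff add_pos_nonneg)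
    ultimately show ?thesis by simp
  qed
  show ?thesis unfolding bump_def
    using tendsto_mult[OF *[of "x - s"] *[of "t - x"]] assms by simp
qed

section \<open>The fundamental lemma of the calculus of variations and uniqueness of weak
  derivatives\<close>

lemma scaleR_absolutely_integrable:
  fixes u :: "real \<Rightarrow> 'b::euclidean_space"
  assumes "u absolutely_integrable_on {s..t}" "continuous_on {s..t} \<phi>"
  shows "(\<lambda>x. \<phi> x *\<^sub>R u x) absolutely_integrable_on {s..t}"
  by (rule absolutely_integrable_bounded_measurable_product[OF bilinear_conv_bounded_bilinear[THEN iffD2, OF bounded_bilinear_scaleR]])
     (use assms in \<open>auto intro!: continuous_imp_measurable_on_sets_lebesgue compact_imp_bounded compact_continuous_image\<close>)

lemma LINT_eq_integral_subinterval:
  fixes g :: "real \<Rightarrow> 'b::euclidean_space"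
  assumes g: "g absolutely_integrable_on {s..t}" and st: "0 < s" "t < L"
    and z: "\<And>x. x \<notin> {s..t} \<Longrightarrow> g x = 0"
  shows "integrable (lebesgue_on {0<..<L}) g" "(LINT x|lebesgue_on {0<..<L}. g x) = integral {s..t} g"
proof -
  have eq: "indicator {0<..<L} x *\<^sub>R g x = indicator {s..t} x *\<^sub>R g x" for x
    using z[of x] st by (cases "x \<in> {s..t}") (auto simp: indicator_def)
  show "integrable (lebesgue_on {0<..<L}) g"
    using g by (simp add: integrable_restrict_space set_integrable_def eq)
  have "(LINT x|lebesgue_on {0<..<L}. g x) = (LINT x|lebesgue. indicator {0<..<L} x *\<^sub>R g x)"
    by (rule integral_restrict_space) simp
  also have "\<dots> = (LINT x:{s..t}|lebesgue. g x)"
    by (simp only: eq set_lebesgue_integral_def)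
  also have "\<dots> = integral {s..t} g"
    by (rule set_lebesgue_integral_eq_integral(2)[OF g])
  finally show "(LINT x|lebesgue_on {0<..<L}. g x) = integral {s..t} g" .
qed

lemma locally_integrable_Icc:
  assumes "locally_integrable L f" "0 < s" "t < L"
  shows "f absolutely_integrable_on {s..t}"
proof -
  have "{s..t} \<subseteq> {0<..<L}" using assms(2,3) by auto
  then show ?thesis using assms(1) compact_Icc unfolding locally_integrable_def by blast
qed

lemma locally_integrable_diff:
  "locally_integrable L f \<Longrightarrow> locally_integrable L g \<Longrightarrow> locally_integrable L (\<lambda>x. f x - g x)"
  unfolding locally_integrable_def by auto

lemma locally_integrable_cong_AE:
  assumes "locally_integrable L f" "AE x in lebesgue. x \<in> {0<..<L} \<longrightarrow> f x = g x"
  shows "locally_integrable L g"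
  unfolding locally_integrable_def
proof safe
  fix K assume K: "compact K" "K \<subseteq> {0<..<L}"
  obtain N where neg: "negligible N" and N: "{x. \<not> (x \<in> {0<..<L} \<longrightarrow> f x = g x)} \<subseteq> N"
    using assms(2) unfolding eventually_ae_filter_negligible by blast
  have "f absolutely_integrable_on K" using assms(1) K unfolding locally_integrable_def by blast
  then show "g absolutely_integrable_on K"
    by (rule absolutely_integrable_spike[OF _ neg]) (use K N in fastforce)
qed

text \<open>Dominated convergence replaces the bumps by indicators of intervals, which reduces the
  fundamental lemma to \<open>AE_zero_if_integral_intervals_zero\<close>.\<close>

lemma AE_zero_if_bump_integrals_zero:
  assumes u: "locally_integrable L u"
    and 0: "\<And>s t n. 0 < s \<Longrightarrow> s \<le> t \<Longrightarrow> t < L \<Longrightarrow> (LINT x|lebesgue_on {0<..<L}. bump s t n x *\<^sub>R u x) = 0"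
  shows "AE x in lebesgue. x \<in> {0<..<L} \<longrightarrow> u x = 0"
proof (rule AE_zero_if_integral_intervals_zero)
  fix s t assume st: "0 < s" "s \<le> t" "t < L"
  show ai: "u absolutely_integrable_on {s..t}" by (rule locally_integrable_Icc[OF u st(1,3)])
  have ab: "(\<lambda>x. bump s t n x *\<^sub>R u x) absolutely_integrable_on {s..t}" for n
    by (rule scaleR_absolutely_integrable[OF ai exp_inv_alg_continuous[OF bump_alg]])
  have *: "integral {s..t} (\<lambda>x. bump s t n x *\<^sub>R u x) = 0" for n
  proof -
    have "(LINT x|lebesgue_on {0<..<L}. bump s t n x *\<^sub>R u x) = integral {s..t} (\<lambda>x. bump s t n x *\<^sub>R u x)"
      by (rule LINT_eq_integral_subinterval(2)[OF ab st(1,3)]) (auto intro: bump_eq_0)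
    then show ?thesis using 0[OF st] by simp
  qed
  have "(\<lambda>n. integral {s<..<t} (\<lambda>x. bump s t n x *\<^sub>R u x)) \<longlonglongrightarrow> integral {s<..<t} u"
  proof (rule dominated_convergence(2)[where h="\<lambda>x. norm (u x)"])
    show "(\<lambda>x. bump s t k x *\<^sub>R u x) integrable_on {s<..<t}" for k
      using ab[of k] by (simp add: absolutely_integrable_on_def integrable_on_Icc_iff_Ioo)
    show "(\<lambda>x. norm (u x)) integrable_on {s<..<t}"
      using ai by (simp add: absolutely_integrable_on_def integrable_on_Icc_iff_Ioo)
    show "norm (bump s t k x *\<^sub>R u x) \<le> norm (u x)" for k x
      using bump_bounds[of s t k x] by (simp add: mult_left_le_one_le)
    show "(\<lambda>k. bump s t k x *\<^sub>R u x) \<longlonglongrightarrow> u x" if "x \<in> {s<..<t}" for x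
      using tendsto_scaleR[OF bump_tendsto[OF that] tendsto_const[of "u x"]] by simp
  qed
  then show "integral {s..t} u = 0"
    using * by (simp add: integral_open_interval_real LIMSEQ_const_iff)
qed

lemma has_weak_deriv_unique:
  assumes "has_weak_deriv L f g1" "has_weak_deriv L f g2"
  shows "AE x in lebesgue. x \<in> {0<..<L} \<longrightarrow> g1 x = g2 x"
proof -
  have l: "locally_integrable L g1" "locally_integrable L g2"
    using assms by (auto simp: has_weak_deriv_def)
  have "AE x in lebesgue. x \<in> {0<..<L} \<longrightarrow> g1 x - g2 x = 0"
  proof (rule AE_zero_if_bump_integrals_zero[OF locally_integrable_diff[OF l]])
    fix s t :: real and n assume st: "0 < s" "s \<le> t" "t < L"
    have test: "test_function L (bump s t n)"
      by (rule exp_inv_alg_test_function[OF bump_alg st(1,3)]) (auto intro: bump_eq_0)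
    have i: "integrable (lebesgue_on {0<..<L}) (\<lambda>x. bump s t n x *\<^sub>R g x)" if "locally_integrable L g" for g
      using st that by (intro LINT_eq_integral_subinterval[where s=s and t=t] scaleR_absolutely_integrable
        locally_integrable_Icc exp_inv_alg_continuous[OF bump_alg]) (auto intro: bump_eq_0)
    have "(LINT x|lebesgue_on {0<..<L}. bump s t n x *\<^sub>R (g1 x - g2 x)) =
        (LINT x|lebesgue_on {0<..<L}. bump s t n x *\<^sub>R g1 x) - (LINT x|lebesgue_on {0<..<L}. bump s t n x *\<^sub>R g2 x)"
      using i l by (simp add: scaleR_diff_right)
    also have "\<dots> = 0" using assms test unfolding has_weak_deriv_def by auto
    finally show "(LINT x|lebesgue_on {0<..<L}. bump s t n x *\<^sub>R (g1 x - g2 x)) = 0" .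
  qed
  then show ?thesis by simp
qed

text \<open>\<open>weak_deriv\<close> picks an arbitrary representative; existence and uniqueness
  almost everywhere are the only access to it.\<close>

lemma weak_deriv_AE:
  assumes "has_weak_deriv L f g"
  shows "has_weak_deriv L f (weak_deriv L f)" "AE x in lebesgue. x \<in> {0<..<L} \<longrightarrow> weak_deriv L f x = g x"
proof -
  show *: "has_weak_deriv L f (weak_deriv L f)" unfolding weak_deriv_def using assms by (rule someI[where P="has_weak_deriv L f"])
  show "AE x in lebesgue. x \<in> {0<..<L} \<longrightarrow> weak_deriv L f x = g x"
    by (rule has_weak_deriv_unique[OF * assms])
qed

lemma test_function_support:
  assumes "test_function L \<phi>" "L > 0"
  obtains s t where "0 < s" "s \<le> t" "t < L" "\<And>x. x \<notin> {s..t} \<Longrightarrow> \<phi> x = 0" "\<And>x. x \<notin> {s..t} \<Longrightarrow> deriv \<phi> x = 0"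
    "\<And>x. (\<phi> has_real_derivative deriv \<phi> x) (at x)" "\<And>S. continuous_on S (deriv \<phi>)"
proof -
  obtain K where K: "compact K" "K \<subseteq> {0<..<L}" "\<And>x. x \<notin> K \<Longrightarrow> \<phi> x = 0"
    and diff: "\<And>n x. (deriv ^^ n) \<phi> differentiable (at x)"
    using assms(1) unfolding test_function_def by blast
  have "\<exists>s t. 0 < s \<and> s \<le> t \<and> t < L \<and> K \<subseteq> {s..t}"
  proof (cases "K = {}")
    case True
    then show ?thesis using \<open>L > 0\<close> by (intro exI[of _ "L/2"]) auto
  next
    case False
    have "Inf K \<in> K" "Sup K \<in> K" using K(1) False
      by (intro closed_contains_Inf closed_contains_Sup compact_imp_closed bounded_imp_bdd_below bounded_imp_bdd_above compact_imp_bounded; simp)+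
    moreover have "K \<subseteq> {Inf K..Sup K}"
      using K(1) by (auto intro!: cInf_lower cSup_upper bounded_imp_bdd_below bounded_imp_bdd_above compact_imp_bounded)
    ultimately show ?thesis using K(2) by (intro exI[of _ "Inf K"] exI[of _ "Sup K"]) auto
  qed
  then obtain s t where st: "0 < s" "s \<le> t" "t < L" "K \<subseteq> {s..t}" by blast
  have z: "\<phi> x = 0" if "x \<notin> {s..t}" for x using K(3) st(4) that by blast
  show thesis
  proof (rule that[OF st(1-3) z])
    show der: "(\<phi> has_real_derivative deriv \<phi> x) (at x)" for x
      using diff[of 0 x] by (simp add: DERIV_deriv_iff_real_differentiable)
    show "continuous_on S (deriv \<phi>)" for S
      using diff[of 1] by (auto intro!: continuous_at_imp_continuous_on differentiable_imp_continuous_within)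
    show "deriv \<phi> x = 0" if x: "x \<notin> {s..t}" for x
    proof -
      have "((\<lambda>x. 0) has_real_derivative 0) (at x)" by simp
      then have "(\<phi> has_real_derivative 0) (at x)"
        by (rule has_field_derivative_transform_within_open[where S="- {s..t}"]) (use x z in auto)
      then show ?thesis by (rule DERIV_imp_deriv)
    qed
  qed
qed

lemma test_function_integrals:
  assumes "test_function L \<phi>" "L > 0" "locally_integrable L f"
  shows "integrable (lebesgue_on {0<..<L}) (\<lambda>x. \<phi> x *\<^sub>R f x)"
    and "integrable (lebesgue_on {0<..<L}) (\<lambda>x. deriv \<phi> x *\<^sub>R f x)"
proof -
  obtain s t where st: "0 < s" "s \<le> t" "t < L" and z: "\<And>x. x \<notin> {s..t} \<Longrightarrow> \<phi> x = 0" "\<And>x. x \<notin> {s..t} \<Longrightarrow> deriv \<phi> x = 0"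
    and c: "\<And>x. (\<phi> has_real_derivative deriv \<phi> x) (at x)" "\<And>S. continuous_on S (deriv \<phi>)"
    using test_function_support[OF assms(1,2)] by metis
  have "continuous_on S \<phi>" for S using c(1) by (meson DERIV_isCont continuous_at_imp_continuous_on)
  with c(2) st z locally_integrable_Icc[OF assms(3)]
  show "integrable (lebesgue_on {0<..<L}) (\<lambda>x. \<phi> x *\<^sub>R f x)"
    "integrable (lebesgue_on {0<..<L}) (\<lambda>x. deriv \<phi> x *\<^sub>R f x)"
    by (auto intro!: LINT_eq_integral_subinterval[where s=s and t=t] scaleR_absolutely_integrable)
qed

text \<open>Second weak derivatives are taken of the chosen representative
  \<open>weak_deriv L f\<close>, whereas membership in \<open>W2p\<close> is witnessed by some other
  function; this moves from one to the other.\<close>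

lemma has_weak_deriv_cong_AE:
  assumes f: "has_weak_deriv L f g" and "AE x in lebesgue. x \<in> {0<..<L} \<longrightarrow> f x = f' x" and L: "L > 0"
  shows "has_weak_deriv L f' g"
  unfolding has_weak_deriv_def
proof (intro conjI allI impI)
  show f': "locally_integrable L f'" and "locally_integrable L g"
    using f locally_integrable_cong_AE[OF _ assms(2)] by (auto simp: has_weak_deriv_def)
  have lf: "locally_integrable L f" using f by (simp add: has_weak_deriv_def)
  fix \<phi> assume \<phi>: "test_function L \<phi>"
  have AE: "AE x in lebesgue_on {0<..<L}. f' x = f x"
    using assms(2) by (subst AE_restrict_space_iff) (auto elim: eventually_mono)
  have "(LINT x|lebesgue_on {0<..<L}. deriv \<phi> x *\<^sub>R f' x) = (LINT x|lebesgue_on {0<..<L}. deriv \<phi> x *\<^sub>R f x)"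
    by (rule integral_cong_AE)
       (use test_function_integrals(2)[OF \<phi> L] lf f' AE in \<open>auto elim: eventually_mono intro: borel_measurable_integrable\<close>)
  then show "(LINT x|lebesgue_on {0<..<L}. deriv \<phi> x *\<^sub>R f' x) = - (LINT x|lebesgue_on {0<..<L}. \<phi> x *\<^sub>R g x)"
    using f \<phi> by (simp add: has_weak_deriv_def)
qed

lemma has_weak_deriv_diff:
  assumes f: "has_weak_deriv L f1 g1" "has_weak_deriv L f2 g2" and L: "L > 0"
  shows "has_weak_deriv L (\<lambda>x. f1 x - f2 x) (\<lambda>x. g1 x - g2 x)"
  unfolding has_weak_deriv_def
proof (intro conjI allI impI)
  have l: "locally_integrable L f1" "locally_integrable L f2" "locally_integrable L g1" "locally_integrable L g2"
    using f by (auto simp: has_weak_deriv_def)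
  then show "locally_integrable L (\<lambda>x. f1 x - f2 x)" "locally_integrable L (\<lambda>x. g1 x - g2 x)"
    by (auto intro: locally_integrable_diff)
  fix \<phi> assume \<phi>: "test_function L \<phi>"
  show "(LINT x|lebesgue_on {0<..<L}. deriv \<phi> x *\<^sub>R (f1 x - f2 x)) = - (LINT x|lebesgue_on {0<..<L}. \<phi> x *\<^sub>R (g1 x - g2 x))"
    using f \<phi> l by (simp add: scaleR_diff_right test_function_integrals[OF \<phi> L] has_weak_deriv_def)
qed

text \<open>Du Bois-Reymond: any bump minus a multiple of a fixed one of unit integral is the
  derivative of a test function.\<close>

lemma weak_deriv_indefinite_integral:
  assumes fg: "has_weak_deriv L f g" and g: "g absolutely_integrable_on {0..L}" and L: "L > 0"
  shows "\<exists>c. AE x in lebesgue. x \<in> {0<..<L} \<longrightarrow> f x = c + integral {0..x} g"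
proof -
  define F where "F x = integral {0..x} g" for x
  have gi: "g integrable_on {0..L}" using g by (simp add: absolutely_integrable_on_def)
  have cF: "continuous_on {0..L} F"
    unfolding F_def by (rule indefinite_integral_continuous_1[OF gi])
  have lF: "locally_integrable L F"
    unfolding locally_integrable_def
  proof safe
    fix K assume K: "compact K" "K \<subseteq> {0<..<L}"
    have "F absolutely_integrable_on {0..L}" using cF by (rule absolutely_integrable_continuous_real)
    then show "F absolutely_integrable_on K"
      by (rule set_integrable_subset) (use K lmeasurable_compact in \<open>auto simp: fmeasurable_def\<close>)
  qed
  have lf: "locally_integrable L f" using fg by (simp add: has_weak_deriv_def)
  \<comment> \<open>The indefinite integral \<open>F\<close> also has the weak derivative
    \<open>g\<close>: the product rule in each coordinate, with boundary terms that vanish because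
    \<open>\<phi>\<close> does. Hence \<open>h = f - F\<close> below has weak derivative
    zero.\<close>
  have ibp: "(LINT x|lebesgue_on {0<..<L}. deriv \<phi> x *\<^sub>R F x) = - (LINT x|lebesgue_on {0<..<L}. \<phi> x *\<^sub>R g x)"
    if \<phi>: "test_function L \<phi>" for \<phi>
  proof -
    have lg: "locally_integrable L g" using fg by (simp add: has_weak_deriv_def)
    obtain s t where st: "0 < s" "s \<le> t" "t < L" and z: "\<And>x. x \<notin> {s..t} \<Longrightarrow> \<phi> x = 0" "\<And>x. x \<notin> {s..t} \<Longrightarrow> deriv \<phi> x = 0"
      and c: "\<And>x. (\<phi> has_real_derivative deriv \<phi> x) (at x)" "\<And>S. continuous_on S (deriv \<phi>)"
      using test_function_support[OF \<phi> L] by metis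
    have c\<phi>: "continuous_on S \<phi>" for S using c(1) by (meson DERIV_isCont continuous_at_imp_continuous_on)
    have ai: "(\<lambda>x. \<phi> x *\<^sub>R g x) absolutely_integrable_on {0..L}" "(\<lambda>x. deriv \<phi> x *\<^sub>R F x) absolutely_integrable_on {0..L}"
      using g absolutely_integrable_continuous_real[OF cF] c\<phi> c(2) by (auto intro: scaleR_absolutely_integrable)
    have LI: "(LINT x|lebesgue_on {0<..<L}. h x) = integral {0..L} h" if "h absolutely_integrable_on {0..L}" for h :: "real \<Rightarrow> real^2"
    proof -
      have "h absolutely_integrable_on {0<..<L}" using that by (simp add: absolutely_integrable_on_Icc_iff_Ioo)
      then have "(LINT x|lebesgue_on {0<..<L}. h x) = integral {0<..<L} h"
        by (intro lebesgue_integral_eq_integral absolutely_integrable_imp_integrable) auto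
      then show ?thesis by (simp add: integral_open_interval_real)
    qed
    have "integral {0..L} (\<lambda>x. \<phi> x *\<^sub>R g x) + integral {0..L} (\<lambda>x. deriv \<phi> x *\<^sub>R F x) = 0"
    proof (rule euclidean_eqI)
      fix b :: "real^2" assume b: "b \<in> Basis"
      have gb: "(\<lambda>x. g x \<bullet> b) absolutely_integrable_on {0..L}"
        using g b by (simp add: absolutely_integrable_component)
      have db: "deriv \<phi> absolutely_integrable_on {0..L}" by (rule absolutely_integrable_continuous_real[OF c(2)])
      have p: "integral {0..L} (\<lambda>x. \<phi> x * (g x \<bullet> b) + (F x \<bullet> b) * deriv \<phi> x) = \<phi> L * (F L \<bullet> b) - \<phi> 0 * (F 0 \<bullet> b)"
      proof (rule product_rule_indefinite_integral(2)[OF db gb])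
        fix x assume x: "x \<in> {0..L}"
        have "(deriv \<phi> has_integral \<phi> x - \<phi> 0) {0..x}"
          by (rule fundamental_theorem_of_calculus)
             (use x c(1) in \<open>auto simp: has_real_derivative_iff_has_vector_derivative[symmetric] intro: DERIV_subset\<close>)
        then show "\<phi> x = \<phi> 0 + integral {0..x} (deriv \<phi>)" by (simp add: integral_unique)
        have "g integrable_on {0..x}" using gi x by (auto intro: integrable_subinterval_real)
        then show "F x \<bullet> b = F 0 \<bullet> b + integral {0..x} (\<lambda>x. g x \<bullet> b)"
          using b by (simp add: F_def integral_component_eq)
      qed (use L in simp)
      have "integral {0..L} (\<lambda>x. \<phi> x * (g x \<bullet> b) + (F x \<bullet> b) * deriv \<phi> x) = 0"
        unfolding p using z(1)[of 0] z(1)[of L] st by simp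
      moreover have "integral {0..L} (\<lambda>x. \<phi> x * (g x \<bullet> b) + (F x \<bullet> b) * deriv \<phi> x) =
         integral {0..L} (\<lambda>x. \<phi> x *\<^sub>R g x + deriv \<phi> x *\<^sub>R F x) \<bullet> b"
        using ai b by (subst integral_component_eq[symmetric])
          (auto simp: inner_add_left mult.commute absolutely_integrable_on_def intro: integrable_add)
      ultimately show "(integral {0..L} (\<lambda>x. \<phi> x *\<^sub>R g x) + integral {0..L} (\<lambda>x. deriv \<phi> x *\<^sub>R F x)) \<bullet> b = 0 \<bullet> b"
        using ai by (simp add: Henstock_Kurzweil_Integration.integral_add absolutely_integrable_on_def)
    qed
    then show ?thesis using LI[OF ai(1)] LI[OF ai(2)] by (simp add: add_eq_0_iff)
  qed
  define h where "h x = f x - F x" for x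
  have lh: "locally_integrable L h" unfolding h_def by (rule locally_integrable_diff[OF lf lF])
  have h0: "(LINT x|lebesgue_on {0<..<L}. deriv \<phi> x *\<^sub>R h x) = 0" if \<phi>: "test_function L \<phi>" for \<phi>
    using ibp[OF \<phi>] fg \<phi> test_function_integrals(2)[OF \<phi> L lf] test_function_integrals(2)[OF \<phi> L lF]
    by (simp add: h_def scaleR_diff_right has_weak_deriv_def)
  \<comment> \<open>A function of the class with integral zero has a compactly supported primitive,
    and this primitive is an admissible test function.\<close>
  have key: "(LINT x|lebesgue_on {0<..<L}. \<psi> x *\<^sub>R h x) = 0"
    if \<psi>: "exp_inv_alg \<psi>" and st: "0 < s" "s \<le> t" "t < L" and z: "\<And>x. x \<notin> {s..t} \<Longrightarrow> \<psi> x = 0"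
      and I0: "integral {s..t} \<psi> = 0" for \<psi> s t
  proof -
    have c: "continuous_on S \<psi>" for S by (rule exp_inv_alg_continuous[OF \<psi>])
    have "\<exists>F. \<forall>x. -\<infinity> < ereal x \<longrightarrow> ereal x < \<infinity> \<longrightarrow> (F has_vector_derivative \<psi> x) (at x)"
      by (rule einterval_antiderivative) (use c[of UNIV] in \<open>auto simp: continuous_on_eq_continuous_at\<close>)
    then obtain G where G: "\<And>x. (G has_real_derivative \<psi> x) (at x)"
      by (auto simp: has_real_derivative_iff_has_vector_derivative)
    define \<phi> where "\<phi> x = G x - G s" for x
    have d: "(\<phi> has_real_derivative \<psi> x) (at x)" for x
      unfolding \<phi>_def using DERIV_diff[OF G DERIV_const] by simp
    have FT: "(\<psi> has_integral \<phi> y - \<phi> x) {x..y}" if "x \<le> y" for x y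
      by (rule fundamental_theorem_of_calculus)
         (use that d in \<open>auto simp: has_real_derivative_iff_has_vector_derivative[symmetric] intro: DERIV_subset\<close>)
    have const: "\<phi> y = \<phi> x" if "x \<le> y" "{x<..<y} \<inter> {s..t} = {}" for x y
    proof -
      have "integral {x..y} \<psi> = integral {x<..<y} \<psi>" by (simp add: integral_open_interval_real)
      also have "\<dots> = integral {x<..<y} (\<lambda>x. 0)"
        by (rule Henstock_Kurzweil_Integration.integral_cong) (use that z in blast)
      finally show ?thesis using integral_unique[OF FT[OF that(1)]] by simp
    qed
    have "\<phi> s = 0" by (simp add: \<phi>_def)
    have t0: "\<phi> t = 0" using integral_unique[OF FT[OF st(2)]] I0 \<open>\<phi> s = 0\<close> by simp
    have z\<phi>: "\<phi> x = 0" if "x \<notin> {s..t}" for x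
    proof (cases "x < s")
      case True
      moreover have "{x<..<s} \<inter> {s..t} = {}" by auto
      ultimately show ?thesis using const[of x s] \<open>\<phi> s = 0\<close> by simp
    next
      case False
      moreover have "{t<..<x} \<inter> {s..t} = {}" by auto
      ultimately show ?thesis using const[of t x] that t0 by simp
    qed
    have d\<phi>: "deriv \<phi> = \<psi>" using d by (auto simp: fun_eq_iff intro: DERIV_imp_deriv)
    have "(deriv ^^ n) \<phi> differentiable (at x)" for n x
    proof (cases n)
      case 0 then show ?thesis using d real_differentiable_def by auto
    next
      case (Suc m) then show ?thesis using exp_inv_alg_smooth[OF \<psi>, of m x] by (simp add: funpow_swap1 d\<phi> del: funpow.simps add: funpow_Suc_right)
    qed
    then have "test_function L \<phi>" unfolding test_function_def
      using z\<phi> st by (auto intro!: exI[of _ "{s..t}"])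
    from h0[OF this] show ?thesis by (simp add: d\<phi>)
  qed
  \<comment> \<open>The fixed bump \<open>\<beta>\<close> lives on the middle third; the constant
    \<open>c\<close> below is the mean of \<open>h\<close> weighted by it.\<close>
  define a b where "a = L/3" and "b = 2*L/3"
  have ab: "0 < a" "a < b" "b < L" using L by (auto simp: a_def b_def)
  define \<beta> where "\<beta> = bump a b 0"
  have c\<beta>: "continuous_on S \<beta>" for S unfolding \<beta>_def by (rule exp_inv_alg_continuous[OF bump_alg])
  define I where "I = integral {a..b} \<beta>"
  have "I > 0"
  proof -
    have "I \<noteq> 0"
    proof
      assume "I = 0"
      then have "(\<beta> has_integral 0) (cbox a b)"
        using integrable_integral[OF integrable_continuous_real[OF c\<beta>[of "{a..b}"]]] by (simp add: I_def)
      then have "\<beta> ((a+b)/2) = 0"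
        by (rule has_integral_0_cbox_imp_0[rotated 2]) (use c\<beta> ab in \<open>auto simp: \<beta>_def bump_bounds\<close>)
      then show False using bump_pos[of "(a+b)/2" a b 0] ab by (simp add: \<beta>_def)
    qed
    moreover have "I \<ge> 0" unfolding I_def \<beta>_def
      by (rule integral_nonneg[OF integrable_continuous_real[OF exp_inv_alg_continuous[OF bump_alg]]]) (simp add: bump_bounds)
    ultimately show ?thesis by simp
  qed
  define c where "c = (1/I) *\<^sub>R (LINT x|lebesgue_on {0<..<L}. \<beta> x *\<^sub>R h x)"
  have lc: "locally_integrable L (\<lambda>x. c)" unfolding locally_integrable_def
    by (auto intro!: absolutely_integrable_on_const lmeasurable_compact)
  have "AE x in lebesgue. x \<in> {0<..<L} \<longrightarrow> h x - c = 0"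
  proof (rule AE_zero_if_bump_integrals_zero[OF locally_integrable_diff[OF lh lc]])
    fix s t :: real and n assume st: "0 < s" "s \<le> t" "t < L"
    define J where "J = integral {s..t} (bump s t n)"
    \<comment> \<open>One interval containing the supports of both bumps, so that \<open>key\<close>
      applies to their combination \<open>\<psi>\<close>.\<close>
    define lo hi where "lo = min a s" and "hi = max b t"
    have lohi: "0 < lo" "lo \<le> hi" "hi < L" "lo \<le> a" "b \<le> hi" "lo \<le> s" "t \<le> hi" using st ab by (auto simp: lo_def hi_def)
    define \<psi> where "\<psi> x = bump s t n x + (- (J/I)) * \<beta> x" for x
    have \<psi>: "exp_inv_alg \<psi>" unfolding \<psi>_def \<beta>_def by (intro exp_inv_alg.intros bump_alg)
    have ext: "integral {lo..hi} (bump u v m) = integral {u..v} (bump u v m)" if "lo \<le> u" "v \<le> hi" for u v m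
    proof -
      have "{x \<in> {lo..hi} - {u..v}. bump u v m x \<noteq> 0} = {}" by (auto intro!: bump_eq_0)
      moreover have "{x \<in> {u..v} - {lo..hi}. bump u v m x \<noteq> 0} = {}" using that by auto
      ultimately show ?thesis by (intro integral_spike_set) (simp_all only: negligible_empty)
    qed
    have ci: "bump u v m integrable_on {p..q}" for u v m p q
      by (rule integrable_continuous_real[OF exp_inv_alg_continuous[OF bump_alg]])
    have "integral {lo..hi} \<psi> = J + (- (J/I)) * I"
    proof -
      have 1: "bump s t n integrable_on {lo..hi}" "(\<lambda>x. (- (J/I)) * \<beta> x) integrable_on {lo..hi}"
        unfolding \<beta>_def by (rule ci) (rule integrable_on_mult_right[OF ci])
      have "integral {lo..hi} \<psi> = integral {lo..hi} (bump s t n) + integral {lo..hi} (\<lambda>x. (- (J/I)) * \<beta> x)"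
        unfolding \<psi>_def by (rule Henstock_Kurzweil_Integration.integral_add[OF 1])
      also have "integral {lo..hi} (\<lambda>x. (- (J/I)) * \<beta> x) = (- (J/I)) * integral {lo..hi} \<beta>"
        by (rule integral_mult_right)
      finally show ?thesis
        using ext[of s t n] ext[of a b 0] lohi by (simp add: \<beta>_def J_def I_def)
    qed
    then have I0: "integral {lo..hi} \<psi> = 0" using \<open>I > 0\<close> by simp
    have k: "(LINT x|lebesgue_on {0<..<L}. \<psi> x *\<^sub>R h x) = 0"
      by (rule key[OF \<psi> lohi(1-3) _ I0]) (use lohi in \<open>auto simp: \<psi>_def \<beta>_def bump_eq_0\<close>)
    have int: "integrable (lebesgue_on {0<..<L}) (\<lambda>x. bump u v m x *\<^sub>R q x)" if "0 < u" "v < L" "locally_integrable L q" for u v m q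
      using that by (intro LINT_eq_integral_subinterval[where s=u and t=v] scaleR_absolutely_integrable
        locally_integrable_Icc exp_inv_alg_continuous[OF bump_alg]) (auto intro: bump_eq_0)
    have "(LINT x|lebesgue_on {0<..<L}. \<psi> x *\<^sub>R h x) =
      (LINT x|lebesgue_on {0<..<L}. bump s t n x *\<^sub>R h x + (- (J/I)) *\<^sub>R (\<beta> x *\<^sub>R h x))"
      by (simp add: \<psi>_def scaleR_left_distrib scaleR_left_diff_distrib)
    also have "\<dots> = (LINT x|lebesgue_on {0<..<L}. bump s t n x *\<^sub>R h x)
        + (LINT x|lebesgue_on {0<..<L}. (- (J/I)) *\<^sub>R (\<beta> x *\<^sub>R h x))"
      unfolding \<beta>_def
      by (rule Bochner_Integration.integral_add[OF int[OF st(1,3) lh] integrable_scaleR_right[OF int[OF ab(1,3) lh]]])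
    also have "(LINT x|lebesgue_on {0<..<L}. (- (J/I)) *\<^sub>R (\<beta> x *\<^sub>R h x)) = (- (J/I)) *\<^sub>R (I *\<^sub>R c)"
      using \<open>I > 0\<close> by (subst integral_scaleR_right) (simp add: c_def)
    finally have e1: "(LINT x|lebesgue_on {0<..<L}. bump s t n x *\<^sub>R h x) = J *\<^sub>R c"
      using k \<open>I > 0\<close> by simp
    have "(LINT x|lebesgue_on {0<..<L}. bump s t n x *\<^sub>R c) = integral {s..t} (\<lambda>x. bump s t n x *\<^sub>R c)"
      using st lc by (intro LINT_eq_integral_subinterval(2) scaleR_absolutely_integrable
        locally_integrable_Icc exp_inv_alg_continuous[OF bump_alg]) (auto simp: bump_eq_0)
    also have "\<dots> = J *\<^sub>R c" unfolding J_def
      by (rule integral_unique[OF has_integral_scaleR_left[OF integrable_integral[OF ci]]])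
    finally show "(LINT x|lebesgue_on {0<..<L}. bump s t n x *\<^sub>R (h x - c)) = 0"
      using e1 int[OF st(1,3) lh, of n] int[OF st(1,3) lc, of n] by (simp add: scaleR_diff_right)
  qed
  then have "AE x in lebesgue. x \<in> {0<..<L} \<longrightarrow> f x = c + integral {0..x} g"
    by eventually_elim (auto simp: h_def F_def algebra_simps)
  then show ?thesis by blast
qed

section \<open>Tangents of curves in \<open>W\<^sup>2\<^sup>,\<^sup>p\<close>\<close>

lemma AE_zero_continuous:
  fixes d :: "real \<Rightarrow> 'b::euclidean_space"
  assumes c: "continuous_on {a..b} d" and ae: "AE x in lebesgue. x \<in> {a<..<b} \<longrightarrow> d x = 0"
    and "a < b" "x \<in> {a..b}"
  shows "d x = 0"
proof -
  obtain N where N: "negligible N" "{x. \<not> (x \<in> {a<..<b} \<longrightarrow> d x = 0)} \<subseteq> N"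
    using ae unfolding eventually_ae_filter_negligible by blast
  have "((\<lambda>x. 0) has_integral 0) (cbox a b)" by simp
  then have "((\<lambda>x. norm (d x)) has_integral 0) (cbox a b)"
  proof (rule has_integral_spike[rotated 2])
    show "negligible (N \<union> {a,b})" using N(1) by simp
    fix x assume "x \<in> cbox a b - (N \<union> {a, b})"
    then have "x \<in> {a<..<b}" "x \<notin> N" by auto
    then show "norm (d x) = 0" using N(2) by auto
  qed
  then have "norm (d x) = 0"
    by (rule has_integral_0_cbox_imp_0[rotated 2]) (use assms in \<open>auto intro: continuous_on_norm\<close>)
  then show ?thesis by simp
qed

lemma integral_cong_AE_Ioo:
  fixes f g :: "real \<Rightarrow> 'b::euclidean_space"
  assumes ae: "AE x in lebesgue. x \<in> {a<..<b} \<longrightarrow> f x = g x" and cd: "a \<le> c" "d \<le> b"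
  shows "integral {c..d} f = integral {c..d} g"
proof -
  obtain N where N: "negligible N" "{x. \<not> (x \<in> {a<..<b} \<longrightarrow> f x = g x)} \<subseteq> N"
    using ae unfolding eventually_ae_filter_negligible by blast
  show ?thesis
  proof (rule integral_spike)
    show "negligible (N \<union> {a,b})" using N(1) by simp
    fix x assume "x \<in> {c..d} - (N \<union> {a,b})"
    then have "x \<in> {a<..<b}" "x \<notin> N" using cd by auto
    then show "g x = f x" using N(2) by auto
  qed
qed

lemma Lp_absolutely_integrable:
  assumes "f \<in> Lp p L" "p \<ge> 1"
  shows "f absolutely_integrable_on {0..L}" "(\<lambda>x. norm (f x) powr p) absolutely_integrable_on {0..L}"
proof -
  have m: "f \<in> borel_measurable (lebesgue_on {0<..<L})"
    and i: "integrable (lebesgue_on {0<..<L}) (\<lambda>x. norm (f x) powr p)"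
    using assms(1) by (auto simp: Lp_def)
  have ip: "(\<lambda>x. norm (f x) powr p) integrable_on {0<..<L}"
    by (rule integrable_on_lebesgue_on[OF i]) simp
  then have "(\<lambda>x. norm (f x) powr p) absolutely_integrable_on {0<..<L}"
    by (rule nonnegative_absolutely_integrable_1) simp
  then show "(\<lambda>x. norm (f x) powr p) absolutely_integrable_on {0..L}"
    by (simp add: absolutely_integrable_on_Icc_iff_Ioo)
  have "f absolutely_integrable_on {0<..<L}"
  proof (rule measurable_bounded_by_integrable_imp_absolutely_integrable[OF m])
    have "(\<lambda>x. 1::real) integrable_on {0<..<L}" 
      using integrable_const_ivl[of "1::real" 0 L] by (simp only: integrable_on_Icc_iff_Ioo)
    then show "(\<lambda>x. 1 + norm (f x) powr p) integrable_on {0<..<L}" using ip by (rule integrable_add)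
    fix x
    show "norm (f x) \<le> 1 + norm (f x) powr p"
    proof (cases "norm (f x) \<le> 1")
      case False
      then have "norm (f x) powr 1 \<le> norm (f x) powr p" using assms(2) by (intro powr_mono) auto
      then show ?thesis using False by simp
    qed (simp add: add_increasing2)
  qed simp
  then show "f absolutely_integrable_on {0..L}" by (simp add: absolutely_integrable_on_Icc_iff_Ioo)
qed

lemma Lp_cong_AE:
  assumes "f \<in> Lp p L" "p \<ge> 1" and ae: "AE x in lebesgue. x \<in> {0<..<L} \<longrightarrow> g x = f x"
  shows "g \<in> Lp p L"
proof -
  obtain N where N: "negligible N" "{x. \<not> (x \<in> {0<..<L} \<longrightarrow> g x = f x)} \<subseteq> N"
    using ae unfolding eventually_ae_filter_negligible by blast
  have "f absolutely_integrable_on {0<..<L}"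
    using Lp_absolutely_integrable(1)[OF assms(1,2)] by (simp add: absolutely_integrable_on_Icc_iff_Ioo)
  then have "g absolutely_integrable_on {0<..<L}"
    by (rule absolutely_integrable_spike[OF _ N(1)]) (use N in auto)
  then have m: "g \<in> borel_measurable (lebesgue_on {0<..<L})"
    by (rule absolutely_integrable_imp_borel_measurable) simp
  have fm: "f \<in> borel_measurable (lebesgue_on {0<..<L})" using assms(1) by (auto simp: Lp_def)
  have "AE x in lebesgue_on {0<..<L}. g x = f x"
    using ae by (subst AE_restrict_space_iff) auto
  then have "integrable (lebesgue_on {0<..<L}) (\<lambda>x. norm (g x) powr p) \<longleftrightarrow> integrable (lebesgue_on {0<..<L}) (\<lambda>x. norm (f x) powr p)"
    using m fm by (intro integrable_cong_AE) auto
  then show ?thesis using m assms(1) by (simp add: Lp_def)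
qed

text \<open>\<open>V\<close> is the continuous representative of the first weak derivative.
  Continuity follows from the integral formula, which also gives meaning to the values at the two
  ends of the interval.\<close>

definition is_tangent :: "real \<Rightarrow> (real \<Rightarrow> real^2) \<Rightarrow> (real \<Rightarrow> real^2) \<Rightarrow> bool" where
  "is_tangent L \<eta> V \<longleftrightarrow>
     (\<forall>s\<in>{0..L}. V s = V 0 + integral {0..s} (weak_deriv L (weak_deriv L \<eta>))) \<and>
     (AE s in lebesgue. s \<in> {0<..<L} \<longrightarrow> weak_deriv L \<eta> s = V s)"

lemma W2p_weak_derivs:
  assumes \<eta>: "\<eta> \<in> W2p p L" and p: "p \<ge> 1" and L: "L > 0"
  shows "has_weak_deriv L \<eta> (weak_deriv L \<eta>)" "weak_deriv L \<eta> \<in> Lp p L"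
    "has_weak_deriv L (weak_deriv L \<eta>) (weak_deriv L (weak_deriv L \<eta>))"
    "weak_deriv L (weak_deriv L \<eta>) \<in> Lp p L"
proof -
  obtain v w where v: "v \<in> Lp p L" "w \<in> Lp p L" "has_weak_deriv L \<eta> v" "has_weak_deriv L v w"
    using \<eta> by (auto simp: W2p_def)
  show "has_weak_deriv L \<eta> (weak_deriv L \<eta>)" by (rule weak_deriv_AE(1)[OF v(3)])
  note a = weak_deriv_AE(2)[OF v(3)]
  show "weak_deriv L \<eta> \<in> Lp p L" by (rule Lp_cong_AE[OF v(1) p a])
  have "AE x in lebesgue. x \<in> {0<..<L} \<longrightarrow> v x = weak_deriv L \<eta> x" using a by eventually_elim auto
  from has_weak_deriv_cong_AE[OF v(4) this L] have h: "has_weak_deriv L (weak_deriv L \<eta>) w" .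
  show "has_weak_deriv L (weak_deriv L \<eta>) (weak_deriv L (weak_deriv L \<eta>))" by (rule weak_deriv_AE(1)[OF h])
  show "weak_deriv L (weak_deriv L \<eta>) \<in> Lp p L"
    by (rule Lp_cong_AE[OF v(2) p weak_deriv_AE(2)[OF h]])
qed

lemma continuous_on_add_integral:
  fixes V w :: "real \<Rightarrow> 'b::euclidean_space"
  assumes "w absolutely_integrable_on {0..L}" "\<And>s. s \<in> {0..L} \<Longrightarrow> V s = c + integral {0..s} w"
  shows "continuous_on {0..L} V"
proof -
  have "continuous_on {0..L} (\<lambda>s. c + integral {0..s} w)"
    using assms(1) by (intro continuous_intros indefinite_integral_continuous_1)
      (auto simp: absolutely_integrable_on_def)
  then show ?thesis using assms(2) by (metis (no_types, lifting) continuous_on_eq)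
qed

text \<open>\<open>weak_deriv_indefinite_integral\<close> is used twice, for the weak derivative and
  for the curve. In the second case both sides are continuous, so equality almost everywhere becomes
  equality everywhere.\<close>

lemma W2p_tangent:
  assumes \<eta>: "\<eta> \<in> W2p p L" and p: "p \<ge> 1" and L: "L > 0"
  obtains V where "is_tangent L \<eta> V" "continuous_on {0..L} V"
    "\<And>s. s \<in> {0..L} \<Longrightarrow> \<eta> s = \<eta> 0 + integral {0..s} V"
proof -
  let ?v = "weak_deriv L \<eta>" let ?w = "weak_deriv L ?v"
  note W = W2p_weak_derivs[OF \<eta> p L]
  have vi: "?v absolutely_integrable_on {0..L}" and wi: "?w absolutely_integrable_on {0..L}"
    using Lp_absolutely_integrable(1)[OF W(2) p] Lp_absolutely_integrable(1)[OF W(4) p] .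
  obtain c where c: "AE x in lebesgue. x \<in> {0<..<L} \<longrightarrow> ?v x = c + integral {0..x} ?w"
    using weak_deriv_indefinite_integral[OF W(3) wi L] by blast
  define V where "V s = c + integral {0..s} ?w" for s
  have t: "is_tangent L \<eta> V" unfolding is_tangent_def using c by (simp add: V_def)
  have cV: "continuous_on {0..L} V" by (rule continuous_on_add_integral[OF wi, of _ c]) (simp add: V_def)
  obtain d where d: "AE x in lebesgue. x \<in> {0<..<L} \<longrightarrow> \<eta> x = d + integral {0..x} ?v"
    using weak_deriv_indefinite_integral[OF W(1) vi L] by blast
  have iv: "integral {0..x} ?v = integral {0..x} V" if "x \<in> {0..L}" for x
    by (rule integral_cong_AE_Ioo[of 0 L]) (use c that in \<open>auto simp: V_def\<close>)
  have "continuous_on {0..L} \<eta>" using \<eta> by (simp add: W2p_def)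
  then have cd: "continuous_on {0..L} (\<lambda>x. \<eta> x - (d + integral {0..x} V))"
    by (intro continuous_intros indefinite_integral_continuous_1 integrable_continuous_real cV)
  have "AE x in lebesgue. x \<in> {0<..<L} \<longrightarrow> \<eta> x - (d + integral {0..x} V) = 0"
    using d by eventually_elim (simp add: iv)
  from AE_zero_continuous[OF cd this L] have e: "\<eta> x = d + integral {0..x} V" if "x \<in> {0..L}" for x
    using that by simp
  from e[of 0] L have "\<eta> 0 = d" by simp
  with e have "\<eta> s = \<eta> 0 + integral {0..s} V" if "s \<in> {0..L}" for s using that by simp
  with t cV that show thesis by blast
qed

text \<open>In the plane a vector normal to the unit vector \<open>v\<close> is a multiple of
  \<open>v\<close> turned by a right angle, so the determinant is its length up to sign; the second
  claim is then Lagrange's identity for \<open>v\<close> and \<open>q\<close>. It serves for the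
  acceleration and, with the tangent in the place of \<open>q\<close>, in
  \<open>loop_close\<close>.\<close>

lemma norm_rotation_2:
  fixes v w q :: "real^2"
  assumes "norm v = 1" "norm q = 1" "v \<bullet> w = 0"
  shows "\<bar>v$1 * w$2 - v$2 * w$1\<bar> = norm w"
    and "\<bar>w \<bullet> q\<bar> = norm w * sqrt (1 - (v \<bullet> q)\<^sup>2)"
proof -
  have n: "(norm x)\<^sup>2 = (x$1)\<^sup>2 + (x$2)\<^sup>2" for x :: "real^2"
    by (simp add: norm_eq_sqrt_inner inner_vec_def sum_2 power2_eq_square)
  have i: "x \<bullet> y = x$1 * y$1 + x$2 * y$2" for x y :: "real^2" by (simp add: inner_vec_def sum_2)
  have v: "(v$1)\<^sup>2 + (v$2)\<^sup>2 = 1" and q: "(q$1)\<^sup>2 + (q$2)\<^sup>2 = 1" and o: "v$1 * w$1 + v$2 * w$2 = 0"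
    using assms n[of v] n[of q] i[of v w] by auto
  define k where "k = v$1 * w$2 - v$2 * w$1"
  have w1: "w$1 = - k * v$2" and w2: "w$2 = k * v$1"
  proof -
    have "w$1 = w$1 * ((v$1)\<^sup>2 + (v$2)\<^sup>2)" using v by simp
    also have "\<dots> = v$1 * (v$1 * w$1 + v$2 * w$2) - k * v$2" by (simp add: k_def power2_eq_square algebra_simps)
    finally show "w$1 = - k * v$2" using o by simp
    have "w$2 = w$2 * ((v$1)\<^sup>2 + (v$2)\<^sup>2)" using v by simp
    also have "\<dots> = v$2 * (v$1 * w$1 + v$2 * w$2) + k * v$1" by (simp add: k_def power2_eq_square algebra_simps)
    finally show "w$2 = k * v$1" using o by simp
  qed
  have "(norm w)\<^sup>2 = k\<^sup>2 * ((v$1)\<^sup>2 + (v$2)\<^sup>2)" unfolding n w1 w2 by (simp add: power_mult_distrib algebra_simps)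
  then have "(norm w)\<^sup>2 = \<bar>k\<bar>\<^sup>2" unfolding v by simp
  then have kw: "norm w = \<bar>k\<bar>" by (rule power2_eq_imp_eq) simp_all
  then show "\<bar>v$1 * w$2 - v$2 * w$1\<bar> = norm w" by (simp add: k_def)
  have "(v$1 * q$1 + v$2 * q$2)\<^sup>2 + (v$1 * q$2 - v$2 * q$1)\<^sup>2 = ((v$1)\<^sup>2 + (v$2)\<^sup>2) * ((q$1)\<^sup>2 + (q$2)\<^sup>2)"
    by (simp add: power2_eq_square algebra_simps)
  then have "1 - (v \<bullet> q)\<^sup>2 = (v$1 * q$2 - v$2 * q$1)\<^sup>2" using v q by (simp add: i)
  then have "sqrt (1 - (v \<bullet> q)\<^sup>2) = \<bar>v$1 * q$2 - v$2 * q$1\<bar>" by simp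
  moreover have "w \<bullet> q = k * (v$1 * q$2 - v$2 * q$1)" unfolding i w1 w2 by (simp add: algebra_simps)
  ultimately show "\<bar>w \<bullet> q\<bar> = norm w * sqrt (1 - (v \<bullet> q)\<^sup>2)" by (simp add: kw abs_mult)
qed

lemma inner_indefinite_integral:
  fixes V w :: "real \<Rightarrow> real^2"
  assumes "w absolutely_integrable_on {a..b}" "\<And>s. s \<in> {a..b} \<Longrightarrow> V s = V a + integral {a..s} w"
  shows "(\<lambda>s. w s \<bullet> q) absolutely_integrable_on {a..b}"
    and "s \<in> {a..b} \<Longrightarrow> V s \<bullet> q = V a \<bullet> q + integral {a..s} (\<lambda>s. w s \<bullet> q)"
proof -
  have bl: "bounded_linear (\<lambda>x. x \<bullet> q)" by (rule bounded_linear_inner_left)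
  show "(\<lambda>s. w s \<bullet> q) absolutely_integrable_on {a..b}"
    using absolutely_integrable_linear[OF assms(1) bl] by (simp add: o_def)
  assume s: "s \<in> {a..b}"
  have "w absolutely_integrable_on {a..s}" using assms(1) s by (auto intro: absolutely_integrable_on_subinterval)
  then have "w integrable_on {a..s}" by (simp add: absolutely_integrable_on_def)
  from integral_linear[OF this bl] have "integral {a..s} (\<lambda>s. w s \<bullet> q) = integral {a..s} w \<bullet> q"
    by (simp add: o_def)
  then show "V s \<bullet> q = V a \<bullet> q + integral {a..s} (\<lambda>s. w s \<bullet> q)"
    using assms(2)[OF s] by (simp add: inner_add_left)
qed

lemma increment_indefinite_integral:
  fixes V w :: "real \<Rightarrow> 'b::euclidean_space"
  assumes w: "w absolutely_integrable_on {0..L}" and V: "\<And>s. s \<in> {0..L} \<Longrightarrow> V s = V 0 + integral {0..s} w"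
    and a: "0 \<le> a" "a \<le> s" "s \<le> L"
  shows "V s = V a + integral {a..s} w"
proof -
  have "w absolutely_integrable_on {0..s}" using w a by (auto intro: absolutely_integrable_on_subinterval)
  then have "integral {0..a} w + integral {a..s} w = integral {0..s} w"
    using a by (intro Henstock_Kurzweil_Integration.integral_combine) (auto simp: absolutely_integrable_on_def)
  then show ?thesis using V[of a] V[of s] a by (simp add: add.assoc)
qed

text \<open>This is the derivative of \<open>V \<bullet> V = 1\<close>: by the product rule the
  integral of \<open>2 * (V \<bullet> w)\<close> over any interval is an increment of
  \<open>V \<bullet> V\<close>. As \<open>w\<close> is merely integrable, the conclusion holds
  almost everywhere.\<close>

lemma unit_tangent_orthogonal:
  fixes V w :: "real \<Rightarrow> real^2"
  assumes w: "w absolutely_integrable_on {0..L}" and V: "\<And>s. s \<in> {0..L} \<Longrightarrow> V s = V 0 + integral {0..s} w"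
    and n: "\<And>s. s \<in> {0..L} \<Longrightarrow> norm (V s) = 1"
  shows "AE s in lebesgue. s \<in> {0<..<L} \<longrightarrow> V s \<bullet> w s = 0"
proof -
  have cV: "continuous_on {0..L} V" by (rule continuous_on_add_integral[OF w V])
  have wc: "(\<lambda>x. w x $ i) absolutely_integrable_on {0..L}" for i
    using inner_indefinite_integral(1)[OF w V, of "axis i 1"] by (simp add: inner_axis)
  have Vc: "V s $ i = V 0 $ i + integral {0..s} (\<lambda>x. w x $ i)" if "s \<in> {0..L}" for s i
    using inner_indefinite_integral(2)[OF w V that, of "axis i 1"] by (simp add: inner_axis)
  have cVi: "continuous_on {0..L} (\<lambda>x. V x $ i)" for i using cV by (intro continuous_intros)
  have ai: "(\<lambda>s. V s $ i * w s $ i) absolutely_integrable_on {0..L}" for i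
    by (rule absolutely_integrable_continuous_mult[OF wc cVi])
  have "(\<lambda>s. V s $ 1 * w s $ 1 + V s $ 2 * w s $ 2) absolutely_integrable_on {0..L}"
    by (rule set_integral_add(1)[OF ai ai])
  then have AI: "(\<lambda>s. V s \<bullet> w s) absolutely_integrable_on {0..L}" by (simp add: inner_vec_def sum_2)
  show ?thesis
  proof (rule AE_zero_if_integral_intervals_zero)
    fix s t assume st: "0 < s" "s \<le> t" "t < L"
    show "(\<lambda>s. V s \<bullet> w s) absolutely_integrable_on {s..t}"
      by (rule absolutely_integrable_on_subinterval[OF AI]) (use st in auto)
    have sub: "(\<lambda>x. w x $ i) absolutely_integrable_on {s..t}" for i
      by (rule absolutely_integrable_on_subinterval[OF wc]) (use st in auto)
    have inc: "V r $ i = V s $ i + integral {s..r} (\<lambda>x. w x $ i)" if "r \<in> {s..t}" for r i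
      by (rule increment_indefinite_integral[OF wc Vc]) (use that st in auto)
    have P: "integral {s..t} (\<lambda>x. V x $ i * w x $ i + V x $ i * w x $ i) = V t $ i * V t $ i - V s $ i * V s $ i"
      and Pi: "(\<lambda>x. V x $ i * w x $ i + V x $ i * w x $ i) absolutely_integrable_on {s..t}" for i
      using product_rule_indefinite_integral[OF sub sub st(2) inc inc] by blast+
    have "2 * (integral {s..t} (\<lambda>s. V s \<bullet> w s)) = integral {s..t} (\<lambda>x. 2 * (V x \<bullet> w x))" by simp
    also have "\<dots> = integral {s..t} (\<lambda>x. (V x $ 1 * w x $ 1 + V x $ 1 * w x $ 1) + (V x $ 2 * w x $ 2 + V x $ 2 * w x $ 2))"
      by (simp add: inner_vec_def sum_2 algebra_simps)
    also have "\<dots> = V t \<bullet> V t - V s \<bullet> V s"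
      using Pi[of 1] Pi[of 2] P[of 1] P[of 2]
      by (subst Henstock_Kurzweil_Integration.integral_add) (auto simp: absolutely_integrable_on_def inner_vec_def sum_2)
    also have "\<dots> = 0" using n[of s] n[of t] st by (simp add: dot_square_norm)
    finally show "integral {s..t} (\<lambda>s. V s \<bullet> w s) = 0" by simp
  qed
qed

text \<open>For a unit speed curve the acceleration is normal, so its norm is the absolute curvature.\<close>

definition tangent_field :: "real \<Rightarrow> real^2 \<Rightarrow> real^2 \<Rightarrow> real \<Rightarrow> (real \<Rightarrow> real^2) \<Rightarrow> (real \<Rightarrow> real^2) \<Rightarrow> (real \<Rightarrow> real^2) \<Rightarrow> bool" where
  "tangent_field p P0 P1 L \<eta> V w \<longleftrightarrow> w = weak_deriv L (weak_deriv L \<eta>) \<and> is_tangent L \<eta> V \<and>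
     w absolutely_integrable_on {0..L} \<and> (\<lambda>s. norm (w s) powr p) absolutely_integrable_on {0..L} \<and>
     (\<forall>s\<in>{0..L}. V s = V 0 + integral {0..s} w) \<and> (\<forall>s\<in>{0..L}. norm (V s) = 1) \<and>
     (\<forall>s\<in>{0..L}. \<eta> s = P0 + integral {0..s} V) \<and> integral {0..L} V = P1 - P0 \<and>
     (AE s in lebesgue. s \<in> {0<..<L} \<longrightarrow> V s \<bullet> w s = 0) \<and>
     bending_energy p L \<eta> = integral {0..L} (\<lambda>s. norm (w s) powr p)"

lemma tangent_fieldD:
  assumes "tangent_field p P0 P1 L \<eta> V w"
  shows "is_tangent L \<eta> V"
    "w absolutely_integrable_on {0..L}" "(\<lambda>s. norm (w s) powr p) absolutely_integrable_on {0..L}"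
    "\<And>s. s \<in> {0..L} \<Longrightarrow> V s = V 0 + integral {0..s} w"
    "\<And>s. s \<in> {0..L} \<Longrightarrow> norm (V s) = 1"
    "\<And>s. s \<in> {0..L} \<Longrightarrow> \<eta> s = P0 + integral {0..s} V"
    "integral {0..L} V = P1 - P0"
    "AE s in lebesgue. s \<in> {0<..<L} \<longrightarrow> V s \<bullet> w s = 0"
    "bending_energy p L \<eta> = integral {0..L} (\<lambda>s. norm (w s) powr p)"
    "continuous_on {0..L} V"
proof -
  show "w absolutely_integrable_on {0..L}" and "\<And>s. s \<in> {0..L} \<Longrightarrow> V s = V 0 + integral {0..s} w"
    using assms unfolding tangent_field_def by blast+
  then show "continuous_on {0..L} V" by (rule continuous_on_add_integral)
qed (use assms in \<open>unfold tangent_field_def; blast\<close>)+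

lemma A_pin_tangent_field:
  assumes \<eta>: "\<eta> \<in> A_pin p P0 P1 L" and p: "p \<ge> 1" and L: "L > 0"
  shows "\<exists>V w. tangent_field p P0 P1 L \<eta> V w"
proof -
  define w where "w = weak_deriv L (weak_deriv L \<eta>)"
  have \<eta>': "\<eta> \<in> W2p p L" "\<eta> 0 = P0" "\<eta> L = P1"
    and un: "AE s in lebesgue_on {0<..<L}. norm (weak_deriv L \<eta> s) = 1"
    using \<eta> by (auto simp: A_pin_def W2p_arc_def)
  obtain V where V: "is_tangent L \<eta> V" "continuous_on {0..L} V" "\<And>s. s \<in> {0..L} \<Longrightarrow> \<eta> s = \<eta> 0 + integral {0..s} V"
    using W2p_tangent[OF \<eta>'(1) p L] by metis
  note W = W2p_weak_derivs[OF \<eta>'(1) p L]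
  have wi: "w absolutely_integrable_on {0..L}" and wp: "(\<lambda>s. norm (w s) powr p) absolutely_integrable_on {0..L}"
    unfolding w_def using Lp_absolutely_integrable[OF W(4) p] .
  have VI: "\<And>s. s \<in> {0..L} \<Longrightarrow> V s = V 0 + integral {0..s} w"
    and VA: "AE s in lebesgue. s \<in> {0<..<L} \<longrightarrow> weak_deriv L \<eta> s = V s"
    using V(1) unfolding is_tangent_def w_def by blast+
  have un': "AE s in lebesgue. s \<in> {0<..<L} \<longrightarrow> norm (weak_deriv L \<eta> s) = 1"
    using un by (subst (asm) AE_restrict_space_iff) auto
  have "AE s in lebesgue. s \<in> {0<..<L} \<longrightarrow> norm (V s) - 1 = 0"
    using un' VA by eventually_elim auto
  moreover have "continuous_on {0..L} (\<lambda>s. norm (V s) - 1)" using V(2) by (intro continuous_intros)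
  ultimately have n: "norm (V s) = 1" if "s \<in> {0..L}" for s
    using AE_zero_continuous[of 0 L "\<lambda>s. norm (V s) - 1" s] that L by auto
  have orth: "AE s in lebesgue. s \<in> {0<..<L} \<longrightarrow> V s \<bullet> w s = 0"
    by (rule unit_tangent_orthogonal[OF wi VI n])
  have curv: "AE s in lebesgue_on {0<..<L}. \<bar>curvature L \<eta> s\<bar> powr p = norm (w s) powr p"
  proof (subst AE_restrict_space_iff)
    show "AE s in lebesgue. s \<in> {0<..<L} \<longrightarrow> \<bar>curvature L \<eta> s\<bar> powr p = norm (w s) powr p"
      using VA orth
    proof eventually_elim
      case (elim s)
      show ?case
      proof
        assume s: "s \<in> {0<..<L}"
        then have "\<bar>curvature L \<eta> s\<bar> = \<bar>V s $ 1 * w s $ 2 - V s $ 2 * w s $ 1\<bar>"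
          using elim by (simp add: curvature_def Let_def w_def)
        also have "\<dots> = norm (w s)"
          using elim s n[of s] by (intro norm_rotation_2(1)[of _ "V s"]) auto
        finally show "\<bar>curvature L \<eta> s\<bar> powr p = norm (w s) powr p" by simp
      qed
    qed
  qed simp
  have wm: "(\<lambda>s. norm (w s) powr p) \<in> borel_measurable (lebesgue_on {0<..<L})"
    and wpi: "integrable (lebesgue_on {0<..<L}) (\<lambda>s. norm (w s) powr p)"
    using W(4) by (auto simp: Lp_def w_def)
  have lim: "bending_energy p L \<eta> = (LINT s|lebesgue_on {0<..<L}. norm (w s) powr p)"
    unfolding bending_energy_def
  proof (rule integral_cong_AE[OF _ wm curv])
    have m: "weak_deriv L \<eta> \<in> borel_measurable (lebesgue_on {0<..<L})" "w \<in> borel_measurable (lebesgue_on {0<..<L})"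
      using W(2,4) by (auto simp: Lp_def w_def)
    have c: "(\<lambda>s. f s $ i) \<in> borel_measurable (lebesgue_on {0<..<L})" if "f \<in> borel_measurable (lebesgue_on {0<..<L})" for f :: "real \<Rightarrow> real^2" and i
      using borel_measurable_inner[OF that borel_measurable_const, of "axis i 1"] by (simp add: inner_axis)
    show "(\<lambda>s. \<bar>curvature L \<eta> s\<bar> powr p) \<in> borel_measurable (lebesgue_on {0<..<L})"
      unfolding curvature_def Let_def w_def[symmetric]
      by (intro powr_real_measurable borel_measurable_abs borel_measurable_diff borel_measurable_times c m borel_measurable_const)
  qed
  also have "\<dots> = integral {0<..<L} (\<lambda>s. norm (w s) powr p)"
    by (rule lebesgue_integral_eq_integral[OF wpi]) simp
  finally have be: "bending_energy p L \<eta> = integral {0..L} (\<lambda>s. norm (w s) powr p)"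
    by (simp add: integral_open_interval_real)
  have "integral {0..L} V = P1 - P0" using V(3)[of L] \<eta>' L by simp
  moreover have "\<And>s. s \<in> {0..L} \<Longrightarrow> \<eta> s = P0 + integral {0..s} V" using V(3) \<eta>'(2) by simp
  ultimately have "tangent_field p P0 P1 L \<eta> V w"
    unfolding tangent_field_def using w_def V(1) wi wp VI n orth be by blast
  then show ?thesis by blast
qed

text \<open>One-dimensional Sobolev embedding with explicit constants: the oscillation of
  \<open>V - U\<close> is at most the integral of the norm of the difference of the accelerations,
  and its size on average is controlled by the first-order part of the norm.
  \<open>\<epsilon>\<close> precedes the curves, since one neighbourhood has to serve all
  competitors.\<close>

lemma tangent_close:
  assumes p: "p \<ge> 1" and L: "L > 0" and \<delta>: "\<delta> > 0"
  shows "\<exists>\<epsilon>>0. \<forall>\<eta> \<gamma> V U. \<eta> \<in> W2p p L \<longrightarrow> \<gamma> \<in> W2p p L \<longrightarrow> is_tangent L \<eta> V \<longrightarrow> is_tangent L \<gamma> U \<longrightarrow>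
    W2p_norm p L (\<lambda>s. \<eta> s - \<gamma> s) < \<epsilon> \<longrightarrow> (\<forall>s\<in>{0..L}. norm (V s - U s) < \<delta>)"
proof -
  \<comment> \<open>\<open>d\<close> and \<open>\<epsilon>\<close> are chosen so that the two terms
    of the final estimate equal \<open>\<delta>/4\<close> each.\<close>
  define d where "d = \<delta> / (4 * (1 + L))"
  have d: "d > 0" using L \<delta> by (simp add: d_def)
  define \<epsilon> where "\<epsilon> = (\<delta> / 4 / ((1/L + 1) * d powr (1 - p))) powr (1/p)"
  have "1/L + 1 > 0" using L by (simp add: add_pos_pos)
  then have e: "\<epsilon> > 0" using L \<delta> d by (simp add: \<epsilon>_def)
  have ep: "\<epsilon> powr p = \<delta> / 4 / ((1/L + 1) * d powr (1 - p))"
  proof -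
    have "1/L + 1 > 0" using L by (simp add: add_pos_pos)
    then show ?thesis using p L \<delta> d by (simp add: \<epsilon>_def powr_powr)
  qed
  \<comment> \<open>In place of Hoelder's inequality:
    \<open>t \<le> d + t powr p * d powr (1 - p)\<close>, where the second term alone suffices if
    \<open>t > d\<close>.\<close>
  have small: "integral {0..L} (\<lambda>x. norm (f x)) \<le> d * L + \<epsilon> powr p * d powr (1 - p)"
    if f: "f \<in> Lp p L" and n: "Lp_norm p L f < \<epsilon>" for f :: "real \<Rightarrow> real^2"
  proof -
    note ai = Lp_absolutely_integrable[OF f p]
    have i: "(\<lambda>x. norm (f x)) integrable_on {0..L}" "(\<lambda>x. norm (f x) powr p) integrable_on {0..L}"
      using ai by (auto simp: absolutely_integrable_on_def)
    have "integrable (lebesgue_on {0<..<L}) (\<lambda>x. norm (f x) powr p)" using f by (simp add: Lp_def)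
    then have "(LINT x|lebesgue_on {0<..<L}. norm (f x) powr p) = integral {0<..<L} (\<lambda>x. norm (f x) powr p)"
      by (rule lebesgue_integral_eq_integral) simp
    then have "(integral {0..L} (\<lambda>x. norm (f x) powr p)) powr (1/p) < \<epsilon>"
      using n by (simp add: Lp_norm_def integral_open_interval_real)
    then have "((integral {0..L} (\<lambda>x. norm (f x) powr p)) powr (1/p)) powr p \<le> \<epsilon> powr p"
      using p by (intro powr_mono2) auto
    moreover have "integral {0..L} (\<lambda>x. norm (f x) powr p) \<ge> 0" by (rule integral_nonneg[OF i(2)]) simp
    ultimately have A: "integral {0..L} (\<lambda>x. norm (f x) powr p) \<le> \<epsilon> powr p" using p by (simp add: powr_powr)
    have "integral {0..L} (\<lambda>x. norm (f x)) \<le> integral {0..L} (\<lambda>x. d + norm (f x) powr p * d powr (1 - p))"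
    proof (rule integral_le[OF i(1)])
      show "(\<lambda>x. d + norm (f x) powr p * d powr (1 - p)) integrable_on {0..L}"
        by (intro integrable_add integrable_on_mult_left i(2) integrable_const_ivl)
      fix x
      show "norm (f x) \<le> d + norm (f x) powr p * d powr (1 - p)"
      proof (cases "norm (f x) \<le> d")
        case True then show ?thesis by (simp add: add_increasing2)
      next
        case False
        then have fx: "norm (f x) > 0" "d \<le> norm (f x)" using d by auto
        have "norm (f x) powr (1 - p) \<le> d powr (1 - p)" using fx d p by (intro powr_mono2') auto
        then have "norm (f x) powr p * norm (f x) powr (1 - p) \<le> norm (f x) powr p * d powr (1 - p)"
          by (intro mult_left_mono) auto
        then show ?thesis using fx d by (simp add: powr_add[symmetric])
      qed
    qed
    also have "\<dots> = d * L + integral {0..L} (\<lambda>x. norm (f x) powr p) * d powr (1 - p)"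
      using L by (subst Henstock_Kurzweil_Integration.integral_add) (auto intro!: integrable_on_mult_left i(2))
    also have "\<dots> \<le> d * L + \<epsilon> powr p * d powr (1 - p)" using A by (intro add_left_mono mult_right_mono) auto
    finally show ?thesis .
  qed
  show ?thesis
  proof (intro exI[of _ \<epsilon>] conjI e allI impI ballI)
    fix \<eta> \<gamma> V U s
    assume \<eta>: "\<eta> \<in> W2p p L" and \<gamma>: "\<gamma> \<in> W2p p L" and V: "is_tangent L \<eta> V" and U: "is_tangent L \<gamma> U"
      and n: "W2p_norm p L (\<lambda>s. \<eta> s - \<gamma> s) < \<epsilon>" and s: "s \<in> {0..L}"
    note W1 = W2p_weak_derivs[OF \<eta> p L] and W2 = W2p_weak_derivs[OF \<gamma> p L]
    let ?h = "\<lambda>s. \<eta> s - \<gamma> s"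
    let ?v = "\<lambda>s. weak_deriv L \<eta> s - weak_deriv L \<gamma> s"
    let ?w = "\<lambda>s. weak_deriv L (weak_deriv L \<eta>) s - weak_deriv L (weak_deriv L \<gamma>) s"
    \<comment> \<open>Being a choice, \<open>weak_deriv\<close> is linear only up to null sets, so
      the weak derivatives of the difference have to be identified almost everywhere, at both
      orders.\<close>
    have hv: "has_weak_deriv L ?h ?v" by (rule has_weak_deriv_diff[OF W1(1) W2(1) L])
    have vw: "has_weak_deriv L ?v ?w" by (rule has_weak_deriv_diff[OF W1(3) W2(3) L])
    note av = weak_deriv_AE(2)[OF hv]
    have "AE x in lebesgue. x \<in> {0<..<L} \<longrightarrow> ?v x = weak_deriv L ?h x" using av by eventually_elim auto
    from has_weak_deriv_cong_AE[OF vw this L] have hw: "has_weak_deriv L (weak_deriv L ?h) ?w" .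
    note aw = weak_deriv_AE(2)[OF hw]
    have sub: "(\<lambda>s. f s - g s) \<in> Lp p L" if "f \<in> Lp p L" "g \<in> Lp p L" for f g :: "real \<Rightarrow> real^2"
    proof -
      have m: "f \<in> borel_measurable (lebesgue_on {0<..<L})" "g \<in> borel_measurable (lebesgue_on {0<..<L})"
        and i: "integrable (lebesgue_on {0<..<L}) (\<lambda>x. norm (f x) powr p)" "integrable (lebesgue_on {0<..<L}) (\<lambda>x. norm (g x) powr p)"
        using that by (auto simp: Lp_def)
      have "integrable (lebesgue_on {0<..<L}) (\<lambda>x. norm (f x - g x) powr p)"
      proof (rule Bochner_Integration.integrable_bound[where f="\<lambda>x. 2 powr p * (norm (f x) powr p + norm (g x) powr p)"])
        show "integrable (lebesgue_on {0<..<L}) (\<lambda>x. 2 powr p * (norm (f x) powr p + norm (g x) powr p))" using i by simp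
        show "(\<lambda>x. norm (f x - g x) powr p) \<in> borel_measurable (lebesgue_on {0<..<L})" using m by measurable
        show "AE x in lebesgue_on {0<..<L}. norm (norm (f x - g x) powr p) \<le> norm (2 powr p * (norm (f x) powr p + norm (g x) powr p))"
        proof (rule AE_I2)
          fix x
          have "norm (f x - g x) \<le> 2 * max (norm (f x)) (norm (g x))"
            using norm_triangle_ineq4[of "f x" "g x"] by linarith
          then have "norm (f x - g x) powr p \<le> (2 * max (norm (f x)) (norm (g x))) powr p"
            using p by (intro powr_mono2) auto
          also have "\<dots> = 2 powr p * max (norm (f x)) (norm (g x)) powr p"
            by (simp add: powr_mult)
          also have "\<dots> \<le> 2 powr p * (norm (f x) powr p + norm (g x) powr p)"
            by (intro mult_left_mono) (auto simp: max_def)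
          finally show "norm (norm (f x - g x) powr p) \<le> norm (2 powr p * (norm (f x) powr p + norm (g x) powr p))" by simp
        qed
      qed
      then show ?thesis using m by (simp add: Lp_def)
    qed
    note LV = Lp_cong_AE[OF sub[OF W1(2) W2(2)] p av] and LW = Lp_cong_AE[OF sub[OF W1(4) W2(4)] p aw]
    have pos: "Lp_norm p L f \<ge> 0" for f by (simp add: Lp_norm_def)
    have nv: "Lp_norm p L (weak_deriv L ?h) < \<epsilon>" and nw: "Lp_norm p L (weak_deriv L (weak_deriv L ?h)) < \<epsilon>"
      using n pos[of ?h] pos[of "weak_deriv L ?h"] pos[of "weak_deriv L (weak_deriv L ?h)"] unfolding W2p_norm_def by linarith+
    define D where "D s = V s - U s" for s
    define B where "B = d * L + \<epsilon> powr p * d powr (1 - p)"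
    have wi: "?w absolutely_integrable_on {0..L}"
      using Lp_absolutely_integrable(1)[OF W1(4) p] Lp_absolutely_integrable(1)[OF W2(4) p] by (rule set_integral_diff(1))
    have wn: "(\<lambda>x. norm (?w x)) integrable_on {0..L}" using wi by (simp add: absolutely_integrable_on_def)
    have DI: "D s = D 0 + integral {0..s} ?w" if "s \<in> {0..L}" for s
    proof -
      have "f integrable_on {0..s}" if "f absolutely_integrable_on {0..L}" for f :: "real \<Rightarrow> real^2"
        using that \<open>s \<in> {0..L}\<close> by (meson absolutely_integrable_on_def absolutely_integrable_on_subinterval atLeastAtMost_iff atLeastatMost_subset_iff order_refl)
      then have "integral {0..s} ?w = integral {0..s} (weak_deriv L (weak_deriv L \<eta>)) - integral {0..s} (weak_deriv L (weak_deriv L \<gamma>))"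
        using Lp_absolutely_integrable(1)[OF W1(4) p] Lp_absolutely_integrable(1)[OF W2(4) p]
        by (intro Henstock_Kurzweil_Integration.integral_diff) auto
      moreover have "V s = V 0 + integral {0..s} (weak_deriv L (weak_deriv L \<eta>))" "U s = U 0 + integral {0..s} (weak_deriv L (weak_deriv L \<gamma>))"
        using V U that unfolding is_tangent_def by blast+
      ultimately show ?thesis unfolding D_def by (simp only:) simp
    qed
    have cD: "continuous_on {0..L} D" by (rule continuous_on_add_integral[OF wi DI])
    have IW: "integral {0..L} (\<lambda>x. norm (?w x)) \<le> B"
    proof -
      have "AE x in lebesgue. x \<in> {0<..<L} \<longrightarrow> norm (?w x) = norm (weak_deriv L (weak_deriv L ?h) x)"
        using aw by eventually_elim simp
      then have "integral {0..L} (\<lambda>x. norm (?w x)) = integral {0..L} (\<lambda>x. norm (weak_deriv L (weak_deriv L ?h) x))"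
        by (rule integral_cong_AE_Ioo) auto
      then show ?thesis using small[OF LW nw] by (simp add: B_def)
    qed
    have IV: "integral {0..L} (\<lambda>x. norm (D x)) \<le> B"
    proof -
      have "AE x in lebesgue. x \<in> {0<..<L} \<longrightarrow> weak_deriv L \<eta> x = V x"
        "AE x in lebesgue. x \<in> {0<..<L} \<longrightarrow> weak_deriv L \<gamma> x = U x"
        using V U unfolding is_tangent_def by blast+
      with av have "AE x in lebesgue. x \<in> {0<..<L} \<longrightarrow> norm (D x) = norm (weak_deriv L ?h x)"
        by eventually_elim (simp add: D_def)
      then have "integral {0..L} (\<lambda>x. norm (D x)) = integral {0..L} (\<lambda>x. norm (weak_deriv L ?h x))"
        by (rule integral_cong_AE_Ioo) auto
      then show ?thesis using small[OF LV nv] by (simp add: B_def)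
    qed
    have pt: "norm (D s) \<le> norm (D t) + B" if t: "t \<in> {0..L}" for t
    proof -
      have part: "norm (integral {x..y} ?w) \<le> B" if "0 \<le> x" "x \<le> y" "y \<le> L" for x y
      proof -
        have i: "?w absolutely_integrable_on {x..y}" using that by (intro absolutely_integrable_on_subinterval[OF wi]) auto
        then have "norm (integral {x..y} ?w) \<le> integral {x..y} (\<lambda>x. norm (?w x))"
          by (intro integral_norm_bound_integral) (auto simp: absolutely_integrable_on_def)
        also have "\<dots> \<le> integral {0..L} (\<lambda>x. norm (?w x))"
          using i wn that by (intro integral_subset_le) (auto simp: absolutely_integrable_on_def)
        finally show ?thesis using IW by simp
      qed
      show ?thesis
      proof (cases "t \<le> s")
        case True
        have "D s = D t + integral {t..s} ?w" by (rule increment_indefinite_integral[OF wi DI]) (use True s t in auto)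
        then show ?thesis using norm_triangle_ineq[of "D t" "integral {t..s} ?w"] part[of t s] True s t by auto
      next
        case False
        have "D t = D s + integral {s..t} ?w" by (rule increment_indefinite_integral[OF wi DI]) (use False s t in auto)
        then have "D s = D t - integral {s..t} ?w" by simp
        then show ?thesis using norm_triangle_ineq4[of "D t" "integral {s..t} ?w"] part[of s t] False s t by auto
      qed
    qed
    have "L * norm (D s) = integral {0..L} (\<lambda>t. norm (D s))" using L by simp
    also have "\<dots> \<le> integral {0..L} (\<lambda>t. norm (D t) + B)"
      using pt by (intro integral_le integrable_add integrable_continuous_real continuous_intros cD) auto
    also have "\<dots> = integral {0..L} (\<lambda>t. norm (D t)) + L * B"
      using L by (subst Henstock_Kurzweil_Integration.integral_add) (auto intro!: integrable_continuous_real continuous_intros cD)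
    also have "\<dots> \<le> B + L * B" using IV by simp
    finally have "norm (D s) \<le> (1/L + 1) * B" using L by (simp add: field_simps)
    also have "\<dots> = d * (1 + L) + (1/L + 1) * (\<epsilon> powr p * d powr (1 - p))"
      using L by (simp add: B_def field_simps)
    also have "\<dots> = \<delta>/4 + \<delta>/4"
    proof -
      have "(1/L + 1) * d powr (1 - p) > 0" using L d by (intro mult_pos_pos) (auto simp: add_pos_pos)
      then have "(1/L + 1) * (\<epsilon> powr p * d powr (1 - p)) = \<delta>/4" unfolding ep by (simp add: field_simps)
      moreover have "d * (1 + L) = \<delta>/4" using L by (simp add: d_def field_simps)
      ultimately show ?thesis by simp
    qed
    finally show "norm (V s - U s) < \<delta>" using \<delta> by (simp add: D_def)
  qed
qed

section \<open>Calibration\<close>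

text \<open>To be used with \<open>z = V \<bullet> q\<close>, \<open>\<zeta> = z'\<close> and \<open>\<kappa> = |k|\<close>.\<close>

definition profile :: "real \<Rightarrow> real \<Rightarrow> real \<Rightarrow> (real \<Rightarrow> real) \<Rightarrow> (real \<Rightarrow> real) \<Rightarrow> (real \<Rightarrow> real) \<Rightarrow> bool" where
  "profile p s t z \<zeta> \<kappa> \<longleftrightarrow> \<zeta> absolutely_integrable_on {s..t} \<and>
     (\<forall>r\<in>{s..t}. z r = z s + integral {s..r} \<zeta>) \<and> (\<forall>r\<in>{s..t}. -1 \<le> z r \<and> z r \<le> 1) \<and>
     (AE r in lebesgue. r \<in> {s<..<t} \<longrightarrow> \<bar>\<zeta> r\<bar> = \<kappa> r * sqrt (1 - (z r)\<^sup>2)) \<and>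
     (\<forall>r. \<kappa> r \<ge> 0) \<and> (\<lambda>r. \<kappa> r powr p) absolutely_integrable_on {s..t}"

definition energy_density :: "real \<Rightarrow> real \<Rightarrow> (real \<Rightarrow> real) \<Rightarrow> (real \<Rightarrow> real) \<Rightarrow> real \<Rightarrow> real" where
  "energy_density p \<mu> z \<kappa> r = \<kappa> r powr p + (p - 1) * \<mu> powr p * ((1 + z r) / 2)"

text \<open>Here \<open>\<delta> > 0\<close> removes the singularity of the weight at \<open>z = 1\<close>, and \<open>y\<close> is a lower bound for
  \<open>(1 + z) / 2\<close> whose contribution to the energy is split off before Young's inequality is applied.\<close>

definition calib :: "real \<Rightarrow> real \<Rightarrow> real \<Rightarrow> real \<Rightarrow> real \<Rightarrow> real" where
  "calib p \<mu> \<delta> y z = p * \<mu> powr (p - 1) * max 0 ((1 + z) / 2 - y) powr ((p - 1) / p) / sqrt (1 - z\<^sup>2 + \<delta>)"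

lemma profile_range:
  assumes "profile p s t z \<zeta> \<kappa>" "r \<in> {s..t}"
  shows "-1 \<le> z r" "z r \<le> 1"
  using assms unfolding profile_def by blast+

lemma profile_nonneg: "profile p s t z \<zeta> \<kappa> \<Longrightarrow> \<kappa> r \<ge> 0"
  unfolding profile_def by blast

lemma profile_continuous:
  assumes "profile p s t z \<zeta> \<kappa>" shows "continuous_on {s..t} z"
proof -
  have "\<zeta> absolutely_integrable_on {s..t}" "\<And>r. r \<in> {s..t} \<Longrightarrow> z r = z s + integral {s..r} \<zeta>"
    using assms unfolding profile_def by blast+
  then show ?thesis by (rule continuous_on_indefinite_integral)
qed

lemma profile_subinterval:
  assumes P: "profile p a b z \<zeta> \<kappa>" and st: "a \<le> s" "t \<le> b"
  shows "profile p s t z \<zeta> \<kappa>"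
  unfolding profile_def
proof (intro conjI ballI)
  have \<zeta>: "\<zeta> absolutely_integrable_on {a..b}" and z: "\<And>r. r \<in> {a..b} \<Longrightarrow> z r = z a + integral {a..r} \<zeta>"
    using P unfolding profile_def by blast+
  show "\<zeta> absolutely_integrable_on {s..t}"
    by (rule absolutely_integrable_on_subinterval[OF \<zeta>]) (use st in auto)
  have "(\<lambda>r. \<kappa> r powr p) absolutely_integrable_on {a..b}" using P unfolding profile_def by blast
  then show "(\<lambda>r. \<kappa> r powr p) absolutely_integrable_on {s..t}"
    by (rule absolutely_integrable_on_subinterval) (use st in auto)
  fix r assume r: "r \<in> {s..t}"
  have "integral {s..r} \<zeta> = z r - z s"
    by (rule integral_increment[OF \<zeta> z]) (use r st in auto)
  then show "z r = z s + integral {s..r} \<zeta>" by simp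
  show "-1 \<le> z r" "z r \<le> 1" using profile_range[OF P, of r] r st by auto
next
  have "AE r in lebesgue. r \<in> {a<..<b} \<longrightarrow> \<bar>\<zeta> r\<bar> = \<kappa> r * sqrt (1 - (z r)\<^sup>2)"
    using P unfolding profile_def by blast
  then show "AE r in lebesgue. r \<in> {s<..<t} \<longrightarrow> \<bar>\<zeta> r\<bar> = \<kappa> r * sqrt (1 - (z r)\<^sup>2)"
    by eventually_elim (use st in auto)
  show "\<forall>r. \<kappa> r \<ge> 0" using P unfolding profile_def by blast
qed

text \<open>Young's inequality with exponents \<open>p\<close> and \<open>p / (p - 1)\<close>.
  Equality occurs for \<open>k = \<mu> * X powr (1/p)\<close>, the curvature law of a loop; this
  dictates the coefficient in \<open>energy_density\<close>.\<close>

lemma young_powr: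
  fixes k X \<mu> p :: real
  assumes p: "p > 1" and k: "k \<ge> 0" and X: "X \<ge> 0" and \<mu>: "\<mu> > 0"
  shows "p * \<mu> powr (p - 1) * X powr ((p - 1) / p) * k \<le> k powr p + (p - 1) * \<mu> powr p * X"
proof -
  define b where "b = \<mu> powr (p - 1) * X powr ((p - 1) / p)"
  have "k * b \<le> k powr p / p + b powr (p / (p - 1)) / (p / (p - 1))"
    by (rule Youngs_inequality) (use p k in \<open>auto simp: b_def field_simps\<close>)
  moreover have "b powr (p / (p - 1)) = \<mu> powr p * X"
    using p \<mu> X by (simp add: b_def powr_mult powr_powr)
  ultimately have "p * (k * b) \<le> p * (k powr p / p + \<mu> powr p * X / (p / (p - 1)))"
    using p by (intro mult_left_mono) auto
  also have "\<dots> = k powr p + (p - 1) * \<mu> powr p * X"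
    using p by (simp add: field_simps)
  finally show ?thesis by (simp add: b_def mult_ac)
qed

lemma sqrt_regularized_pos: "z \<in> {-1..1} \<Longrightarrow> \<delta> > 0 \<Longrightarrow> sqrt (1 - z\<^sup>2 + \<delta>) > (0::real)"
proof -
  assume "z \<in> {-1..1}" "\<delta> > 0"
  then have "\<bar>z\<bar> \<le> 1" by auto
  then have "z\<^sup>2 \<le> 1" by (rule abs_square_le_1[THEN iffD2])
  then show ?thesis using \<open>\<delta> > 0\<close> by auto
qed

lemma calib_continuous:
  assumes "p > 1" "\<delta> > 0" shows "continuous_on {-1..1} (calib p \<mu> \<delta> y)"
proof -
  have nz: "\<forall>z\<in>{-1..1}. sqrt (1 - z\<^sup>2 + \<delta>) \<noteq> 0"
    using sqrt_regularized_pos[OF _ assms(2)] by fastforce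
  have "continuous_on {-1..1} (\<lambda>z. max 0 ((1 + z) / 2 - y) powr ((p - 1) / p))"
  proof (rule continuous_on_powr')
    show "continuous_on {-1..1} (\<lambda>z. max 0 ((1 + z) / 2 - y))"
      by (intro continuous_on_max continuous_intros) simp
  qed (use assms(1) in auto)
  then show ?thesis unfolding calib_def[abs_def]
    using nz by (intro continuous_on_divide continuous_on_mult continuous_on_const continuous_on_real_sqrt
      continuous_on_add continuous_on_diff continuous_on_power continuous_on_id)
qed

lemma calib_nonneg: "p > 1 \<Longrightarrow> \<delta> > 0 \<Longrightarrow> z \<in> {-1..1} \<Longrightarrow> calib p \<mu> \<delta> y z \<ge> 0"
  using sqrt_regularized_pos[of z \<delta>] by (simp add: calib_def)

lemma energy_density_integrable:
  assumes "profile p s t z \<zeta> \<kappa>"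
  shows "energy_density p \<mu> z \<kappa> integrable_on {s..t}"
proof -
  have "(\<lambda>r. \<kappa> r powr p) absolutely_integrable_on {s..t}"
    using assms unfolding profile_def by blast
  then have "(\<lambda>r. \<kappa> r powr p) integrable_on {s..t}" by (simp add: absolutely_integrable_on_def)
  then have "(\<lambda>r. \<kappa> r powr p + (p - 1) * \<mu> powr p * ((1 + z r) / 2)) integrable_on {s..t}"
    by (rule integrable_add) (auto intro!: integrable_continuous_real continuous_intros profile_continuous[OF assms])
  then show ?thesis by (simp add: energy_density_def[abs_def])
qed

lemma calib_chain:
  assumes P: "profile p s t z \<zeta> \<kappa>" and st: "s \<le> t" and p: "p > 1" and \<delta>: "\<delta> > 0"
  shows "(\<lambda>r. calib p \<mu> \<delta> y (z r) * \<zeta> r) absolutely_integrable_on {s..t}"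
    and "integral {s..t} (\<lambda>r. calib p \<mu> \<delta> y (z r) * \<zeta> r)
     = integral {-1..z t} (calib p \<mu> \<delta> y) - integral {-1..z s} (calib p \<mu> \<delta> y)"
proof -
  have \<zeta>: "\<zeta> absolutely_integrable_on {s..t}" and z: "\<And>r. r \<in> {s..t} \<Longrightarrow> z r = z s + integral {s..r} \<zeta>"
    using P unfolding profile_def by blast+
  have d: "((\<lambda>u. integral {-1..u} (calib p \<mu> \<delta> y)) has_real_derivative calib p \<mu> \<delta> y u) (at u within {-1..1})"
    if "u \<in> {-1..1}" for u
    by (rule integral_has_real_derivative[OF calib_continuous[OF p \<delta>] that])
  have im: "z ` {s..t} \<subseteq> {-1..1}" using profile_range[OF P] by auto
  show "(\<lambda>r. calib p \<mu> \<delta> y (z r) * \<zeta> r) absolutely_integrable_on {s..t}"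
    "integral {s..t} (\<lambda>r. calib p \<mu> \<delta> y (z r) * \<zeta> r)
     = integral {-1..z t} (calib p \<mu> \<delta> y) - integral {-1..z s} (calib p \<mu> \<delta> y)"
    using chain_rule_indefinite_integral[OF \<zeta> st z d calib_continuous[OF p \<delta>] im] by blast+
qed

text \<open>The amount \<open>y\<close> is taken off \<open>(1 + z) / 2\<close> before Young's
  inequality is applied, so its share of the energy survives as the linear term, and the remainder
  is calibrated with the correspondingly smaller weight.\<close>

lemma calibration_bound:
  assumes P: "profile p s t z \<zeta> \<kappa>" and st: "s \<le> t" and p: "p > 1" and \<delta>: "\<delta> > 0" and \<mu>: "\<mu> > 0"
    and y: "y \<ge> 0" "\<And>r. r \<in> {s..t} \<Longrightarrow> y \<le> (1 + z r) / 2"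
  shows "(p - 1) * \<mu> powr p * y * (t - s)
      + \<bar>integral {-1..z t} (calib p \<mu> \<delta> y) - integral {-1..z s} (calib p \<mu> \<delta> y)\<bar>
      \<le> integral {s..t} (energy_density p \<mu> z \<kappa>)"
proof -
  let ?g = "\<lambda>r. calib p \<mu> \<delta> y (z r) * \<zeta> r"
  note ai = calib_chain(1)[OF P st p \<delta>, of \<mu> y]
  have zb: "z r \<in> {-1..1}" if "r \<in> {s..t}" for r using profile_range[OF P that] by auto
  define E where "E r = energy_density p \<mu> z \<kappa> r - (p - 1) * \<mu> powr p * y" for r
  have Ei: "E integrable_on {s..t}"
    unfolding E_def[abs_def] by (intro integrable_diff energy_density_integrable[OF P] integrable_const_ivl)
  have ae: "AE r in lebesgue. r \<in> {s<..<t} \<longrightarrow> \<bar>\<zeta> r\<bar> = \<kappa> r * sqrt (1 - (z r)\<^sup>2)"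
    using P unfolding profile_def by blast
  have "AE r in lebesgue. r \<in> {s<..<t} \<longrightarrow> norm (?g r) \<le> E r"
    using ae
  proof eventually_elim
    case (elim r)
    show ?case
    proof
      assume r: "r \<in> {s<..<t}"
      then have zr: "z r \<in> {-1..1}" and yr: "y \<le> (1 + z r) / 2" using zb y(2) by auto
      note sp = sqrt_regularized_pos[OF zr \<delta>]
      have k: "\<kappa> r \<ge> 0" by (rule profile_nonneg[OF P])
      \<comment> \<open>The regularization enlarges the root and hence weakens the weight: the error
        has the favourable sign for every \<open>\<delta>\<close>.\<close>
      have "\<bar>\<zeta> r\<bar> \<le> \<kappa> r * sqrt (1 - (z r)\<^sup>2 + \<delta>)"
        using elim r k \<delta> by (auto intro!: mult_left_mono)
      then have "\<bar>\<zeta> r\<bar> / sqrt (1 - (z r)\<^sup>2 + \<delta>) \<le> \<kappa> r" using sp by (simp add: pos_divide_le_eq)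
      then have "p * \<mu> powr (p - 1) * ((1 + z r) / 2 - y) powr ((p - 1) / p) * (\<bar>\<zeta> r\<bar> / sqrt (1 - (z r)\<^sup>2 + \<delta>))
          \<le> p * \<mu> powr (p - 1) * ((1 + z r) / 2 - y) powr ((p - 1) / p) * \<kappa> r"
        using p by (intro mult_left_mono) auto
      also have "\<dots> \<le> \<kappa> r powr p + (p - 1) * \<mu> powr p * ((1 + z r) / 2 - y)"
        by (rule young_powr) (use p k yr \<mu> in auto)
      also have "\<dots> = E r" by (simp add: E_def energy_density_def algebra_simps)
      finally show "norm (?g r) \<le> E r"
        using p sp yr by (simp add: calib_def abs_mult max_def)
    qed
  qed
  then obtain N where N: "negligible N" "{r. \<not> (r \<in> {s<..<t} \<longrightarrow> norm (?g r) \<le> E r)} \<subseteq> N"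
    unfolding eventually_ae_filter_negligible by blast
  have N': "negligible (N \<union> {s,t})" using N(1) by simp
  \<comment> \<open>The comparison of integrals wants a bound at every point, so both integrands are
    set to zero on the exceptional null set.\<close>
  let ?h = "\<lambda>r. if r \<in> N \<union> {s,t} then 0 else ?g r" and ?E = "\<lambda>r. if r \<in> N \<union> {s,t} then 0 else E r"
  have gi: "?g integrable_on {s..t}" using ai by (simp add: absolutely_integrable_on_def)
  have "norm (integral {s..t} ?h) \<le> integral {s..t} ?E"
  proof (rule integral_norm_bound_integral)
    show "?h integrable_on {s..t}" by (rule integrable_spike[OF gi N']) auto
    show "?E integrable_on {s..t}" by (rule integrable_spike[OF Ei N']) auto
    fix r assume "r \<in> {s..t}"
    then have "norm (?g r) \<le> E r" if "r \<notin> N \<union> {s,t}"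
      using subsetD[OF N(2), of r] that by auto
    then show "norm (?h r) \<le> ?E r" by simp
  qed
  moreover have "integral {s..t} ?h = integral {s..t} ?g" by (rule integral_spike[OF N']) auto
  moreover have "integral {s..t} ?E = integral {s..t} E" by (rule integral_spike[OF N']) auto
  moreover have "integral {s..t} E = integral {s..t} (energy_density p \<mu> z \<kappa>) - (p - 1) * \<mu> powr p * y * (t - s)"
    unfolding E_def[abs_def] using st
    by (subst Henstock_Kurzweil_Integration.integral_diff[OF energy_density_integrable[OF P] integrable_const_ivl]) simp
  ultimately show ?thesis using calib_chain(2)[OF P st p \<delta>, of \<mu> y] by simp
qed

section \<open>Lower bounds for the energy of loops and segments\<close>

lemma loop_bound:
  assumes P: "profile p a b z \<zeta> \<kappa>" and t: "t \<in> {a..b}" "z t = 1" and p: "p > 1" and \<delta>: "\<delta> > 0" and \<mu>: "\<mu> > 0"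
  shows "2 * integral {-1..1} (calib p \<mu> \<delta> 0) - integral {-1..z a} (calib p \<mu> \<delta> 0) - integral {-1..z b} (calib p \<mu> \<delta> 0)
    \<le> integral {a..b} (energy_density p \<mu> z \<kappa>)"
proof -
  have P1: "profile p a t z \<zeta> \<kappa>" and P2: "profile p t b z \<zeta> \<kappa>"
    using profile_subinterval[OF P] t by auto
  have nn: "0 \<le> (1 + z r) / 2" if "r \<in> {a..b}" for r using profile_range[OF P that] by auto
  have "integral {-1..z t} (calib p \<mu> \<delta> 0) - integral {-1..z a} (calib p \<mu> \<delta> 0) \<le> integral {a..t} (energy_density p \<mu> z \<kappa>)"
    using calibration_bound[OF P1 _ p \<delta> \<mu>, of 0] nn t by auto
  moreover have "integral {-1..z t} (calib p \<mu> \<delta> 0) - integral {-1..z b} (calib p \<mu> \<delta> 0) \<le> integral {t..b} (energy_density p \<mu> z \<kappa>)"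
    using calibration_bound[OF P2 _ p \<delta> \<mu>, of 0] nn t by auto
  moreover have "integral {a..t} (energy_density p \<mu> z \<kappa>) + integral {t..b} (energy_density p \<mu> z \<kappa>) = integral {a..b} (energy_density p \<mu> z \<kappa>)"
    using t by (intro Henstock_Kurzweil_Integration.integral_combine energy_density_integrable[OF P]) auto
  ultimately show ?thesis using t by simp
qed

text \<open>A primitive of \<open>p \<mu>\<^sup>p\<^sup>-\<^sup>1 ((1 + z) / 2)\<^sup>-\<^sup>1\<^sup>/\<^sup>2\<^sup>-\<^sup>1\<^sup>/\<^sup>p\<close>; the exponent exceeds \<open>-1\<close> because \<open>p > 2\<close>.\<close>

definition flat_margin :: "real \<Rightarrow> real \<Rightarrow> real \<Rightarrow> real" where
  "flat_margin p \<mu> Z = 2 * p * \<mu> powr (p - 1) / (1/2 - 1/p) * ((1 + Z) / 2) powr (1/2 - 1/p)"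

text \<open>With \<open>X = (1 + z) / 2\<close> and \<open>\<alpha> = (p - 1) / p\<close>, the
  numerator changes by at most \<open>y * X powr (\<alpha> - 1)\<close>, because
  \<open>1 - u \<le> (1 - u) powr \<alpha>\<close> for \<open>u = y / X\<close> below 1; beyond that
  the truncation makes it trivial. The denominator is at least \<open>sqrt X\<close>, which gives
  the exponent.\<close>

lemma calib_difference:
  assumes p: "p > 2" and \<mu>: "\<mu> > 0" and \<delta>: "\<delta> > 0" and y: "y \<ge> 0" and z: "-1 < z" "z \<le> 0"
  shows "calib p \<mu> \<delta> 0 z - calib p \<mu> \<delta> y z \<le> y * (p * \<mu> powr (p - 1) * ((1 + z) / 2) powr (1/2 - 1/p - 1))"
proof -
  define X where "X = (1 + z) / 2"
  define \<alpha> where "\<alpha> = (p - 1) / p"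
  have X: "X > 0" using z by (simp add: X_def)
  have \<alpha>: "\<alpha> > 0" "\<alpha> \<le> 1" using p by (auto simp: \<alpha>_def)
  have key: "X powr \<alpha> - max 0 (X - y) powr \<alpha> \<le> y * X powr (\<alpha> - 1)"
  proof (cases "X \<le> y")
    case True
    have "X powr \<alpha> = X * X powr (\<alpha> - 1)" using X by (simp add: powr_diff)
    also have "\<dots> \<le> y * X powr (\<alpha> - 1)" using True by (intro mult_right_mono) auto
    finally show ?thesis using True by (simp add: max_absorb1)
  next
    case False
    then have "(X - y) = X * (1 - y / X)" "1 - y/X \<ge> 0" "1 - y/X \<le> 1" "1 - y/X > 0" using X y by (auto simp: field_simps)
    then have "max 0 (X - y) powr \<alpha> = X powr \<alpha> * (1 - y/X) powr \<alpha>" using X False by (simp add: powr_mult max_def)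
    moreover have "(1 - y/X) powr 1 \<le> (1 - y/X) powr \<alpha>"
      using \<open>1 - y/X > 0\<close> \<open>1 - y/X \<le> 1\<close> \<alpha> by (intro powr_mono') auto
    ultimately have "X powr \<alpha> * (1 - y/X) \<le> max 0 (X - y) powr \<alpha>"
      using \<open>1 - y/X > 0\<close> by (simp add: mult_left_mono)
    moreover have "X powr \<alpha> * (1 - y/X) = X powr \<alpha> - y * X powr (\<alpha> - 1)"
      using X by (simp add: powr_diff algebra_simps)
    ultimately show ?thesis by simp
  qed
  \<comment> \<open>For \<open>z \<le> 0\<close> one has
    \<open>1 - z^2 = (1 + z) * (1 - z) \<ge> 1 + z\<close>.\<close>
  have "X \<le> 1 - z\<^sup>2 + \<delta>"
  proof -
    have "z * z \<le> (-1) * z" using z by (intro mult_right_mono_neg) auto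
    then show ?thesis using z \<delta> by (simp add: X_def power2_eq_square)
  qed
  then have s: "sqrt X \<le> sqrt (1 - z\<^sup>2 + \<delta>)" by simp
  have "calib p \<mu> \<delta> 0 z - calib p \<mu> \<delta> y z = p * \<mu> powr (p - 1) * (X powr \<alpha> - max 0 (X - y) powr \<alpha>) / sqrt (1 - z\<^sup>2 + \<delta>)"
    using X by (simp add: calib_def X_def \<alpha>_def diff_divide_distrib right_diff_distrib max_def)
  also have "\<dots> \<le> p * \<mu> powr (p - 1) * (y * X powr (\<alpha> - 1)) / sqrt (1 - z\<^sup>2 + \<delta>)"
    using key p s X by (intro divide_right_mono mult_left_mono) (auto intro: order_trans[of 0 "sqrt X"])
  also have "\<dots> \<le> p * \<mu> powr (p - 1) * (y * X powr (\<alpha> - 1)) / sqrt X"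
    using s X p y by (intro divide_left_mono) (auto intro: order.strict_trans2[of 0 "sqrt X"])
  also have "\<dots> = y * (p * \<mu> powr (p - 1) * X powr (1/2 - 1/p - 1))"
  proof -
    have "1/2 - 1/p - 1 = (\<alpha> - 1) - 1/2" using p by (simp add: \<alpha>_def field_simps)
    then have "X powr (1/2 - 1/p - 1) = X powr (\<alpha> - 1) / sqrt X" using X by (simp only: powr_diff) (simp add: powr_half_sqrt)
    then show ?thesis by simp
  qed
  finally show ?thesis by (simp add: X_def)
qed

text \<open>The majorant from \<open>calib_difference\<close> can be unbounded near
  \<open>z = -1\<close>, but its primitive is continuous up to that point. Hence the fundamental
  theorem in its interior form and a comparison on the open interval.\<close>

lemma calib_integral_difference:
  assumes p: "p > 2" and \<mu>: "\<mu> > 0" and \<delta>: "\<delta> > 0" and y: "y \<ge> 0" and Z: "-1 \<le> Z" "Z \<le> 0"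
  shows "integral {-1..Z} (calib p \<mu> \<delta> 0) - integral {-1..Z} (calib p \<mu> \<delta> y) \<le> y * flat_margin p \<mu> Z"
proof -
  define \<beta> where "\<beta> = 1/2 - 1/p"
  have \<beta>: "\<beta> > 0" using p by (simp add: \<beta>_def field_simps)
  let ?k = "\<lambda>z. y * (p * \<mu> powr (p - 1) * ((1 + z) / 2) powr (\<beta> - 1))"
  let ?K = "\<lambda>z. y * (2 * p * \<mu> powr (p - 1) / \<beta> * ((1 + z) / 2) powr \<beta>)"
  have "(?k has_integral (?K Z - ?K (-1))) {-1..Z}"
  proof (rule fundamental_theorem_of_calculus_interior[OF Z(1)])
    show "continuous_on {-1..Z} ?K" using \<beta> by (intro continuous_intros continuous_on_powr') auto
    fix x assume x: "x \<in> {-1<..<Z}"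
    then have "(?K has_real_derivative ?k x) (at x)"
      using \<beta> by (auto intro!: derivative_eq_intros simp: field_simps)
    then show "(?K has_vector_derivative ?k x) (at x)" by (simp add: has_real_derivative_iff_has_vector_derivative)
  qed
  then have kI: "(?k has_integral y * flat_margin p \<mu> Z) {-1..Z}"
    using \<beta> by (simp add: flat_margin_def \<beta>_def)
  have ci: "calib p \<mu> \<delta> u integrable_on {-1..Z}" for u
    by (intro integrable_continuous_real continuous_on_subset[OF calib_continuous[of p \<delta>]]) (use p \<delta> Z in auto)
  have kI': "(?k has_integral y * flat_margin p \<mu> Z) {-1<..<Z}"
    using kI by (simp add: has_integral_Icc_iff_Ioo)
  have "((\<lambda>z. calib p \<mu> \<delta> 0 z - calib p \<mu> \<delta> y z) has_integral
      (integral {-1..Z} (calib p \<mu> \<delta> 0) - integral {-1..Z} (calib p \<mu> \<delta> y))) {-1..Z}"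
    by (intro has_integral_diff integrable_integral ci)
  then have "((\<lambda>z. calib p \<mu> \<delta> 0 z - calib p \<mu> \<delta> y z) has_integral
      (integral {-1..Z} (calib p \<mu> \<delta> 0) - integral {-1..Z} (calib p \<mu> \<delta> y))) {-1<..<Z}"
    by (simp add: has_integral_Icc_iff_Ioo)
  then show ?thesis
    by (rule has_integral_le[OF _ kI']) (use calib_difference[OF p \<mu> \<delta> y] Z in \<open>auto simp: \<beta>_def\<close>)
qed

text \<open>Let \<open>z\<close> be minimal at \<open>t\<close>, with
  \<open>(1 + z t) / 2 = y\<close>. The weight with shift \<open>y\<close> vanishes below
  \<open>z t\<close>, so calibrating from \<open>t\<close> towards both ends yields the full
  integrals from \<open>-1\<close>. The linear term, \<open>y\<close> times the length up to a
  constant, pays for replacing the shift \<open>y\<close> by 0. If \<open>z\<close> reaches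
  \<open>-1\<close>, then \<open>y = 0\<close> and nothing has to be paid, so no case distinction
  arises.\<close>

lemma segment_bound:
  assumes P: "profile p a b z \<zeta> \<kappa>" and ab: "a \<le> b" and p: "p > 2" and \<delta>: "\<delta> > 0" and \<mu>: "\<mu> > 0"
    and zneg: "\<And>r. r \<in> {a..b} \<Longrightarrow> z r \<le> 0"
    and margin: "flat_margin p \<mu> (z a) + flat_margin p \<mu> (z b) \<le> (p - 1) * \<mu> powr p * (b - a)"
  shows "integral {-1..z a} (calib p \<mu> \<delta> 0) + integral {-1..z b} (calib p \<mu> \<delta> 0)
    \<le> integral {a..b} (energy_density p \<mu> z \<kappa>)"
proof -
  have p1: "p > 1" using p by simp
  obtain t where t: "t \<in> {a..b}" "\<And>r. r \<in> {a..b} \<Longrightarrow> z t \<le> z r"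
    using continuous_attains_inf[OF compact_Icc _ profile_continuous[OF P]] ab by auto
  define y where "y = (1 + z t) / 2"
  have zb: "-1 \<le> z r" "z r \<le> 1" if "r \<in> {a..b}" for r using profile_range[OF P that] by auto
  have y: "y \<ge> 0" using zb[OF t(1)] by (simp add: y_def)
  have ym: "y \<le> (1 + z r) / 2" if "r \<in> {a..b}" for r using t(2)[OF that] by (simp add: y_def)
  have P1: "profile p a t z \<zeta> \<kappa>" and P2: "profile p t b z \<zeta> \<kappa>"
    using profile_subinterval[OF P] t by auto
  let ?C = "(p - 1) * \<mu> powr p"
  have 0: "integral {-1..z t} (calib p \<mu> \<delta> y) = 0"
  proof -
    have "integral {-1..z t} (calib p \<mu> \<delta> y) = integral {-1..z t} (\<lambda>z. 0)"
      by (rule Henstock_Kurzweil_Integration.integral_cong) (simp add: calib_def y_def max_def)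
    then show ?thesis by simp
  qed
  have "?C * y * (t - a) + integral {-1..z a} (calib p \<mu> \<delta> y) \<le> integral {a..t} (energy_density p \<mu> z \<kappa>)"
    using calibration_bound[OF P1 _ p1 \<delta> \<mu> y] ym t 0 by auto
  moreover have "?C * y * (b - t) + integral {-1..z b} (calib p \<mu> \<delta> y) \<le> integral {t..b} (energy_density p \<mu> z \<kappa>)"
    using calibration_bound[OF P2 _ p1 \<delta> \<mu> y] ym t 0 by auto
  moreover have "integral {a..t} (energy_density p \<mu> z \<kappa>) + integral {t..b} (energy_density p \<mu> z \<kappa>) = integral {a..b} (energy_density p \<mu> z \<kappa>)"
    using t by (intro Henstock_Kurzweil_Integration.integral_combine energy_density_integrable[OF P]) auto
  moreover have "?C * y * (t - a) + ?C * y * (b - t) = y * (?C * (b - a))" by (simp add: algebra_simps)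
  moreover have "y * (flat_margin p \<mu> (z a) + flat_margin p \<mu> (z b)) \<le> y * (?C * (b - a))"
    using margin y by (rule mult_left_mono)
  moreover have "integral {-1..z r} (calib p \<mu> \<delta> 0) - integral {-1..z r} (calib p \<mu> \<delta> y) \<le> y * flat_margin p \<mu> (z r)" if "r \<in> {a..b}" for r
    by (rule calib_integral_difference[OF p \<mu> \<delta> y]) (use that zb zneg in auto)
  from this[of a] this[of b] have "integral {-1..z a} (calib p \<mu> \<delta> 0) + integral {-1..z b} (calib p \<mu> \<delta> 0) - (integral {-1..z a} (calib p \<mu> \<delta> y) + integral {-1..z b} (calib p \<mu> \<delta> y)) \<le> y * (flat_margin p \<mu> (z a) + flat_margin p \<mu> (z b))"
    using ab by (simp add: distrib_left)
  ultimately show ?thesis by linarith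
qed

lemma flat_margin_small:
  assumes p: "p > 2" and \<mu>: "\<mu> > 0" and e: "e > 0"
  obtains \<rho> where "\<rho> > 0" "\<rho> \<le> 1" "\<And>Z. -1 \<le> Z \<Longrightarrow> Z \<le> -1 + \<rho> \<Longrightarrow> flat_margin p \<mu> Z \<le> e"
proof -
  define \<beta> where "\<beta> = 1/2 - 1/p"
  have \<beta>: "\<beta> > 0" using p by (simp add: \<beta>_def field_simps)
  define C where "C = 2 * p * \<mu> powr (p - 1) / \<beta>"
  have C: "C > 0" using p \<mu> \<beta> by (simp add: C_def)
  \<comment> \<open>Solves \<open>C * \<rho> powr \<beta> = e\<close>, except for the cap at 1,
    which later guarantees \<open>z \<le> 0\<close> on the segments.\<close>
  define \<rho> where "\<rho> = min 1 ((e / C) powr (1 / \<beta>))"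
  show thesis
  proof (rule that[of \<rho>])
    show "\<rho> > 0" "\<rho> \<le> 1" using e C by (auto simp: \<rho>_def)
    fix Z assume Z: "-1 \<le> Z" "Z \<le> -1 + \<rho>"
    have "\<rho> \<ge> 0" using e C by (simp add: \<rho>_def)
    have "((1 + Z) / 2) powr \<beta> \<le> ((e / C) powr (1 / \<beta>)) powr \<beta>"
      using Z \<beta> \<open>\<rho> \<ge> 0\<close> by (intro powr_mono2) (auto simp: \<rho>_def)
    also have "\<dots> = e / C" using \<beta> e C by (simp add: powr_powr)
    finally have "C * ((1 + Z) / 2) powr \<beta> \<le> C * (e / C)" using C by (intro mult_left_mono) auto
    then show "flat_margin p \<mu> Z \<le> e"
      unfolding flat_margin_def \<beta>_def[symmetric] C_def[symmetric] using C by simp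
  qed
qed

text \<open>Equality case of the calibration, up to the regularization.\<close>

lemma half_loop_limit:
  assumes P: "profile p a b z \<zeta> \<kappa>" and ab: "a \<le> b" and p: "p > 1" and \<mu>: "\<mu> > 0"
    and \<sigma>: "\<sigma> \<in> {1, -1}" "z a = - \<sigma>" "z b = \<sigma>"
    and ae: "AE r in lebesgue. r \<in> {a<..<b} \<longrightarrow> -1 < z r \<and> z r < 1 \<and> \<sigma> * \<zeta> r \<ge> 0 \<and> \<kappa> r = \<mu> * ((1 + z r) / 2) powr (1 / p)"
  shows "(\<lambda>n. integral {-1..1} (calib p \<mu> (1 / real (Suc n)) 0)) \<longlonglongrightarrow> integral {a..b} (energy_density p \<mu> z \<kappa>)"
proof -
  let ?\<delta> = "\<lambda>n. 1 / real (Suc n)"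
  let ?f = "energy_density p \<mu> z \<kappa>"
  let ?g = "\<lambda>n r. \<sigma> * (calib p \<mu> (?\<delta> n) 0 (z r) * \<zeta> r)"
  have \<delta>: "?\<delta> n > 0" for n by simp
  note ch = calib_chain[OF P ab p \<delta>]
  have gi: "?g n integrable_on {a..b}" for n
    using ch(1)[of \<mu> n 0] by (intro integrable_on_mult_right) (simp add: absolutely_integrable_on_def)
  \<comment> \<open>\<open>z\<close> runs from \<open>-1\<close> to 1 or backwards according to
    \<open>\<sigma>\<close>. In both cases one of the two integrals from the chain rule is over a
    single point.\<close>
  have G: "integral {-1..1} (calib p \<mu> (?\<delta> n) 0) = integral {a..b} (?g n)" for n
    using ch(2)[of \<mu> n 0] \<sigma> by (subst integral_mult_right) auto
  have "AE r in lebesgue. r \<in> {a<..<b} \<longrightarrow> \<bar>\<zeta> r\<bar> = \<kappa> r * sqrt (1 - (z r)\<^sup>2)"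
    using P unfolding profile_def by blast
  \<comment> \<open>Since \<open>\<zeta>\<close> keeps its sign and \<open>\<kappa>\<close> realizes
    equality in Young's inequality, the calibration integrand is the energy density times a factor
    that is at most 1 and tends to 1 with \<open>n\<close>. The energy density itself is therefore
    the dominating function.\<close>
  with ae have "AE r in lebesgue. r \<in> {a<..<b} \<longrightarrow>
     (\<forall>n. ?g n r = ?f r * (sqrt (1 - (z r)\<^sup>2) / sqrt (1 - (z r)\<^sup>2 + ?\<delta> n))) \<and> ?f r \<ge> 0 \<and> \<bar>z r\<bar> < 1"
  proof eventually_elim
    case (elim r)
    show ?case
    proof
      assume r: "r \<in> {a<..<b}"
      define X where "X = (1 + z r) / 2"
      have zr: "-1 < z r" "z r < 1" and k: "\<kappa> r = \<mu> * X powr (1/p)" and s: "\<sigma> * \<zeta> r \<ge> 0"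
        and \<zeta>: "\<bar>\<zeta> r\<bar> = \<kappa> r * sqrt (1 - (z r)\<^sup>2)"
        using elim r by (auto simp: X_def)
      have X: "X > 0" using zr by (simp add: X_def)
      have abs\<zeta>: "\<sigma> * \<zeta> r = \<bar>\<zeta> r\<bar>" using s \<sigma>(1) by auto
      have kp: "\<kappa> r powr p = \<mu> powr p * X" using k X \<mu> p by (simp add: powr_mult powr_powr)
      then have f: "?f r = p * \<mu> powr p * X" 
        by (simp only: energy_density_def X_def[symmetric]) (simp add: left_diff_distrib)
      have "\<mu> powr (p - 1) * X powr ((p - 1) / p) * \<kappa> r = (\<mu> powr (p - 1) * \<mu>) * (X powr ((p - 1) / p) * X powr (1/p))"
        by (simp add: k mult_ac)
      also have "\<mu> powr (p - 1) * \<mu> = \<mu> powr p" using \<mu> by (simp add: powr_diff)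
      also have "X powr ((p - 1) / p) * X powr (1/p) = X"
        using X p by (simp add: powr_add[symmetric] diff_divide_distrib)
      finally have kf: "p * \<mu> powr (p - 1) * X powr ((p - 1) / p) * \<kappa> r = ?f r" by (simp add: f mult_ac)
      have "?g n r = ?f r * (sqrt (1 - (z r)\<^sup>2) / sqrt (1 - (z r)\<^sup>2 + ?\<delta> n))" for n
      proof -
        have "?g n r = calib p \<mu> (?\<delta> n) 0 (z r) * (\<sigma> * \<zeta> r)" by simp
        also have "\<dots> = (p * \<mu> powr (p - 1) * X powr ((p - 1) / p) * \<kappa> r) * (sqrt (1 - (z r)\<^sup>2) / sqrt (1 - (z r)\<^sup>2 + ?\<delta> n))"
          using X unfolding abs\<zeta> \<zeta> by (simp add: calib_def X_def max_def)
        finally show ?thesis unfolding kf .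
      qed
      moreover have "?f r \<ge> 0" using f X p by simp
      ultimately show "(\<forall>n. ?g n r = ?f r * (sqrt (1 - (z r)\<^sup>2) / sqrt (1 - (z r)\<^sup>2 + ?\<delta> n))) \<and> ?f r \<ge> 0 \<and> \<bar>z r\<bar> < 1"
        using zr by auto
    qed
  qed
  then obtain N where N: "negligible N" "{r. \<not> (r \<in> {a<..<b} \<longrightarrow>
     (\<forall>n. ?g n r = ?f r * (sqrt (1 - (z r)\<^sup>2) / sqrt (1 - (z r)\<^sup>2 + ?\<delta> n))) \<and> ?f r \<ge> 0 \<and> \<bar>z r\<bar> < 1)} \<subseteq> N"
    unfolding eventually_ae_filter_negligible by blast
  have N': "negligible (N \<union> {a,b})" using N(1) by simp
  let ?G = "\<lambda>n r. if r \<in> N \<union> {a,b} then 0 else ?g n r" and ?F = "\<lambda>r. if r \<in> N \<union> {a,b} then 0 else ?f r"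
  have "(\<lambda>n. integral {a..b} (?G n)) \<longlonglongrightarrow> integral {a..b} ?F"
  proof (rule dominated_convergence(2))
    show "?G n integrable_on {a..b}" for n by (rule integrable_spike[OF gi N']) auto
    show "?F integrable_on {a..b}" by (rule integrable_spike[OF energy_density_integrable[OF P] N']) auto
    fix r assume r: "r \<in> {a..b}"
    have *: "(\<forall>n. ?g n r = ?f r * (sqrt (1 - (z r)\<^sup>2) / sqrt (1 - (z r)\<^sup>2 + ?\<delta> n))) \<and> ?f r \<ge> 0 \<and> \<bar>z r\<bar> < 1"
      if "r \<notin> N \<union> {a,b}"
      using subsetD[OF N(2), of r] that r by auto
    have pos: "1 - (z r)\<^sup>2 > 0" if "r \<notin> N \<union> {a,b}"
      using *[OF that] abs_square_less_1[of "z r"] by auto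
    show "norm (?G n r) \<le> ?F r" for n
    proof (cases "r \<in> N \<union> {a,b}")
      case False
      have "sqrt (1 - (z r)\<^sup>2) \<le> sqrt (1 - (z r)\<^sup>2 + ?\<delta> n)" by simp
      then have "sqrt (1 - (z r)\<^sup>2) / sqrt (1 - (z r)\<^sup>2 + ?\<delta> n) \<le> 1" "0 \<le> sqrt (1 - (z r)\<^sup>2) / sqrt (1 - (z r)\<^sup>2 + ?\<delta> n)"
        using pos[OF False] by (auto simp: divide_le_eq_1 add_pos_pos intro!: divide_nonneg_nonneg)
      then have "\<bar>?f r * (sqrt (1 - (z r)\<^sup>2) / sqrt (1 - (z r)\<^sup>2 + ?\<delta> n))\<bar> \<le> ?f r"
        using *[OF False] unfolding abs_mult by (simp only: abs_of_nonneg mult_left_le)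
      moreover have "?g n r = ?f r * (sqrt (1 - (z r)\<^sup>2) / sqrt (1 - (z r)\<^sup>2 + ?\<delta> n))" using *[OF False] by blast
      ultimately show ?thesis using False by (simp only: if_False real_norm_def)
    qed auto
    show "(\<lambda>n. ?G n r) \<longlonglongrightarrow> ?F r"
    proof (cases "r \<in> N \<union> {a,b}")
      case False
      have "(\<lambda>n. ?f r * (sqrt (1 - (z r)\<^sup>2) / sqrt (1 - (z r)\<^sup>2 + inverse (real (Suc n)))))
          \<longlonglongrightarrow> ?f r * (sqrt (1 - (z r)\<^sup>2) / sqrt (1 - (z r)\<^sup>2 + 0))"
        using pos[OF False] by (intro tendsto_intros LIMSEQ_inverse_real_of_nat) auto
      then have "(\<lambda>n. ?f r * (sqrt (1 - (z r)\<^sup>2) / sqrt (1 - (z r)\<^sup>2 + ?\<delta> n))) \<longlonglongrightarrow> ?f r"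
        using pos[OF False] by (simp add: inverse_eq_divide)
      moreover have "(\<lambda>n. ?g n r) = (\<lambda>n. ?f r * (sqrt (1 - (z r)\<^sup>2) / sqrt (1 - (z r)\<^sup>2 + ?\<delta> n)))"
        using *[OF False] by blast
      ultimately show ?thesis using False by (simp only: if_False)
    qed simp
  qed
  moreover have "integral {a..b} (?G n) = integral {a..b} (?g n)" for n by (rule integral_spike[OF N']) auto
  moreover have "integral {a..b} ?F = integral {a..b} ?f" by (rule integral_spike[OF N']) auto
  ultimately show ?thesis by (simp only: G)
qed

section \<open>The degenerate p-elliptic functions\<close>

definition sec_weight :: "real \<Rightarrow> real \<Rightarrow> real" where
  "sec_weight p \<phi> = \<bar>cos \<phi>\<bar> powr (-2/p)"

text \<open>The integrable majorant is a derivative: with \<open>\<beta> = 1/2 - 1/p\<close>,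
  \<open>|cos x|\<^sup>-\<^sup>2\<^sup>/\<^sup>p \<le> (1 - sin x)\<^sup>\<beta>\<^sup>-\<^sup>1 cos x\<close> on \<open>(0, \<pi>/2)\<close>.\<close>

lemma sec_weight_quarter_integrable:
  assumes p: "p > 2"
  shows "set_integrable lborel {0..pi/2} (sec_weight p)"
proof -
  define \<beta> where "\<beta> = 1/2 - 1/p"
  have \<beta>: "\<beta> > 0" using p by (simp add: \<beta>_def field_simps)
  let ?g = "\<lambda>x. (1 - sin x) powr (\<beta> - 1) * cos x"
  have "(?g has_integral (- ((1 - sin (pi/2)) powr \<beta> / \<beta>) - (- ((1 - sin 0) powr \<beta> / \<beta>)))) {0..pi/2}"
  proof (rule fundamental_theorem_of_calculus_interior)
    show "continuous_on {0..pi/2} (\<lambda>x. - ((1 - sin x) powr \<beta> / \<beta>))"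
      using \<beta> by (intro continuous_intros continuous_on_powr') auto
    fix x assume x: "x \<in> {0<..<pi/2}"
    have "sin x < 1" using x sin_monotone_2pi[of x "pi/2"] by auto
    then have "((\<lambda>x. - ((1 - sin x) powr \<beta> / \<beta>)) has_real_derivative ?g x) (at x)"
      using \<beta> by (auto intro!: derivative_eq_intros)
    then show "((\<lambda>x. - ((1 - sin x) powr \<beta> / \<beta>)) has_vector_derivative ?g x) (at x)"
      by (simp add: has_real_derivative_iff_has_vector_derivative)
  qed simp
  then have gi: "?g integrable_on {0<..<pi/2}" by (auto simp: integrable_on_Icc_iff_Ioo[symmetric])
  have m: "sec_weight p \<in> borel_measurable borel" unfolding sec_weight_def[abs_def] by measurable
  have "sec_weight p absolutely_integrable_on {0<..<pi/2}"
  proof (rule measurable_bounded_by_integrable_imp_absolutely_integrable[OF _ _ gi])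
    show "sec_weight p \<in> borel_measurable (lebesgue_on {0<..<pi/2})"
      using m by (intro measurable_restrict_space1 measurable_completion) simp
    fix x assume x: "x \<in> {0<..<pi/2}"
    have s: "0 < sin x" "sin x < 1" "0 < cos x"
      using x sin_monotone_2pi[of x "pi/2"] sin_gt_zero[of x] cos_gt_zero[of x] by auto
    have c2: "(cos x)\<^sup>2 = (1 - sin x) * (1 + sin x)"
      using sin_cos_squared_add[of x] by (simp add: power2_eq_square algebra_simps)
    also have "\<dots> \<ge> (1 - sin x) * 1" using s by (intro mult_left_mono) auto
    finally have c2': "1 - sin x \<le> (cos x)\<^sup>2" by simp
    have "sqrt (1 - sin x) \<le> sqrt ((cos x)\<^sup>2)" using c2' by (rule real_sqrt_le_mono)
    then have sq: "(1 - sin x) powr (1/2) \<le> cos x" using s by (simp add: powr_half_sqrt)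
    have "sec_weight p x = ((cos x)\<^sup>2) powr (-1/p)"
      using s by (simp add: sec_weight_def powr_powr flip: powr_numeral)
    also have "\<dots> \<le> (1 - sin x) powr (-1/p)" using c2' s p by (intro powr_mono2') auto
    also have "\<dots> = (1 - sin x) powr (\<beta> - 1) * (1 - sin x) powr (1/2)"
      by (simp add: \<beta>_def powr_add[symmetric])
    also have "\<dots> \<le> ?g x" using sq by (intro mult_left_mono) auto
    finally show "norm (sec_weight p x) \<le> ?g x" by (simp add: sec_weight_def)
  qed simp
  then have "sec_weight p absolutely_integrable_on {0..pi/2}"
    by (simp add: absolutely_integrable_on_Icc_iff_Ioo)
  then have i: "integrable lebesgue (\<lambda>x. indicator {0..pi/2} x *\<^sub>R sec_weight p x)"
    by (simp add: set_integrable_def)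
  have "(\<lambda>x. indicator {0..pi/2} x *\<^sub>R sec_weight p x) \<in> borel_measurable lborel" using m by measurable
  from integrable_completion[OF this] i show ?thesis by (simp add: set_integrable_def)
qed

lemma set_integrable_real_affine:
  fixes f :: "real \<Rightarrow> real"
  assumes "set_integrable lborel S f" "c \<noteq> 0" "\<And>x. f (t + c * x) = f x" "\<And>x. x \<in> T \<longleftrightarrow> t + c * x \<in> S"
  shows "set_integrable lborel T f"
proof -
  have "integrable lborel (\<lambda>x. indicator S (t + c * x) *\<^sub>R f (t + c * x))"
    using assms(1) lborel_integrable_real_affine[OF _ assms(2), of "\<lambda>x. indicator S x *\<^sub>R f x" t]
    by (simp add: set_integrable_def)
  moreover have "indicator S (t + c * x) = (indicator T x :: real)" for x
    using assms(4)[of x] by (simp add: indicator_def)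
  ultimately show ?thesis by (simp add: set_integrable_def assms(3))
qed

text \<open>The quarter period is extended by reflection at \<open>pi/2\<close>, translation by
  multiples of \<open>pi\<close> and reflection at 0. Arbitrary intervals are needed because
  \<open>am1p\<close> inverts \<open>F1p\<close> on the whole line.\<close>

lemma sec_weight_integrable:
  assumes p: "p > 2"
  shows "set_integrable lborel {a..b} (sec_weight p)"
proof -
  have h: "set_integrable lborel {pi/2..pi} (sec_weight p)"
    by (rule set_integrable_real_affine[OF sec_weight_quarter_integrable[OF p], of "-1" pi])
       (auto simp: sec_weight_def)
  have "{0..pi} = {0..pi/2} \<union> {pi/2..pi}" by auto
  then have f: "set_integrable lborel {0..pi} (sec_weight p)"
    using set_integrable_Un[OF sec_weight_quarter_integrable[OF p] h] by simp
  have pos: "set_integrable lborel {0..real n * pi} (sec_weight p)" for n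
  proof (induction n)
    case 0
    have "set_integrable lborel {0..0} (sec_weight p)"
      by (rule set_integrable_subset[OF sec_weight_quarter_integrable[OF p]]) auto
    then show ?case by simp
  next
    case (Suc n)
    have "set_integrable lborel {real n * pi..real (Suc n) * pi} (sec_weight p)"
    proof (rule set_integrable_real_affine[OF f, of 1 "- (real n * pi)"])
      show "sec_weight p (- (real n * pi) + 1 * x) = sec_weight p x" for x
        by (simp add: sec_weight_def cos_diff abs_mult algebra_simps)
    qed (auto simp: algebra_simps)
    moreover have "{0..real (Suc n) * pi} = {0..real n * pi} \<union> {real n * pi..real (Suc n) * pi}"
    proof -
      have "0 \<le> real n * pi" "real n * pi \<le> real (Suc n) * pi" by (simp_all add: distrib_right)
      then show ?thesis by (simp add: ivl_disj_un_two_touch(4))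
    qed
    ultimately show ?case using set_integrable_Un[OF Suc.IH] by simp
  qed
  have neg: "set_integrable lborel {- (real n * pi)..0} (sec_weight p)" for n
    by (rule set_integrable_real_affine[OF pos[of n], of "-1" 0]) (auto simp: sec_weight_def)
  obtain n :: nat where "max \<bar>a\<bar> \<bar>b\<bar> / pi \<le> real n" using real_arch_simple by blast
  then have n: "max \<bar>a\<bar> \<bar>b\<bar> \<le> real n * pi" by (simp add: pos_divide_le_eq)
  have "set_integrable lborel ({- (real n * pi)..0} \<union> {0..real n * pi}) (sec_weight p)"
    by (rule set_integrable_Un[OF neg pos]) auto
  then show ?thesis
    by (rule set_integrable_subset) (use n in \<open>auto simp: max_def abs_le_iff split: if_splits\<close>)
qed

lemma sec_weight_integrable_on: "p > 2 \<Longrightarrow> sec_weight p integrable_on {a..b}"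
  by (rule set_borel_integral_eq_integral(1)[OF sec_weight_integrable])

section \<open>The incomplete integral and the amplitude\<close>

lemma F1p_diff:
  assumes p: "p > 2" and xy: "x \<le> y"
  shows "F1p p y - F1p p x = integral {x..y} (sec_weight p)"
proof -
  have pos: "F1p p u = integral {0..u} (sec_weight p)" if "u \<ge> 0" for u
    using interval_integral_eq_integral[OF that sec_weight_integrable[OF p]]
    by (simp add: F1p_def sec_weight_def[abs_def] zero_ereal_def)
  have neg: "F1p p u = - integral {u..0} (sec_weight p)" if "u \<le> 0" for u
    using interval_integral_eq_integral[OF that sec_weight_integrable[OF p]]
      interval_integral_endpoints_reverse[of "ereal 0" "ereal u" "sec_weight p"]
    by (simp add: F1p_def sec_weight_def[abs_def] zero_ereal_def)
  have comb: "integral {u..v} (sec_weight p) + integral {v..w} (sec_weight p) = integral {u..w} (sec_weight p)"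
    if "u \<le> v" "v \<le> w" for u v w
    by (rule Henstock_Kurzweil_Integration.integral_combine[OF that sec_weight_integrable_on[OF p]])
  consider "0 \<le> x" | "x \<le> 0" "0 \<le> y" | "y \<le> 0" by linarith
  then show ?thesis
  proof cases
    case 1 then show ?thesis using pos[of x] pos[of y] comb[of 0 x y] xy by simp
  next
    case 2 then show ?thesis using neg[of x] pos[of y] comb[of x 0 y] xy by simp
  next
    case 3 then show ?thesis using neg[of x] neg[of y] comb[of x y 0] xy by simp
  qed
qed

lemma F1p_mono: "p > 2 \<Longrightarrow> x \<le> y \<Longrightarrow> F1p p x \<le> F1p p y"
  using F1p_diff[of p x y] integral_nonneg[OF sec_weight_integrable_on, of p x y]
  by (simp add: sec_weight_def)

lemma F1p_0 [simp]: "F1p p 0 = 0"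
  by (simp add: F1p_def zero_ereal_def)

lemma F1p_minus: assumes "p > 2" shows "F1p p (- x) = - F1p p x"
proof -
  have *: "F1p p (- u) = - F1p p u" if "u \<ge> 0" for u
  proof -
    have "integral {-u..0} (sec_weight p) = integral {-u..-0} (\<lambda>x. sec_weight p (- x))"
      by (simp add: sec_weight_def[abs_def])
    also have "\<dots> = integral {0..u} (sec_weight p)" by (rule Henstock_Kurzweil_Integration.integral_reflect_real)
    finally show ?thesis using F1p_diff[OF assms, of "-u" 0] F1p_diff[OF assms, of 0 u] that by simp
  qed
  show ?thesis using *[of x] *[of "-x"] by (cases "x \<ge> 0") auto
qed

lemma F1p_half_pi: "F1p p (pi/2) = Kp p"
  unfolding F1p_def Kp_def
proof (rule interval_integral_cong)
  fix x assume "x \<in> einterval (min 0 (ereal (pi/2))) (max 0 (ereal (pi/2)))"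
  then have "0 < x" "x < pi/2" by (auto simp: einterval_iff zero_ereal_def min_def max_def split: if_splits)
  then have "cos x > 0" by (intro cos_gt_zero) auto
  then show "\<bar>cos x\<bar> powr (-2/p) = cos x powr (-2/p)" by simp
qed

lemma F1p_deriv:
  assumes p: "p > 2" and x: "x \<in> {-pi/2<..<pi/2}"
  shows "(F1p p has_real_derivative cos x powr (-2/p)) (at x)"
proof -
  \<comment> \<open>Halfway from \<open>x\<close> to \<open>- pi/2\<close> and to
    \<open>pi/2\<close>: on \<open>{a..b}\<close> the cosine is positive and the weight
    continuous.\<close>
  define a b where "a = (x - pi/2) / 2" and "b = (x + pi/2) / 2"
  have ab: "-pi/2 < a" "a < x" "x < b" "b < pi/2" using x by (auto simp: a_def b_def field_simps)
  have c: "cos u > 0" if "u \<in> {a..b}" for u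
    using that ab by (intro cos_gt_zero_pi) auto
  have "continuous_on {a..b} (sec_weight p)"
    unfolding sec_weight_def[abs_def] using c by (intro continuous_intros) force+
  then have "((\<lambda>u. integral {a..u} (sec_weight p)) has_real_derivative sec_weight p x) (at x within {a..b})"
    by (rule integral_has_real_derivative) (use ab in auto)
  then have "((\<lambda>u. F1p p a + integral {a..u} (sec_weight p)) has_real_derivative sec_weight p x) (at x within {a..b})"
    by (auto intro!: derivative_eq_intros)
  then have "((\<lambda>u. F1p p a + integral {a..u} (sec_weight p)) has_real_derivative sec_weight p x) (at x)"
    using ab by (simp add: at_within_Icc_at)
  then have "(F1p p has_real_derivative sec_weight p x) (at x)"
  proof (rule has_field_derivative_transform_within_open[where S="{a<..<b}"])
    fix u assume "u \<in> {a<..<b}"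
    then show "F1p p a + integral {a..u} (sec_weight p) = F1p p u" using F1p_diff[OF p, of a u] by simp
  qed (use ab in auto)
  then show ?thesis using c[of x] ab by (simp add: sec_weight_def)
qed

lemma F1p_strict_mono:
  assumes p: "p > 2" and x: "-pi/2 < x" "x < y" "y < pi/2"
  shows "F1p p x < F1p p y"
proof (rule DERIV_pos_imp_increasing[OF x(2)])
  fix u assume u: "x \<le> u" "u \<le> y"
  then have "cos u > 0" using x by (intro cos_gt_zero_pi) auto
  then show "\<exists>d. (F1p p has_real_derivative d) (at u) \<and> d > 0"
    using F1p_deriv[OF p, of u] u x by (intro exI[of _ "cos u powr (-2/p)"]) auto
qed

lemma F1p_continuous: "p > 2 \<Longrightarrow> continuous_on {a..b} (F1p p)"
proof -
  assume p: "p > 2"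
  have "continuous_on {a..b} (\<lambda>u. F1p p a + integral {a..u} (sec_weight p))"
    by (intro continuous_intros indefinite_integral_continuous_1 sec_weight_integrable_on[OF p])
  then show ?thesis
    by (rule continuous_on_eq) (use F1p_diff[OF p] in \<open>auto simp: algebra_simps\<close>)
qed

text \<open>\<open>am1p\<close> is an inverse on the whole real line, so preimages outside \<open>(-\<pi>/2, \<pi>/2)\<close> have to be
  excluded.\<close>

lemma am1p_unique:
  assumes p: "p > 2" and x: "x \<in> {-pi/2<..<pi/2}"
  shows "am1p p (F1p p x) = x"
proof -
  have "u = x" if "F1p p u = F1p p x" for u
  proof (rule ccontr)
    assume "u \<noteq> x"
    \<comment> \<open>Halfway between \<open>x\<close> and \<open>u\<close>, with \<open>u\<close>
      clamped to the interval from \<open>- pi/2\<close> to \<open>pi/2\<close>. \<open>F1p\<close>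
      is monotone between \<open>u\<close> and \<open>m\<close> and strictly monotone between
      \<open>m\<close> and \<open>x\<close>, so the two values cannot agree.\<close>
    define m where "m = (if u < x then (max u (-pi/2) + x) / 2 else (min u (pi/2) + x) / 2)"
    show False
    proof (cases "u < x")
      case True
      then have "u \<le> m" "-pi/2 < m" "m < x" using x by (auto simp: m_def max_def)
      then show False using F1p_mono[OF p, of u m] F1p_strict_mono[OF p, of m x] x that by simp
    next
      case False
      then have "m \<le> u" "m < pi/2" "x < m" using x \<open>u \<noteq> x\<close> by (auto simp: m_def min_def)
      then show False using F1p_mono[OF p, of m u] F1p_strict_mono[OF p, of x m] x that by simp
    qed
  qed
  moreover have "F1p p (am1p p (F1p p x)) = F1p p x"
    unfolding am1p_def by (rule f_inv_into_f) simp
  ultimately show ?thesis by blast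
qed

lemma Kp_pos: assumes p: "p > 2" shows "Kp p > 0"
  using F1p_strict_mono[OF p, of 0 "pi/4"] F1p_mono[OF p, of "pi/4" "pi/2"] F1p_half_pi[of p] by simp

lemma am1p_range:
  assumes p: "p > 2" and \<tau>: "\<tau> \<in> {- Kp p<..<Kp p}"
  shows "am1p p \<tau> \<in> {-pi/2<..<pi/2}" "F1p p (am1p p \<tau>) = \<tau>"
proof -
  have "F1p p (-pi/2) = - Kp p" using F1p_minus[OF p, of "pi/2"] F1p_half_pi[of p] by simp
  then obtain x where x: "-pi/2 \<le> x" "x \<le> pi/2" "F1p p x = \<tau>"
    using IVT'[of "F1p p" "-pi/2" \<tau> "pi/2"] F1p_half_pi[of p] F1p_continuous[OF p] \<tau> by auto
  have "x \<noteq> -pi/2"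
  proof
    assume "x = -pi/2"
    then have "F1p p x = - Kp p" using \<open>F1p p (-pi/2) = - Kp p\<close> by (simp only:)
    then show False using x(3) \<tau> by simp
  qed
  moreover have "x \<noteq> pi/2"
  proof
    assume "x = pi/2"
    then have "F1p p x = Kp p" using F1p_half_pi by (simp only:)
    then show False using x(3) \<tau> by simp
  qed
  ultimately have x': "x \<in> {-pi/2<..<pi/2}" using x by (metis greaterThanLessThan_iff order_le_less)
  then show "am1p p \<tau> \<in> {-pi/2<..<pi/2}" "F1p p (am1p p \<tau>) = \<tau>"
    using am1p_unique[OF p x'] x(3) by auto
qed

lemma am1p_0: "p > 2 \<Longrightarrow> am1p p 0 = 0"
  using am1p_unique[of p 0] by simp

lemma am1p_less_0:
  assumes p: "p > 2" and \<tau>: "\<tau> \<in> {- Kp p<..<0}"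
  shows "am1p p \<tau> < 0"
proof (rule ccontr)
  assume "\<not> am1p p \<tau> < 0"
  then have "F1p p 0 \<le> F1p p (am1p p \<tau>)" by (intro F1p_mono[OF p]) auto
  then show False using am1p_range(2)[OF p, of \<tau>] \<tau> Kp_pos[OF p] by auto
qed

lemma am1p_greater_0:
  assumes p: "p > 2" and \<tau>: "\<tau> \<in> {0<..<Kp p}"
  shows "am1p p \<tau> > 0"
proof (rule ccontr)
  assume "\<not> am1p p \<tau> > 0"
  then have "F1p p (am1p p \<tau>) \<le> F1p p 0" by (intro F1p_mono[OF p]) auto
  then show False using am1p_range(2)[OF p, of \<tau>] \<tau> Kp_pos[OF p] by auto
qed

lemma am1p_deriv:
  assumes p: "p > 2" and \<tau>: "\<tau> \<in> {- Kp p<..<Kp p}"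
  shows "(am1p p has_real_derivative cos (am1p p \<tau>) powr (2/p)) (at \<tau>)"
proof -
  let ?x = "am1p p \<tau>"
  note r = am1p_range[OF p \<tau>]
  have c: "cos ?x > 0" using r(1) by (intro cos_gt_zero_pi) auto
  have "isCont (am1p p) (F1p p ?x)"
  proof (rule isCont_inverse_function2[where f="F1p p" and g="am1p p" and x="?x" and a="(?x - pi/2)/2" and b="(?x + pi/2)/2"])
    fix u assume "(?x - pi/2)/2 \<le> u" "u \<le> (?x + pi/2)/2"
    then have u: "u \<in> {-pi/2<..<pi/2}" using r(1) by (auto simp: field_simps)
    show "am1p p (F1p p u) = u" by (rule am1p_unique[OF p u])
    show "isCont (F1p p) u" using F1p_deriv[OF p u] by (rule DERIV_isCont)
  qed (use r(1) in \<open>auto simp: field_simps\<close>)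
  then have "(am1p p has_real_derivative inverse (cos ?x powr (-2/p))) (at \<tau>)"
    using DERIV_inverse_function[where f="F1p p" and g="am1p p" and x=\<tau> and a="- Kp p" and b="Kp p", OF F1p_deriv[OF p r(1)]]
      am1p_range(2)[OF p] \<tau> c r(2) by auto
  then show ?thesis using c by (simp add: powr_minus)
qed

section \<open>The p-hyperbolic functions in terms of the amplitude\<close>

lemma sechp_eq:
  assumes p: "p > 2" and \<tau>: "\<tau> \<in> {- Kp p<..<Kp p}"
  shows "sechp p \<tau> = cos (am1p p \<tau>) powr (2/p)" "sechp p \<tau> powr p = (cos (am1p p \<tau>))\<^sup>2"
proof -
  have c: "cos (am1p p \<tau>) > 0" using am1p_range(1)[OF p \<tau>] by (intro cos_gt_zero_pi) auto
  have "cos (am1p p \<tau>) powr (2/p - 1) * cos (am1p p \<tau>) powr 1 = cos (am1p p \<tau>) powr (2/p)"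
    by (simp only: powr_add[symmetric]) simp
  then show "sechp p \<tau> = cos (am1p p \<tau>) powr (2/p)" using c \<tau> by (simp add: sechp_def)
  then show "sechp p \<tau> powr p = (cos (am1p p \<tau>))\<^sup>2" using c p by (simp add: powr_powr powr_numeral)
qed

lemma tanhp_deriv:
  assumes p: "p > 2" and \<tau>: "\<tau> \<in> {- Kp p<..<Kp p}"
  shows "(tanhp p has_real_derivative (cos (am1p p \<tau>))\<^sup>2) (at \<tau>)"
proof -
  \<comment> \<open>An interval inside \<open>{- Kp p<..<Kp p}\<close> that contains
    \<open>\<tau>\<close> as well as 0, the base point of the integral.\<close>
  define a b where "a = (min \<tau> 0 - Kp p) / 2" and "b = (max \<tau> 0 + Kp p) / 2"
  have ab: "- Kp p < a" "a < \<tau>" "\<tau> < b" "b < Kp p" "a < 0" "0 < b"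
    using \<tau> Kp_pos[OF p] by (auto simp: a_def b_def min_def max_def field_simps)
  have "isCont (am1p p) u" if "u \<in> {a..b}" for u
    using am1p_deriv[OF p, of u] that ab by (auto intro: DERIV_isCont)
  then have "continuous_on {a..b} (am1p p)" by (intro continuous_at_imp_continuous_on) auto
  then have "continuous_on {a..b} (\<lambda>u. (cos (am1p p u))\<^sup>2)" by (intro continuous_intros)
  then have "continuous_on {a..b} (\<lambda>u. sechp p u powr p)"
    by (rule continuous_on_eq) (use sechp_eq(2)[OF p] ab in auto)
  then have "((\<lambda>u. LBINT y=ereal 0..ereal u. sechp p y powr p) has_vector_derivative (sechp p \<tau> powr p)) (at \<tau> within {a..b})"
    by (intro interval_integral_FTC2) (use ab in auto)
  then have "(tanhp p has_vector_derivative (sechp p \<tau> powr p)) (at \<tau>)"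
    using ab by (simp add: at_within_Icc_at tanhp_def[abs_def] zero_ereal_def)
  then show ?thesis using sechp_eq(2)[OF p \<tau>] by (simp add: has_real_derivative_iff_has_vector_derivative)
qed

section \<open>Geometry of flat cores\<close>

definition loop_curve :: "real \<Rightarrow> real \<Rightarrow> real \<Rightarrow> real^2" where
  "loop_curve p \<sigma> s = vector [2 * tanhp p s - s, - \<sigma> * (p / (p - 1)) * sechp p s powr (p - 1)]"

text \<open>The parameter at which the \<open>j\<close>-th segment begins, counted from
  \<open>j = 1\<close>; \<open>2 * Kp p\<close> is the length of a loop.\<close>

definition flat_start :: "real \<Rightarrow> (nat \<Rightarrow> real) \<Rightarrow> nat \<Rightarrow> real" where
  "flat_start p l j = (\<Sum>i\<in>{1..<j}. l i + 2 * Kp p)"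

lemma flat_start_1 [simp]: "flat_start p l (Suc 0) = 0"
  by (simp add: flat_start_def)

lemma flat_start_Suc: "j \<ge> 1 \<Longrightarrow> flat_start p l (Suc j) = flat_start p l j + l j + 2 * Kp p"
  by (simp add: flat_start_def)

lemma flat_start_mono:
  assumes "\<And>j. j \<in> {1..n} \<Longrightarrow> l j \<ge> 0" "Kp p \<ge> 0" "i \<le> j" "j \<le> Suc n"
  shows "flat_start p l i \<le> flat_start p l j"
  unfolding flat_start_def using assms by (intro sum_mono2) auto

text \<open>The translations \<open>k\<close> stay unspecified because only tangents will matter.
  Each loop is described relative to the parameter of its midpoint, where its own parameter is
  0.\<close>

definition flat_pieces :: "real \<Rightarrow> (nat \<Rightarrow> real) \<Rightarrow> (nat \<Rightarrow> real) \<Rightarrow> nat \<Rightarrow> (real \<Rightarrow> real^2) \<Rightarrow> bool" where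
  "flat_pieces p l \<sigma> j g \<longleftrightarrow>
     (\<exists>k. \<forall>s\<in>{flat_start p l j..flat_start p l j + l j}. g s = k + vector [- (s - flat_start p l j), 0]) \<and>
     (\<exists>k. \<forall>s\<in>{flat_start p l j + l j..flat_start p l (Suc j)}. g s = k + loop_curve p (\<sigma> j) (s - (flat_start p l j + l j + Kp p)))"

text \<open>Both branches agree at the junction, so the formula of the second piece holds on the
  closed half-line.\<close>

lemma arc_concat_right:
  fixes g h :: "real \<Rightarrow> real^2"
  assumes "f = (\<lambda>s. if s \<le> a then g s else h (s - a) + g a - h 0)" "s \<ge> a"
  shows "f s = (g a - h 0) + h (s - a)"
  using assms by (cases "s = a") (auto simp: algebra_simps)

lemma segment_loop_block:
  "segment \<Lambda> \<oplus> loop p \<sigma> = (0, \<Lambda> + 2 * Kp p, \<lambda>s. if s \<le> \<Lambda> then vector [- s, 0]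
     else loop_curve p \<sigma> (s - (\<Lambda> + Kp p)) + vector [- \<Lambda>, 0] - loop_curve p \<sigma> (- Kp p))"
  by (simp add: segment_def loop_def loop_curve_def fun_eq_iff algebra_simps)

lemma arc_Concat_pieces:
  assumes K: "Kp p \<ge> 0" and n: "n \<ge> 1" and l: "\<And>j. j \<in> {1..n} \<Longrightarrow> l j \<ge> 0"
  shows "\<exists>g. arc_Concat (\<lambda>j. segment (l j) \<oplus> loop p (\<sigma> j)) n = (0, flat_start p l (Suc n), g) \<and>
     (\<forall>j\<in>{1..n}. flat_pieces p l \<sigma> j g)"
  using n l
proof (induction n rule: nat_induct_at_least)
  case base
  define h where "h = (\<lambda>s. if s \<le> l 1 then vector [- s, 0]
     else loop_curve p (\<sigma> 1) (s - (l 1 + Kp p)) + vector [- l 1, 0] - loop_curve p (\<sigma> 1) (- Kp p))"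
  have "h s = vector [- s, 0]" if "s \<le> l 1" for s using that by (simp add: h_def)
  moreover have "h s = (vector [- l 1, 0] - loop_curve p (\<sigma> 1) (- Kp p)) + loop_curve p (\<sigma> 1) (s - (l 1 + Kp p))" if "s \<ge> l 1" for s
    using that by (cases "s = l 1") (auto simp: h_def)
  ultimately have "flat_pieces p l \<sigma> 1 h"
    unfolding flat_pieces_def by (auto intro!: exI[of _ 0] exI[of _ "vector [- l 1, 0] - loop_curve p (\<sigma> 1) (- Kp p)"])
  then show ?case
    by (auto simp: segment_loop_block flat_start_Suc h_def)
next
  case (Suc n)
  let ?A = "flat_start p l (Suc n)" and ?l = "l (Suc n)" and ?\<sigma> = "\<sigma> (Suc n)"
  obtain g where g: "arc_Concat (\<lambda>j. segment (l j) \<oplus> loop p (\<sigma> j)) n = (0, ?A, g)"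
    "\<And>j. j \<in> {1..n} \<Longrightarrow> flat_pieces p l \<sigma> j g"
    using Suc.IH Suc.prems by auto
  define h where "h = (\<lambda>s. if s \<le> ?l then vector [- s, 0]
     else loop_curve p ?\<sigma> (s - (?l + Kp p)) + vector [- ?l, 0] - loop_curve p ?\<sigma> (- Kp p))"
  define f where "f = (\<lambda>s. if s \<le> ?A then g s else h (s - ?A) + g ?A - h 0)"
  \<comment> \<open>The recursive equation of \<open>arc_Concat\<close> applies only to arguments of
    the form \<open>Suc (Suc m)\<close>.\<close>
  obtain m where m: "n = Suc m" using Suc.hyps by (cases n) auto
  have eq: "arc_Concat (\<lambda>j. segment (l j) \<oplus> loop p (\<sigma> j)) (Suc n) = (0, flat_start p l (Suc (Suc n)), f)"
  proof -
    have "arc_Concat (\<lambda>j. segment (l j) \<oplus> loop p (\<sigma> j)) (Suc n) = (0, ?A, g) \<oplus> (0, ?l + 2 * Kp p, h)"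
      using g(1) unfolding m by (simp only: arc_Concat.simps(3) segment_loop_block h_def m)
    moreover have "flat_start p l (Suc (Suc n)) = ?A + (?l + 2 * Kp p)"
      using flat_start_Suc[of "Suc n" p l] by simp
    ultimately show ?thesis by (simp add: f_def fun_eq_iff)
  qed
  have fA: "f s = (g ?A - h 0) + h (s - ?A)" if "s \<ge> ?A" for s
    by (rule arc_concat_right[OF f_def that])
  have h1: "h s = vector [- s, 0]" if "s \<le> ?l" for s using that by (simp add: h_def)
  have h2: "h s = (vector [- ?l, 0] - loop_curve p ?\<sigma> (- Kp p)) + loop_curve p ?\<sigma> (s - (?l + Kp p))" if "s \<ge> ?l" for s
    using that by (cases "s = ?l") (auto simp: h_def)
  have l0: "?l \<ge> 0" using Suc.prems by simp
  have "flat_pieces p l \<sigma> j f" if j: "j \<in> {1..Suc n}" for j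
  proof (cases "j = Suc n")
    case True
    have "f s = (g ?A - h 0) + vector [- (s - ?A), 0]" if "s \<in> {?A..?A + ?l}" for s
      using fA[of s] h1[of "s - ?A"] that by simp
    moreover have "f s = (g ?A - h 0 + (vector [- ?l, 0] - loop_curve p ?\<sigma> (- Kp p))) + loop_curve p ?\<sigma> (s - (?A + ?l + Kp p))"
      if "s \<ge> ?A + ?l" for s
      using fA[of s] h2[of "s - ?A"] that l0 by (simp add: algebra_simps)
    ultimately show ?thesis unfolding flat_pieces_def True by (meson atLeastAtMost_iff)
  next
    case False
    then have jn: "j \<in> {1..n}" using j by auto
    have "flat_start p l (Suc j) \<le> ?A"
      using Suc.prems K jn by (intro flat_start_mono[where n=n]) auto
    moreover have "flat_start p l j + l j \<le> flat_start p l (Suc j)" using K jn by (simp add: flat_start_Suc)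
    ultimately have fg: "f s = g s" if "s \<le> flat_start p l (Suc j)" for s using that by (simp add: f_def)
    obtain k1 k2 where
      "\<forall>s\<in>{flat_start p l j..flat_start p l j + l j}. g s = k1 + vector [- (s - flat_start p l j), 0]"
      "\<forall>s\<in>{flat_start p l j + l j..flat_start p l (Suc j)}. g s = k2 + loop_curve p (\<sigma> j) (s - (flat_start p l j + l j + Kp p))"
      using g(2)[OF jn] unfolding flat_pieces_def by blast
    then show ?thesis
      using fg \<open>flat_start p l j + l j \<le> flat_start p l (Suc j)\<close> unfolding flat_pieces_def
      by (intro conjI exI[of _ k1] exI[of _ k2]) auto
  qed
  with eq show ?case by blast
qed

lemma flat_arc_pieces:
  assumes K: "Kp p \<ge> 0" and N: "N \<ge> 1" and l: "\<And>j. j \<in> {1..N+1} \<Longrightarrow> l j \<ge> 0"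
  shows "\<exists>g. flat_arc p N \<sigma> l = (0, flat_start p l (N+1) + l (N+1), g) \<and>
     (\<forall>j\<in>{1..N+1}. \<exists>k. \<forall>s\<in>{flat_start p l j..flat_start p l j + l j}. g s = k + vector [- (s - flat_start p l j), 0]) \<and>
     (\<forall>j\<in>{1..N}. \<exists>k. \<forall>s\<in>{flat_start p l j + l j..flat_start p l (Suc j)}. g s = k + loop_curve p (\<sigma> j) (s - (flat_start p l j + l j + Kp p)))"
proof -
  let ?A = "flat_start p l (N+1)" and ?l = "l (N+1)"
  obtain g where g: "arc_Concat (\<lambda>j. segment (l j) \<oplus> loop p (\<sigma> j)) N = (0, ?A, g)"
    "\<And>j. j \<in> {1..N} \<Longrightarrow> flat_pieces p l \<sigma> j g"
    using arc_Concat_pieces[OF K N, of l \<sigma>] l by auto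
  define f where "f = (\<lambda>s. if s \<le> ?A then g s else vector [- (s - ?A), 0] + g ?A - (vector [- 0, 0] :: real^2))"
  have eq: "flat_arc p N \<sigma> l = (0, ?A + ?l, f)"
    using g(1) by (simp add: flat_arc_def segment_def f_def fun_eq_iff)
  have fA: "f s = (g ?A - vector [- 0, 0]) + vector [- (s - ?A), 0]" if "s \<ge> ?A" for s
    using arc_concat_right[OF _ that, of f g "\<lambda>s. vector [- s, 0]"] by (simp add: f_def)
  have low: "flat_start p l j + l j \<le> flat_start p l (Suc j)" "f s = g s" if "j \<in> {1..N}" "s \<le> flat_start p l (Suc j)" for j s
  proof -
    have "flat_start p l (Suc j) \<le> ?A"
      using l K that by (intro flat_start_mono[where n=N]) auto
    then show "f s = g s" using that by (simp add: f_def)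
    show "flat_start p l j + l j \<le> flat_start p l (Suc j)" using K that by (simp add: flat_start_Suc)
  qed
  have 1: "\<exists>k. \<forall>s\<in>{flat_start p l j..flat_start p l j + l j}. f s = k + vector [- (s - flat_start p l j), 0]" if j: "j \<in> {1..N+1}" for j
  proof (cases "j = N + 1")
    case True then show ?thesis using fA by auto
  next
    case False
    then have jN: "j \<in> {1..N}" using j by auto
    obtain k where "\<forall>s\<in>{flat_start p l j..flat_start p l j + l j}. g s = k + vector [- (s - flat_start p l j), 0]"
      using g(2)[OF jN] unfolding flat_pieces_def by blast
    moreover have "f s = g s" if "s \<in> {flat_start p l j..flat_start p l j + l j}" for s
      using low(1)[OF jN order_refl] low(2)[OF jN, of s] that by auto
    ultimately show ?thesis by auto
  qed
  have 2: "\<exists>k. \<forall>s\<in>{flat_start p l j + l j..flat_start p l (Suc j)}. f s = k + loop_curve p (\<sigma> j) (s - (flat_start p l j + l j + Kp p))" if jN: "j \<in> {1..N}" for j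
  proof -
    obtain k where "\<forall>s\<in>{flat_start p l j + l j..flat_start p l (Suc j)}. g s = k + loop_curve p (\<sigma> j) (s - (flat_start p l j + l j + Kp p))"
      using g(2)[OF jN] unfolding flat_pieces_def by blast
    then show ?thesis using low(2)[OF jN] by auto
  qed
  show ?thesis using eq 1 2 by blast
qed

section \<open>Tangents along segments and loops\<close>

lemma tangent_derivative:
  fixes \<gamma> U :: "real \<Rightarrow> real^2"
  assumes cU: "continuous_on {0..L} U" and \<gamma>: "\<And>s. s \<in> {0..L} \<Longrightarrow> \<gamma> s = P0 + integral {0..s} U" and s: "0 < s" "s < L"
  shows "(\<gamma> has_vector_derivative U s) (at s)"
proof -
  have "((\<lambda>u. integral {0..u} U) has_vector_derivative U s) (at s within {0..L})"
    by (rule integral_has_vector_derivative[OF cU]) (use s in auto)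
  then have "((\<lambda>u. P0 + integral {0..u} U) has_vector_derivative U s) (at s within {0..L})"
    by (auto intro!: derivative_eq_intros)
  then have "((\<lambda>u. P0 + integral {0..u} U) has_vector_derivative U s) (at s)"
    using s by (simp add: at_within_Icc_at)
  then show ?thesis
    by (rule has_vector_derivative_transform_within_open[where S="{0<..<L}"]) (use s \<gamma> in auto)
qed

text \<open>Differentiation gives the tangent in the interior, and continuity of \<open>U\<close>
  carries it to the ends. There it supplies the boundary values \<open>z = -1\<close> of the
  neighbouring loops.\<close>

lemma segment_tangent:
  fixes \<gamma> U :: "real \<Rightarrow> real^2"
  assumes cU: "continuous_on {0..L} U" and \<gamma>: "\<And>s. s \<in> {0..L} \<Longrightarrow> \<gamma> s = P0 + integral {0..s} U"
    and ab: "0 \<le> a" "a < b" "b \<le> L"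
    and seg: "\<And>s. s \<in> {a..b} \<Longrightarrow> \<gamma> s = k + (m * (s - a)) *\<^sub>R q" and s: "s \<in> {a..b}"
  shows "U s = m *\<^sub>R q"
proof -
  have "U s = m *\<^sub>R q" if s: "a < s" "s < b" for s
  proof -
    have "(\<gamma> has_vector_derivative U s) (at s)" by (rule tangent_derivative[OF cU \<gamma>]) (use s ab in auto)
    moreover have "((\<lambda>s. k + (m * (s - a)) *\<^sub>R q) has_vector_derivative m *\<^sub>R q) (at s)"
      by (auto intro!: derivative_eq_intros)
    then have "(\<gamma> has_vector_derivative m *\<^sub>R q) (at s)"
      by (rule has_vector_derivative_transform_within_open[where S="{a<..<b}"]) (use s seg in auto)
    ultimately show ?thesis by (rule vector_derivative_unique_at)
  qed
  then have "AE s in lebesgue. s \<in> {a<..<b} \<longrightarrow> U s - m *\<^sub>R q = 0" by (intro AE_I2) auto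
  moreover have "continuous_on {a..b} (\<lambda>s. U s - m *\<^sub>R q)"
    using cU ab by (intro continuous_intros) (auto intro: continuous_on_subset)
  ultimately have "U s - m *\<^sub>R q = 0" using AE_zero_continuous[OF _ _ ab(2) s] by blast
  then show ?thesis by simp
qed

lemma inner_tangent_derivative:
  fixes \<gamma> :: "real \<Rightarrow> real^2"
  assumes "(\<gamma> has_vector_derivative D) (at s)"
  shows "((\<lambda>s. \<gamma> s \<bullet> q) has_real_derivative D \<bullet> q) (at s)"
  using bounded_linear.has_vector_derivative[OF bounded_linear_inner_left assms, of q]
  by (simp add: has_real_derivative_iff_has_vector_derivative)

lemma sechp_0: "p > 2 \<Longrightarrow> sechp p 0 = 1"
  using sechp_eq(1)[of p 0] Kp_pos[of p] am1p_0[of p] by simp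

lemma sechp_Kp: "sechp p (Kp p) = 0" "sechp p (- Kp p) = 0"
  by (auto simp: sechp_def)

text \<open>The longitudinal component comes from differentiating \<open>2 * tanhp p s - s\<close>;
  the scales cancel by \<open>c * \<nu> = 1\<close>. The second claim expresses the turning of the
  loop in a form that survives small perturbations of the tangent: the height along
  \<open>q2\<close> is the same at both ends and different in the middle, so by the mean value
  theorem its derivative takes both signs.\<close>

lemma loop_tangent:
  fixes \<gamma> U :: "real \<Rightarrow> real^2"
  assumes p: "p > 2" and cU: "continuous_on {0..L} U" and \<gamma>: "\<And>s. s \<in> {0..L} \<Longrightarrow> \<gamma> s = P0 + integral {0..s} U"
    and c: "c > 0" "c * \<nu> = 1" and m: "0 \<le> m - Kp p / \<nu>" "m + Kp p / \<nu> \<le> L"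
    and q: "q1 \<bullet> q1 = 1" "q2 \<bullet> q2 = 1" "q1 \<bullet> q2 = 0" and \<sigma>: "\<sigma> \<in> {1, -1}"
    and loop: "\<And>s. s \<in> {m - Kp p / \<nu>..m + Kp p / \<nu>} \<Longrightarrow>
      \<gamma> s = k + c *\<^sub>R (loop_curve p \<sigma> (\<nu> * (s - m)) $ 1 *\<^sub>R q1 + loop_curve p \<sigma> (\<nu> * (s - m)) $ 2 *\<^sub>R q2)"
  shows "\<And>s. s \<in> {m - Kp p / \<nu><..<m + Kp p / \<nu>} \<Longrightarrow> U s \<bullet> q1 = 2 * (cos (am1p p (\<nu> * (s - m))))\<^sup>2 - 1"
    and "\<exists>t1 t2. m - Kp p / \<nu> < t1 \<and> t1 < t2 \<and> t2 < m + Kp p / \<nu> \<and> (U t1 \<bullet> q2) * (U t2 \<bullet> q2) < 0"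
proof -
  have lam: "\<nu> > 0" using c by (metis mult.commute zero_less_mult_pos zero_less_one)
  have K: "Kp p > 0" by (rule Kp_pos[OF p])
  have Kl: "Kp p / \<nu> > 0" using K lam by simp
  have der: "(\<gamma> has_vector_derivative U s) (at s)" if "s \<in> {m - Kp p / \<nu><..<m + Kp p / \<nu>}" for s
    by (rule tangent_derivative[OF cU \<gamma>]) (use that m in auto)
  have q21: "q2 \<bullet> q1 = 0" using q(3) by (simp add: inner_commute)
  have h1: "\<gamma> s \<bullet> q1 = k \<bullet> q1 + c * (2 * tanhp p (\<nu> * (s - m)) - \<nu> * (s - m))" if "s \<in> {m - Kp p / \<nu>..m + Kp p / \<nu>}" for s
    using q q21 by (simp add: loop[OF that] inner_add_left inner_diff_left loop_curve_def vector_2)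
  show "U s \<bullet> q1 = 2 * (cos (am1p p (\<nu> * (s - m))))\<^sup>2 - 1" if s: "s \<in> {m - Kp p / \<nu><..<m + Kp p / \<nu>}" for s
  proof -
    have \<tau>: "\<nu> * (s - m) \<in> {- Kp p<..<Kp p}" using s lam by (auto simp: field_simps)
    have "((\<lambda>s. k \<bullet> q1 + c * (2 * tanhp p (\<nu> * (s - m)) - \<nu> * (s - m))) has_real_derivative
        c * (2 * ((cos (am1p p (\<nu> * (s - m))))\<^sup>2 * \<nu>) - \<nu>)) (at s)"
      by (auto intro!: derivative_eq_intros DERIV_chain2[where f="tanhp p" and g="\<lambda>s. \<nu> * (s - m)", OF tanhp_deriv[OF p \<tau>]])
    then have "((\<lambda>s. \<gamma> s \<bullet> q1) has_real_derivative c * (2 * ((cos (am1p p (\<nu> * (s - m))))\<^sup>2 * \<nu>) - \<nu>)) (at s)"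
      by (rule has_field_derivative_transform_within_open[where S="{m - Kp p / \<nu><..<m + Kp p / \<nu>}"])
         (use s h1 in auto)
    then have "U s \<bullet> q1 = c * (2 * ((cos (am1p p (\<nu> * (s - m))))\<^sup>2 * \<nu>) - \<nu>)"
      using inner_tangent_derivative[OF der[OF s]] by (intro DERIV_unique)
    also have "\<dots> = (c * \<nu>) * (2 * (cos (am1p p (\<nu> * (s - m))))\<^sup>2 - 1)" by (simp add: algebra_simps)
    finally show ?thesis using c by simp
  qed
  define h where "h s = \<gamma> s \<bullet> q2" for s
  define D where "D = c * (- \<sigma> * (p / (p - 1)))"
  have "D \<noteq> 0" using c \<sigma> p by (auto simp: D_def)
  have heq: "h s = k \<bullet> q2 + D * sechp p (\<nu> * (s - m)) powr (p - 1)" if "s \<in> {m - Kp p / \<nu>..m + Kp p / \<nu>}" for s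
    using q by (simp add: h_def loop[OF that] inner_add_left inner_diff_left loop_curve_def vector_2 D_def)
  have h0: "h (m - Kp p / \<nu>) = k \<bullet> q2" "h (m + Kp p / \<nu>) = k \<bullet> q2" "h m = k \<bullet> q2 + D"
    using heq[of "m - Kp p / \<nu>"] heq[of "m + Kp p / \<nu>"] heq[of m] Kl lam sechp_Kp[of p] sechp_0[OF p] by auto
  have "continuous_on {0..L} (\<lambda>s. P0 + integral {0..s} U)"
    by (intro continuous_intros indefinite_integral_continuous_1 integrable_continuous_real cU)
  then have "continuous_on {0..L} \<gamma>" by (rule continuous_on_eq) (use \<gamma> in auto)
  then have hc: "continuous_on {x..y} h" if "0 \<le> x" "y \<le> L" for x y
  proof -
    have "continuous_on {x..y} \<gamma>" by (rule continuous_on_subset[OF \<open>continuous_on {0..L} \<gamma>\<close>]) (use that in auto)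
    then show ?thesis unfolding h_def[abs_def] by (intro continuous_on_inner continuous_on_const)
  qed
  have hd: "(h has_derivative (*) (U s \<bullet> q2)) (at s)" if "s \<in> {m - Kp p / \<nu><..<m + Kp p / \<nu>}" for s
    using inner_tangent_derivative[OF der[OF that], of q2] by (simp add: has_field_derivative_def h_def[abs_def])
  obtain t1 where t1: "m - Kp p / \<nu> < t1" "t1 < m" "h m - h (m - Kp p / \<nu>) = (U t1 \<bullet> q2) * (m - (m - Kp p / \<nu>))"
    using mvt[of "m - Kp p / \<nu>" m h "\<lambda>s. (*) (U s \<bullet> q2)"] hc[of "m - Kp p / \<nu>" m] hd Kl m by auto
  obtain t2 where t2: "m < t2" "t2 < m + Kp p / \<nu>" "h (m + Kp p / \<nu>) - h m = (U t2 \<bullet> q2) * (m + Kp p / \<nu> - m)"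
    using mvt[of m "m + Kp p / \<nu>" h "\<lambda>s. (*) (U s \<bullet> q2)"] hc[of m "m + Kp p / \<nu>"] hd Kl m by auto
  have "D * (- D) = ((U t1 \<bullet> q2) * (Kp p / \<nu>)) * ((U t2 \<bullet> q2) * (Kp p / \<nu>))"
    using t1(3) t2(3) h0 by simp
  also have "\<dots> = (U t1 \<bullet> q2) * (U t2 \<bullet> q2) * (Kp p / \<nu>)\<^sup>2" by (simp add: power2_eq_square mult_ac)
  finally have e: "(U t1 \<bullet> q2) * (U t2 \<bullet> q2) * (Kp p / \<nu>)\<^sup>2 = - (D * D)" by simp
  moreover have "D * D > 0" using \<open>D \<noteq> 0\<close> not_real_square_gt_zero[of D] by blast
  ultimately have "(U t1 \<bullet> q2) * (U t2 \<bullet> q2) * (Kp p / \<nu>)\<^sup>2 < 0" by simp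
  then have "(U t1 \<bullet> q2) * (U t2 \<bullet> q2) < 0" using Kl by (simp add: mult_less_0_iff)
  with t1 t2 show "\<exists>t1 t2. m - Kp p / \<nu> < t1 \<and> t1 < t2 \<and> t2 < m + Kp p / \<nu> \<and> (U t1 \<bullet> q2) * (U t2 \<bullet> q2) < 0"
    by (intro exI[of _ t1] exI[of _ t2]) auto
qed

text \<open>The explicit form of \<open>z\<close> determines \<open>\<zeta>\<close> almost
  everywhere, and \<open>\<bar>\<zeta>\<bar> = \<kappa> * sqrt (1 - z^2)\<close> can be solved for
  \<open>\<kappa>\<close> because the sine of the amplitude does not vanish on an open half loop.
  With \<open>C\<close> and \<open>S\<close> the cosine and sine, the derivative of \<open>z\<close>
  is \<open>- 4 * \<nu> * C * S * C powr (2/p)\<close> and the root is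
  \<open>2 * C * \<bar>S\<bar>\<close>; their quotient is the origin of the factor
  \<open>2 * \<nu>\<close>.\<close>

lemma half_loop_profile:
  assumes P: "profile p a b z \<zeta> \<kappa>" and p: "p > 2" and lam: "\<nu> > 0" and \<sigma>: "\<sigma> \<in> {1, -1}"
    and r: "\<And>r. r \<in> {a<..<b} \<Longrightarrow> \<nu> * (r - m) \<in> {- Kp p<..<Kp p}"
    and am: "\<And>r. r \<in> {a<..<b} \<Longrightarrow> \<sigma> * am1p p (\<nu> * (r - m)) < 0"
    and z: "\<And>r. r \<in> {a<..<b} \<Longrightarrow> z r = 2 * (cos (am1p p (\<nu> * (r - m))))\<^sup>2 - 1"
  shows "AE r in lebesgue. r \<in> {a<..<b} \<longrightarrow> -1 < z r \<and> z r < 1 \<and> \<sigma> * \<zeta> r \<ge> 0 \<and> \<kappa> r = (2 * \<nu>) * ((1 + z r) / 2) powr (1 / p)"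
proof -
  define C where "C r = cos (am1p p (\<nu> * (r - m)))" for r
  define S where "S r = sin (am1p p (\<nu> * (r - m)))" for r
  define d where "d r = - 4 * \<nu> * C r * S r * C r powr (2/p)" for r
  have rng: "am1p p (\<nu> * (u - m)) \<in> {-pi/2<..<pi/2}" if "u \<in> {a<..<b}" for u
    by (rule am1p_range(1)[OF p r[OF that]])
  have Cpos: "C u > 0" if "u \<in> {a<..<b}" for u
    unfolding C_def using rng[OF that] by (intro cos_gt_zero_pi) auto
  have Sneg: "\<sigma> * S u < 0" if u: "u \<in> {a<..<b}" for u
  proof (cases "\<sigma> = 1")
    case True
    then show ?thesis using am[OF u] rng[OF u] sin_gt_zero[of "- am1p p (\<nu> * (u - m))"] by (auto simp: S_def)
  next
    case False
    then have "\<sigma> = -1" using \<sigma> by auto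
    then show ?thesis using am[OF u] rng[OF u] sin_gt_zero[of "am1p p (\<nu> * (u - m))"] by (auto simp: S_def)
  qed
  have dam: "((\<lambda>u. am1p p (\<nu> * (u - m))) has_real_derivative C u powr (2/p) * \<nu>) (at u)" if u: "u \<in> {a<..<b}" for u
    unfolding C_def by (rule DERIV_chain2[where f="am1p p" and g="\<lambda>u. \<nu> * (u - m)", OF am1p_deriv[OF p r[OF u]]]) (auto intro!: derivative_eq_intros)
  have dz: "((\<lambda>u. 2 * (cos (am1p p (\<nu> * (u - m))))\<^sup>2 - 1) has_real_derivative d u) (at u)" if u: "u \<in> {a<..<b}" for u
    using dam[OF u] by (auto intro!: derivative_eq_intros simp: d_def C_def S_def)
  have z': "(z has_real_derivative d u) (at u)" if u: "u \<in> {a<..<b}" for u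
    by (rule has_field_derivative_transform_within_open[OF dz[OF u], where S="{a<..<b}"]) (use u z in auto)
  have cam: "continuous_on {s..t} (\<lambda>u. am1p p (\<nu> * (u - m)))" if "a < s" "t < b" for s t
    using that by (intro continuous_at_imp_continuous_on ballI DERIV_isCont[OF dam]) auto
  have cd: "continuous_on {s..t} d" if "a < s" "t < b" for s t
  proof -
    have "C u \<noteq> 0" if "u \<in> {s..t}" for u using Cpos[of u] that \<open>a < s\<close> \<open>t < b\<close> by auto
    then show ?thesis unfolding d_def C_def S_def
      by (intro continuous_intros cam[OF that]) auto
  qed
  have \<zeta>: "\<zeta> absolutely_integrable_on {a..b}" and zI: "\<And>r. r \<in> {a..b} \<Longrightarrow> z r = z a + integral {a..r} \<zeta>"
    and ae: "AE r in lebesgue. r \<in> {a<..<b} \<longrightarrow> \<bar>\<zeta> r\<bar> = \<kappa> r * sqrt (1 - (z r)\<^sup>2)"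
    using P unfolding profile_def by blast+
  have "AE r in lebesgue. r \<in> {a<..<b} \<longrightarrow> \<zeta> r - d r = 0"
  proof (rule AE_zero_if_integral_intervals_zero)
    fix s t assume st: "a < s" "s \<le> t" "t < b"
    have i: "\<zeta> absolutely_integrable_on {s..t}" "d absolutely_integrable_on {s..t}"
      by (rule absolutely_integrable_on_subinterval[OF \<zeta>], use st in simp)
         (rule absolutely_integrable_continuous_real[OF cd[OF st(1,3)]])
    then show "(\<lambda>r. \<zeta> r - d r) absolutely_integrable_on {s..t}" by (rule set_integral_diff(1))
    have "(d has_integral z t - z s) {s..t}"
      by (rule fundamental_theorem_of_calculus[OF st(2)])
         (use st z' in \<open>auto simp: has_real_derivative_iff_has_vector_derivative[symmetric] intro: has_field_derivative_at_within\<close>)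
    moreover have "integral {s..t} \<zeta> = z t - z s" by (rule integral_increment[OF \<zeta> zI]) (use st in auto)
    ultimately show "integral {s..t} (\<lambda>r. \<zeta> r - d r) = 0"
      using i by (subst Henstock_Kurzweil_Integration.integral_diff) (auto simp: absolutely_integrable_on_def integral_unique)
  qed
  with ae show ?thesis
  proof eventually_elim
    case (elim u)
    show ?case
    proof
      assume u: "u \<in> {a<..<b}"
      have zu: "z u = 2 * (C u)\<^sup>2 - 1" using z[OF u] by (simp add: C_def)
      have CS: "(C u)\<^sup>2 + (S u)\<^sup>2 = 1" by (simp add: C_def S_def)
      have S0: "S u \<noteq> 0" using Sneg[OF u] by auto
      then have "(S u)\<^sup>2 > 0" by simp
      have Cp: "C u > 0" by (rule Cpos[OF u])
      have \<zeta>u: "\<zeta> u = d u" and k: "\<bar>\<zeta> u\<bar> = \<kappa> u * sqrt (1 - (z u)\<^sup>2)" using elim u by auto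
      have "(C u)\<^sup>2 > 0" using Cp by simp
      then have 1: "-1 < z u" "z u < 1" using CS \<open>(S u)\<^sup>2 > 0\<close> unfolding zu by linarith+
      have "\<sigma> * d u = (- (\<sigma> * S u)) * (4 * \<nu> * C u * C u powr (2/p))" by (simp add: d_def)
      also have "\<dots> \<ge> 0" using Sneg[OF u] lam Cp by (intro mult_nonneg_nonneg) auto
      finally have 2: "\<sigma> * \<zeta> u \<ge> 0" by (simp add: \<zeta>u)
      have "1 - (z u)\<^sup>2 = 4 * (C u)\<^sup>2 * (1 - (C u)\<^sup>2)" by (simp add: zu power2_eq_square algebra_simps)
      also have "1 - (C u)\<^sup>2 = (S u)\<^sup>2" using CS by simp
      also have "4 * (C u)\<^sup>2 * (S u)\<^sup>2 = (2 * C u * S u)\<^sup>2" by (simp add: power_mult_distrib)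
      finally have "sqrt (1 - (z u)\<^sup>2) = 2 * C u * \<bar>S u\<bar>" using Cp by (simp add: abs_mult)
      then have "\<kappa> u * (2 * C u * \<bar>S u\<bar>) = 4 * \<nu> * C u * \<bar>S u\<bar> * C u powr (2/p)"
        using k \<zeta>u lam Cp by (auto simp: d_def abs_mult)
      also have "\<dots> = (2 * \<nu> * C u powr (2/p)) * (2 * C u * \<bar>S u\<bar>)" by simp
      finally have "\<kappa> u = 2 * \<nu> * C u powr (2/p)" using Cp S0 by simp
      moreover have "((1 + z u) / 2) powr (1/p) = C u powr (2/p)"
        using Cp by (simp add: zu powr_powr flip: powr_numeral)
      ultimately show "-1 < z u \<and> z u < 1 \<and> \<sigma> * \<zeta> u \<ge> 0 \<and> \<kappa> u = (2 * \<nu>) * ((1 + z u) / 2) powr (1 / p)"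
        using 1 2 by simp
    qed
  qed
qed

section \<open>Local minimality\<close>

lemma tangent_profile:
  assumes T: "tangent_field p P0 P1 L \<eta> V w" and q: "norm q = 1"
  shows "profile p 0 L (\<lambda>s. V s \<bullet> q) (\<lambda>s. w s \<bullet> q) (\<lambda>s. norm (w s))"
  unfolding profile_def
proof (intro conjI ballI allI)
  show "(\<lambda>s. w s \<bullet> q) absolutely_integrable_on {0..L}" by (rule inner_indefinite_integral(1)[OF tangent_fieldD(2,4)[OF T]])
  show "V r \<bullet> q = V 0 \<bullet> q + integral {0..r} (\<lambda>s. w s \<bullet> q)" if "r \<in> {0..L}" for r
    by (rule inner_indefinite_integral(2)[OF tangent_fieldD(2,4)[OF T] that])
  fix r assume r: "r \<in> {0..L}"
  have "\<bar>V r \<bullet> q\<bar> \<le> 1" using Cauchy_Schwarz_ineq2[of "V r" q] tangent_fieldD(5)[OF T r] q by simp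
  then show "-1 \<le> V r \<bullet> q" "V r \<bullet> q \<le> 1" by auto
next
  show "AE r in lebesgue. r \<in> {0<..<L} \<longrightarrow> \<bar>w r \<bullet> q\<bar> = norm (w r) * sqrt (1 - (V r \<bullet> q)\<^sup>2)"
    using tangent_fieldD(8)[OF T]
  proof eventually_elim
    case (elim r)
    then show ?case using norm_rotation_2(2)[of "V r" q "w r"] tangent_fieldD(5)[OF T, of r] q by auto
  qed
qed (use tangent_fieldD(3)[OF T] in auto)

lemma tangent_energy:
  assumes T: "tangent_field p P0 P1 L \<eta> V w" and L: "L > 0"
  shows "integral {0..L} (energy_density p \<mu> (\<lambda>s. V s \<bullet> q) (\<lambda>s. norm (w s)))
    = bending_energy p L \<eta> + (p - 1) * \<mu> powr p / 2 * (L + (P1 - P0) \<bullet> q)"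
proof -
  have wp: "(\<lambda>s. norm (w s) powr p) integrable_on {0..L}"
    using tangent_fieldD(3)[OF T] unfolding absolutely_integrable_on_def by blast
  have Vi: "V integrable_on {0..L}" by (rule integrable_continuous_real[OF tangent_fieldD(10)[OF T]])
  have Vq: "((\<lambda>s. V s \<bullet> q) has_integral (integral {0..L} V \<bullet> q)) {0..L}"
    using has_integral_linear[OF integrable_integral[OF Vi] bounded_linear_inner_left[of q]] by (simp add: o_def)
  have 1: "((\<lambda>s. 1::real) has_integral L) {0..L}" using has_integral_const_real[of "1::real" 0 L] L by simp
  have "((\<lambda>s. norm (w s) powr p + (p - 1) * \<mu> powr p / 2 * (1 + V s \<bullet> q)) has_integral
      (integral {0..L} (\<lambda>s. norm (w s) powr p) + (p - 1) * \<mu> powr p / 2 * (L + integral {0..L} V \<bullet> q))) {0..L}"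
    by (intro has_integral_add integrable_integral[OF wp] has_integral_mult_right 1 Vq)
  then have "((energy_density p \<mu> (\<lambda>s. V s \<bullet> q) (\<lambda>s. norm (w s))) has_integral
      (integral {0..L} (\<lambda>s. norm (w s) powr p) + (p - 1) * \<mu> powr p / 2 * (L + integral {0..L} V \<bullet> q))) {0..L}"
    by (simp add: energy_density_def[abs_def])
  then show ?thesis unfolding tangent_fieldD(9)[OF T] tangent_fieldD(7)[OF T, symmetric] by (rule integral_unique)
qed

text \<open>Formulated as a property of the radius \<open>d\<close>, so that one radius can be
  extracted for finitely many pieces. \<open>d\<close> is fixed before \<open>\<delta>\<close>: the
  neighbourhood must not shrink when the regularization is removed.\<close>

definition segment_stable ::
    "real \<Rightarrow> real \<Rightarrow> real \<Rightarrow> real^2 \<Rightarrow> (real \<Rightarrow> real^2) \<Rightarrow> real \<Rightarrow> real \<Rightarrow> real \<Rightarrow> bool" where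
  "segment_stable p \<mu> L q U a b d \<longleftrightarrow>
     (\<forall>V w \<delta>. profile p 0 L (\<lambda>s. V s \<bullet> q) (\<lambda>s. w s \<bullet> q) (\<lambda>s. norm (w s)) \<longrightarrow>
       (\<forall>s\<in>{0..L}. norm (V s - U s) < d) \<longrightarrow> \<delta> > 0 \<longrightarrow>
       integral {-1..V a \<bullet> q} (calib p \<mu> \<delta> 0) + integral {-1..V b \<bullet> q} (calib p \<mu> \<delta> 0)
        \<le> integral {a..b} (energy_density p \<mu> (\<lambda>s. V s \<bullet> q) (\<lambda>s. norm (w s))))"

definition loop_stable ::
    "real \<Rightarrow> real \<Rightarrow> real \<Rightarrow> real^2 \<Rightarrow> (real \<Rightarrow> real^2) \<Rightarrow> real \<Rightarrow> real \<Rightarrow> real \<Rightarrow> bool" where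
  "loop_stable p \<mu> L q U a b d \<longleftrightarrow>
     (\<forall>V w \<delta>. profile p 0 L (\<lambda>s. V s \<bullet> q) (\<lambda>s. w s \<bullet> q) (\<lambda>s. norm (w s)) \<longrightarrow>
       continuous_on {0..L} V \<longrightarrow> (\<forall>s\<in>{0..L}. norm (V s) = 1) \<longrightarrow>
       (\<forall>s\<in>{0..L}. norm (V s - U s) < d) \<longrightarrow> \<delta> > 0 \<longrightarrow>
       2 * integral {-1..1} (calib p \<mu> \<delta> 0) - integral {-1..V a \<bullet> q} (calib p \<mu> \<delta> 0)
         - integral {-1..V b \<bullet> q} (calib p \<mu> \<delta> 0)
        \<le> integral {a..b} (energy_density p \<mu> (\<lambda>s. V s \<bullet> q) (\<lambda>s. norm (w s))))"

lemma segment_stable_mono: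
  assumes "segment_stable p \<mu> L q U a b d" "d' \<le> d" shows "segment_stable p \<mu> L q U a b d'"
  using assms(1) unfolding segment_stable_def by (meson assms(2) less_le_trans)

lemma loop_stable_mono:
  assumes "loop_stable p \<mu> L q U a b d" "d' \<le> d" shows "loop_stable p \<mu> L q U a b d'"
  using assms(1) unfolding loop_stable_def by (meson assms(2) less_le_trans)

lemma segment_close:
  fixes U :: "real \<Rightarrow> real^2"
  assumes p: "p > 2" and \<mu>: "\<mu> > 0" and ab: "0 \<le> a" "a < b" "b \<le> L" and q: "norm q = 1"
    and U: "\<And>s. s \<in> {a..b} \<Longrightarrow> U s = - q"
  shows "\<exists>d>0. segment_stable p \<mu> L q U a b d"
proof -
  \<comment> \<open>Half of what the segment can repay, as each of its two ends contributes one
    margin.\<close>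
  define e where "e = (p - 1) * \<mu> powr p * (b - a) / 2"
  have "e > 0" using p \<mu> ab by (simp add: e_def)
  then obtain \<rho> where \<rho>: "\<rho> > 0" "\<rho> \<le> 1" "\<And>Z. -1 \<le> Z \<Longrightarrow> Z \<le> -1 + \<rho> \<Longrightarrow> flat_margin p \<mu> Z \<le> e"
    using flat_margin_small[OF p \<mu>] by metis
  have "segment_stable p \<mu> L q U a b \<rho>"
    unfolding segment_stable_def
  proof (intro allI impI)
    fix V w :: "real \<Rightarrow> real^2" and \<delta> :: real
    assume P: "profile p 0 L (\<lambda>s. V s \<bullet> q) (\<lambda>s. w s \<bullet> q) (\<lambda>s. norm (w s))"
      and close: "\<forall>s\<in>{0..L}. norm (V s - U s) < \<rho>" and \<delta>: "\<delta> > 0"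
    have z: "-1 \<le> V s \<bullet> q" "V s \<bullet> q \<le> -1 + \<rho>" if s: "s \<in> {a..b}" for s
    proof -
      have s': "s \<in> {0..L}" using s ab by auto
      show "-1 \<le> V s \<bullet> q" using profile_range(1)[OF P s'] .
      have "(V s - U s) \<bullet> q \<le> norm (V s - U s) * norm q" by (rule norm_cauchy_schwarz)
      moreover have "(V s - U s) \<bullet> q = V s \<bullet> q + 1" using q by (simp add: U[OF s] inner_add_left dot_square_norm)
      ultimately show "V s \<bullet> q \<le> -1 + \<rho>" using bspec[OF close s'] q by simp
    qed
    have m: "flat_margin p \<mu> (V s \<bullet> q) \<le> e" if "s \<in> {a..b}" for s by (rule \<rho>(3)[OF z[OF that]])
    show "integral {-1..V a \<bullet> q} (calib p \<mu> \<delta> 0) + integral {-1..V b \<bullet> q} (calib p \<mu> \<delta> 0)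
      \<le> integral {a..b} (energy_density p \<mu> (\<lambda>s. V s \<bullet> q) (\<lambda>s. norm (w s)))"
    proof (rule segment_bound[OF profile_subinterval[OF P ab(1,3)] _ p \<delta> \<mu>])
      show "a \<le> b" using ab by simp
      show "V r \<bullet> q \<le> 0" if "r \<in> {a..b}" for r using z(2)[OF that] \<rho>(2) by simp
      show "flat_margin p \<mu> (V a \<bullet> q) + flat_margin p \<mu> (V b \<bullet> q) \<le> (p - 1) * \<mu> powr p * (b - a)"
        using m[of a] m[of b] ab by (simp add: e_def)
    qed
  qed
  with \<rho>(1) show ?thesis by blast
qed

text \<open>For \<open>V\<close> close to \<open>U\<close> the component
  \<open>V \<bullet> q2\<close> has opposite signs at \<open>t1\<close> and \<open>t2\<close>, so it
  vanishes at some \<open>s\<close> in between, and there \<open>V \<bullet> q1\<close> is 1 or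
  \<open>-1\<close>. On the compact interval \<open>U \<bullet> q1\<close> is bounded away from
  \<open>-1\<close>, which leaves only the value 1, as \<open>loop_bound\<close> requires.\<close>

lemma loop_close:
  fixes U :: "real \<Rightarrow> real^2"
  assumes p: "p > 2" and \<mu>: "\<mu> > 0" and ab: "0 \<le> a" "b \<le> L" and q: "norm q1 = 1" "norm q2 = 1" "q1 \<bullet> q2 = 0"
    and cU: "continuous_on {0..L} U" and t: "a < t1" "t1 < t2" "t2 < b"
    and opp: "(U t1 \<bullet> q2) * (U t2 \<bullet> q2) < 0" and U: "\<And>s. s \<in> {t1..t2} \<Longrightarrow> U s \<bullet> q1 > -1"
  shows "\<exists>d>0. loop_stable p \<mu> L q1 U a b d"
proof -
  have "continuous_on {t1..t2} (\<lambda>s. U s \<bullet> q1)"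
    using cU ab t by (intro continuous_intros) (auto intro: continuous_on_subset)
  then obtain r where r: "r \<in> {t1..t2}" "\<And>s. s \<in> {t1..t2} \<Longrightarrow> U r \<bullet> q1 \<le> U s \<bullet> q1"
    using continuous_attains_inf[of "{t1..t2}" "\<lambda>s. U s \<bullet> q1"] t by auto
  \<comment> \<open>Small enough to keep \<open>V \<bullet> q1 > -1\<close> on
    \<open>{t1..t2}\<close> and the signs of \<open>V \<bullet> q2\<close> at both ends.\<close>
  define d where "d = min (U r \<bullet> q1 + 1) (min \<bar>U t1 \<bullet> q2\<bar> \<bar>U t2 \<bullet> q2\<bar>)"
  have nz: "U t1 \<bullet> q2 \<noteq> 0" "U t2 \<bullet> q2 \<noteq> 0" using opp by auto
  have "d > 0" using U[OF r(1)] nz by (auto simp: d_def)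
  have "loop_stable p \<mu> L q1 U a b d"
    unfolding loop_stable_def
  proof (intro allI impI)
    fix V w :: "real \<Rightarrow> real^2" and \<delta> :: real
    assume P: "profile p 0 L (\<lambda>s. V s \<bullet> q1) (\<lambda>s. w s \<bullet> q1) (\<lambda>s. norm (w s))"
      and cV: "continuous_on {0..L} V" and n: "\<forall>s\<in>{0..L}. norm (V s) = 1"
      and close: "\<forall>s\<in>{0..L}. norm (V s - U s) < d" and \<delta>: "\<delta> > 0"
    have ip: "\<bar>V s \<bullet> q - U s \<bullet> q\<bar> < d" if "s \<in> {0..L}" "norm q = 1" for s q
      using Cauchy_Schwarz_ineq2[of "V s - U s" q] bspec[OF close that(1)] that(2) by (simp add: inner_diff_left)
    have c2: "continuous_on {t1..t2} (\<lambda>s. V s \<bullet> q2)"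
      using cV ab t by (intro continuous_intros) (auto intro: continuous_on_subset)
    have s12: "t1 \<in> {0..L}" "t2 \<in> {0..L}" using ab t by auto
    have d12: "\<bar>V t1 \<bullet> q2 - U t1 \<bullet> q2\<bar> < \<bar>U t1 \<bullet> q2\<bar>" "\<bar>V t2 \<bullet> q2 - U t2 \<bullet> q2\<bar> < \<bar>U t2 \<bullet> q2\<bar>"
      using ip[OF s12(1) q(2)] ip[OF s12(2) q(2)] by (auto simp: d_def)
    have "\<exists>s\<in>{t1..t2}. V s \<bullet> q2 = 0"
    proof (cases "U t1 \<bullet> q2 < 0")
      case True
      then have "U t2 \<bullet> q2 > 0" using opp by (simp add: mult_less_0_iff)
      then have "V t1 \<bullet> q2 \<le> 0" "0 \<le> V t2 \<bullet> q2" using d12 True by auto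
      then show ?thesis using IVT'[of "\<lambda>s. V s \<bullet> q2" t1 0 t2] c2 t by auto
    next
      case False
      then have "U t1 \<bullet> q2 > 0" "U t2 \<bullet> q2 < 0" using opp nz by (auto simp: mult_less_0_iff)
      then have "V t2 \<bullet> q2 \<le> 0" "0 \<le> V t1 \<bullet> q2" using d12 by auto
      then show ?thesis using IVT2'[of "\<lambda>s. V s \<bullet> q2" t2 0 t1] c2 t by auto
    qed
    then obtain s where s: "s \<in> {t1..t2}" "V s \<bullet> q2 = 0" by blast
    have sL: "s \<in> {0..L}" using s ab t by auto
    have "\<bar>V s \<bullet> q1 - U s \<bullet> q1\<bar> < U r \<bullet> q1 + 1" using ip[OF sL q(1)] by (simp add: d_def)
    then have gt: "V s \<bullet> q1 > -1" using r(2)[OF s(1)] by linarith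
    \<comment> \<open>The frame vectors \<open>q1\<close> and \<open>q2\<close> take the places of
      tangent and acceleration, and \<open>V s\<close> that of the fixed direction.\<close>
    have "\<bar>q2 \<bullet> V s\<bar> = norm q2 * sqrt (1 - (q1 \<bullet> V s)\<^sup>2)"
      by (rule norm_rotation_2(2)) (use q bspec[OF n sL] in auto)
    then have "(V s \<bullet> q1)\<^sup>2 = 1" using s(2) q(2) by (simp add: inner_commute)
    then have one: "V s \<bullet> q1 = 1" using gt by (auto simp: power2_eq_1_iff)
    show "2 * integral {-1..1} (calib p \<mu> \<delta> 0) - integral {-1..V a \<bullet> q1} (calib p \<mu> \<delta> 0) - integral {-1..V b \<bullet> q1} (calib p \<mu> \<delta> 0)
      \<le> integral {a..b} (energy_density p \<mu> (\<lambda>s. V s \<bullet> q1) (\<lambda>s. norm (w s)))"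
      by (rule loop_bound[OF profile_subinterval[OF P ab] _ _ _ \<delta> \<mu>, of s]) (use s t one p in auto)
  qed
  with \<open>d > 0\<close> show ?thesis by blast
qed

lemma flat_segment_energy:
  fixes U w :: "real \<Rightarrow> real^2"
  assumes w: "w absolutely_integrable_on {0..L}" and U: "\<And>s. s \<in> {0..L} \<Longrightarrow> U s = U 0 + integral {0..s} w"
    and ab: "0 \<le> a" "a < b" "b \<le> L" and q: "norm q = 1" and const: "\<And>s. s \<in> {a..b} \<Longrightarrow> U s = - q" and p: "p > 0"
  shows "integral {a..b} (energy_density p \<mu> (\<lambda>s. U s \<bullet> q) (\<lambda>s. norm (w s))) = 0"
proof -
  have "AE s in lebesgue. s \<in> {a<..<b} \<longrightarrow> w s = 0"
  proof (rule AE_zero_if_integral_intervals_zero)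
    fix s t assume st: "a < s" "s \<le> t" "t < b"
    show "w absolutely_integrable_on {s..t}" by (rule absolutely_integrable_on_subinterval[OF w]) (use st ab in auto)
    have "U t = U s + integral {s..t} w" by (rule increment_indefinite_integral[OF w U]) (use st ab in auto)
    then show "integral {s..t} w = 0" using const[of s] const[of t] st by simp
  qed
  then have "AE s in lebesgue. s \<in> {a<..<b} \<longrightarrow> energy_density p \<mu> (\<lambda>s. U s \<bullet> q) (\<lambda>s. norm (w s)) s = 0"
    by eventually_elim (use const q p in \<open>auto simp: energy_density_def dot_square_norm\<close>)
  then have "integral {a..b} (energy_density p \<mu> (\<lambda>s. U s \<bullet> q) (\<lambda>s. norm (w s))) = integral {a..b} (\<lambda>s. 0)"
    by (rule integral_cong_AE_Ioo) auto
  then show ?thesis by simp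
qed

text \<open>\<open>z\<close> rises from \<open>-1\<close> to 1 up to the midpoint \<open>m\<close>
  and falls afterwards, so each half is an instance of \<open>half_loop_limit\<close>, with sign 1
  and \<open>-1\<close> respectively.\<close>

lemma loop_energy_limit:
  assumes P: "profile p a b z \<zeta> \<kappa>" and p: "p > 2" and \<nu>: "\<nu> > 0"
    and ab: "a = m - Kp p / \<nu>" "b = m + Kp p / \<nu>" "z a = -1" "z b = -1"
    and z: "\<And>r. r \<in> {a<..<b} \<Longrightarrow> z r = 2 * (cos (am1p p (\<nu> * (r - m))))\<^sup>2 - 1"
  shows "(\<lambda>n. 2 * integral {-1..1} (calib p (2 * \<nu>) (1 / real (Suc n)) 0)) \<longlonglongrightarrow> integral {a..b} (energy_density p (2 * \<nu>) z \<kappa>)"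
proof -
  have K: "Kp p > 0" "Kp p / \<nu> > 0" using Kp_pos[OF p] \<nu> by auto
  have am: "a < m" "m < b" using K ab by auto
  have zm: "z m = 1" using z[of m] am am1p_0[OF p] by simp
  have P1: "profile p a m z \<zeta> \<kappa>" and P2: "profile p m b z \<zeta> \<kappa>" using profile_subinterval[OF P] am by auto
  have rng: "\<nu> * (r - m) \<in> {- Kp p<..<Kp p}" if "r \<in> {a<..<b}" for r
    using that \<nu> ab by (auto simp: field_simps)
  have neg: "am1p p (\<nu> * (r - m)) < 0" if "r \<in> {a<..<m}" for r
    by (rule am1p_less_0[OF p]) (use rng[of r] that am \<nu> in \<open>auto simp: mult_less_0_iff\<close>)
  have pos: "am1p p (\<nu> * (r - m)) > 0" if "r \<in> {m<..<b}" for r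
    by (rule am1p_greater_0[OF p]) (use rng[of r] that am \<nu> in auto)
  have "AE r in lebesgue. r \<in> {a<..<m} \<longrightarrow> -1 < z r \<and> z r < 1 \<and> 1 * \<zeta> r \<ge> 0 \<and> \<kappa> r = (2 * \<nu>) * ((1 + z r) / 2) powr (1 / p)"
    by (rule half_loop_profile[OF P1 p \<nu>, of 1 m]) (use rng neg z am in auto)
  then have 1: "(\<lambda>n. integral {-1..1} (calib p (2 * \<nu>) (1 / real (Suc n)) 0)) \<longlonglongrightarrow> integral {a..m} (energy_density p (2 * \<nu>) z \<kappa>)"
    by (intro half_loop_limit[OF P1, of "2 * \<nu>" 1]) (use am p \<nu> ab zm in auto)
  have "AE r in lebesgue. r \<in> {m<..<b} \<longrightarrow> -1 < z r \<and> z r < 1 \<and> (-1) * \<zeta> r \<ge> 0 \<and> \<kappa> r = (2 * \<nu>) * ((1 + z r) / 2) powr (1 / p)"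
    by (rule half_loop_profile[OF P2 p \<nu>, of "-1" m]) (use rng pos z am in auto)
  then have 2: "(\<lambda>n. integral {-1..1} (calib p (2 * \<nu>) (1 / real (Suc n)) 0)) \<longlonglongrightarrow> integral {m..b} (energy_density p (2 * \<nu>) z \<kappa>)"
    by (intro half_loop_limit[OF P2, of "2 * \<nu>" "-1"]) (use am p \<nu> ab zm in auto)
  have "integral {a..m} (energy_density p (2 * \<nu>) z \<kappa>) + integral {m..b} (energy_density p (2 * \<nu>) z \<kappa>) = integral {a..b} (energy_density p (2 * \<nu>) z \<kappa>)"
    using am by (intro Henstock_Kurzweil_Integration.integral_combine energy_density_integrable[OF P]) auto
  with tendsto_add[OF 1 2] show ?thesis by simp
qed

section \<open>Summation over the pieces\<close>

lemma integral_split_alternating: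
  fixes f :: "real \<Rightarrow> real" and a e :: "nat \<Rightarrow> real"
  assumes f: "f integrable_on {a 1..e (Suc N)}"
    and ae: "\<And>j. j \<in> {1..Suc N} \<Longrightarrow> a j \<le> e j" "\<And>j. j \<in> {1..N} \<Longrightarrow> e j \<le> a (Suc j)"
  shows "integral {a 1..e (Suc N)} f = (\<Sum>j=1..Suc N. integral {a j..e j} f) + (\<Sum>j=1..N. integral {e j..a (Suc j)} f)"
proof -
  \<comment> \<open>The order relations are part of the induction because integrability is inherited
    only by subintervals of \<open>{a 1..e (Suc N)}\<close>.\<close>
  have "n \<le> N \<Longrightarrow> a 1 \<le> e (Suc n) \<and> e (Suc n) \<le> e (Suc N) \<and> integral {a 1..e (Suc n)} f = (\<Sum>j=1..Suc n. integral {a j..e j} f) + (\<Sum>j=1..n. integral {e j..a (Suc j)} f)" for n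
  proof (induction n)
    case 0
    have "e (Suc 0) \<le> e (Suc k)" if "k \<le> N" for k using that
    proof (induction k)
      case (Suc k) then show ?case using ae(1)[of "Suc (Suc k)"] ae(2)[of "Suc k"] by force
    qed simp
    then show ?case using ae(1)[of 1] by auto
  next
    case (Suc n)
    have mono: "e (Suc (Suc n)) \<le> e (Suc k)" if "Suc n \<le> k" "k \<le> N" for k using that
    proof (induction k rule: dec_induct)
      case (step k) then show ?case using ae(1)[of "Suc (Suc k)"] ae(2)[of "Suc k"] by force
    qed simp
    have o: "e (Suc n) \<le> a (Suc (Suc n))" "a (Suc (Suc n)) \<le> e (Suc (Suc n))" "a 1 \<le> e (Suc n)" "e (Suc (Suc n)) \<le> e (Suc N)"
      using ae(1)[of "Suc (Suc n)"] ae(2)[of "Suc n"] Suc mono[of N] by auto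
    have i: "f integrable_on {a 1..e (Suc (Suc n))}" "f integrable_on {a 1..a (Suc (Suc n))}"
      by (rule integrable_subinterval_real[OF f], use o in auto)+
    have "integral {a 1..e (Suc n)} f + integral {e (Suc n)..a (Suc (Suc n))} f = integral {a 1..a (Suc (Suc n))} f"
      using o i by (intro Henstock_Kurzweil_Integration.integral_combine) auto
    moreover have "integral {a 1..a (Suc (Suc n))} f + integral {a (Suc (Suc n))..e (Suc (Suc n))} f = integral {a 1..e (Suc (Suc n))} f"
      using o i by (intro Henstock_Kurzweil_Integration.integral_combine) auto
    moreover have "integral {a 1..e (Suc n)} f = (\<Sum>j=1..Suc n. integral {a j..e j} f) + (\<Sum>j=1..n. integral {e j..a (Suc j)} f)"
      using Suc by auto
    ultimately have "integral {a 1..e (Suc (Suc n))} f = (\<Sum>j=1..Suc (Suc n). integral {a j..e j} f) + (\<Sum>j=1..Suc n. integral {e j..a (Suc j)} f)"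
      by (simp only: sum.cl_ivl_Suc) simp
    then show ?case using o by auto
  qed
  from this[of N] show ?thesis by simp
qed

text \<open>Every interior break point belongs to one segment and one loop, with opposite signs;
  only the two ends of the curve survive.\<close>

lemma sum_alternating_telescope:
  fixes A E :: "nat \<Rightarrow> real"
  shows "(\<Sum>j=1..Suc N. A j + E j) + (\<Sum>j=1..N. 2 * M - E j - A (Suc j)) = 2 * real N * M + A 1 + E (Suc N)"
  by (induction N) (simp_all add: algebra_simps)

lemma finite_common_bound:
  fixes P :: "nat \<Rightarrow> real \<Rightarrow> bool"
  assumes "\<And>j. j \<in> {1..n} \<Longrightarrow> \<exists>d>0. P j d" and mono: "\<And>j d d'. P j d \<Longrightarrow> d' \<le> d \<Longrightarrow> P j d'"
  shows "\<exists>d>0. \<forall>j\<in>{1..n}. P j d"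
  using assms(1)
proof (induction n)
  case 0 then show ?case by (auto intro: exI[of _ 1])
next
  case (Suc n)
  then obtain d where d: "d > 0" "\<forall>j\<in>{1..n}. P j d" by force
  obtain e where e: "e > 0" "P (Suc n) e" using Suc.prems[of "Suc n"] by auto
  have "P j (min d e)" if "j \<in> {1..Suc n}" for j
  proof (cases "j = Suc n")
    case True then show ?thesis using mono[OF e(2)] by simp
  next
    case False then show ?thesis using mono[of j d] d(2) that by simp
  qed
  then show ?case using d(1) e(1) by (intro exI[of _ "min d e"]) auto
qed

text \<open>Isolates what the argument uses of a flat core, namely its tangent. The
  \<open>j\<close>-th segment occupies \<open>{a j..e j}\<close>, and the \<open>j\<close>-th loop
  runs from \<open>e j\<close> to \<open>a (Suc j)\<close> with midpoint \<open>m j\<close>, so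
  there is one segment more than there are loops.\<close>

lemma local_minimizer_if_alternating:
  fixes U :: "real \<Rightarrow> real^2" and a e m :: "nat \<Rightarrow> real"
  assumes p: "p > 2" and L: "L > 0" and \<nu>: "\<nu> > 0"
    and \<gamma>: "\<gamma> \<in> A_pin p P0 P1 L" and T: "tangent_field p P0 P1 L \<gamma> U w"
    and q: "norm q1 = 1" "norm q2 = 1" "q1 \<bullet> q2 = 0"
    and ends: "a 1 = 0" "e (Suc N) = L"
    and rng: "\<And>j. j \<in> {1..Suc N} \<Longrightarrow> 0 \<le> a j \<and> e j \<le> L"
    and seg: "\<And>j. j \<in> {1..Suc N} \<Longrightarrow> a j < e j" "\<And>j s. j \<in> {1..Suc N} \<Longrightarrow> s \<in> {a j..e j} \<Longrightarrow> U s = - q1"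
    and loop: "\<And>j. j \<in> {1..N} \<Longrightarrow> e j = m j - Kp p / \<nu>" "\<And>j. j \<in> {1..N} \<Longrightarrow> a (Suc j) = m j + Kp p / \<nu>"
      "\<And>j s. j \<in> {1..N} \<Longrightarrow> s \<in> {e j<..<a (Suc j)} \<Longrightarrow> U s \<bullet> q1 = 2 * (cos (am1p p (\<nu> * (s - m j))))\<^sup>2 - 1"
      "\<And>j. j \<in> {1..N} \<Longrightarrow> \<exists>t1 t2. e j < t1 \<and> t1 < t2 \<and> t2 < a (Suc j) \<and> (U t1 \<bullet> q2) * (U t2 \<bullet> q2) < 0"
  shows "local_minimizer p P0 P1 L \<gamma>"
proof -
  define \<mu> where "\<mu> = 2 * \<nu>"
  have \<mu>: "\<mu> > 0" using \<nu> by (simp add: \<mu>_def)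
  have p1: "p \<ge> 1" "p > 1" using p by auto
  let ?G = "\<lambda>\<delta> z. integral {-1..z} (calib p \<mu> \<delta> 0)"
  let ?E = "\<lambda>V w. energy_density p \<mu> (\<lambda>s. V s \<bullet> q1) (\<lambda>s. norm (w s))"
  let ?prof = "\<lambda>V w. profile p 0 L (\<lambda>s. V s \<bullet> q1) (\<lambda>s. w s \<bullet> q1) (\<lambda>s. norm (w s))"
  note U = tangent_fieldD[OF T]
  have PU: "?prof U w" by (rule tangent_profile[OF T q(1)])
  have rng': "0 \<le> e j" "a (Suc j) \<le> L" "e j \<le> a (Suc j)" if "j \<in> {1..N}" for j
  proof -
    have "Kp p / \<nu> > 0" using Kp_pos[OF p] \<nu> by simp
    then show "e j \<le> a (Suc j)" using loop(1,2)[OF that] by simp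
    show "0 \<le> e j" "a (Suc j) \<le> L" using rng[of j] rng[of "Suc j"] seg(1)[of j] seg(1)[of "Suc j"] that by auto
  qed
  have split: "integral {0..L} f = (\<Sum>j=1..Suc N. integral {a j..e j} f) + (\<Sum>j=1..N. integral {e j..a (Suc j)} f)"
    if "f integrable_on {0..L}" for f :: "real \<Rightarrow> real"
  proof -
    have "f integrable_on {a 1..e (Suc N)}" using that by (simp only: ends)
    then have "integral {a 1..e (Suc N)} f = (\<Sum>j=1..Suc N. integral {a j..e j} f) + (\<Sum>j=1..N. integral {e j..a (Suc j)} f)"
      by (rule integral_split_alternating[where a=a and e=e]) (use seg(1) rng'(3) in \<open>blast intro: less_imp_le\<close>)+
    then show ?thesis unfolding ends .
  qed

  have "\<exists>d>0. \<forall>j\<in>{1..Suc N}. segment_stable p \<mu> L q1 U (a j) (e j) d"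
  proof (rule finite_common_bound[where P="\<lambda>j d. segment_stable p \<mu> L q1 U (a j) (e j) d"])
    show "\<exists>d>0. segment_stable p \<mu> L q1 U (a j) (e j) d" if j: "j \<in> {1..Suc N}" for j
      by (rule segment_close[OF p \<mu> _ seg(1)[OF j] _ q(1) seg(2)[OF j]]) (use rng[OF j] in auto)
  qed (rule segment_stable_mono)
  then obtain d1 where d1: "d1 > 0" "\<And>j. j \<in> {1..Suc N} \<Longrightarrow> segment_stable p \<mu> L q1 U (a j) (e j) d1" by blast
  have "\<exists>d>0. \<forall>j\<in>{1..N}. loop_stable p \<mu> L q1 U (e j) (a (Suc j)) d"
  proof (rule finite_common_bound[where P="\<lambda>j d. loop_stable p \<mu> L q1 U (e j) (a (Suc j)) d"])
    fix j assume j: "j \<in> {1..N}"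
    obtain t1 t2 where t: "e j < t1" "t1 < t2" "t2 < a (Suc j)" "(U t1 \<bullet> q2) * (U t2 \<bullet> q2) < 0"
      using loop(4)[OF j] by blast
    show "\<exists>d>0. loop_stable p \<mu> L q1 U (e j) (a (Suc j)) d"
    proof (rule loop_close[OF p \<mu> rng'(1,2)[OF j] q U(10) t])
      fix s assume "s \<in> {t1..t2}"
      then have s: "s \<in> {e j<..<a (Suc j)}" using t by auto
      have "\<nu> * (s - m j) \<in> {- Kp p<..<Kp p}" using s loop(1,2)[OF j] \<nu> by (auto simp: field_simps)
      then have "cos (am1p p (\<nu> * (s - m j))) > 0" using am1p_range(1)[OF p] by (intro cos_gt_zero_pi) auto
      then have "(cos (am1p p (\<nu> * (s - m j))))\<^sup>2 > 0" by simp
      then show "U s \<bullet> q1 > -1" using loop(3)[OF j s] by linarith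
    qed
  qed (rule loop_stable_mono)
  then obtain d2 where d2: "d2 > 0" "\<And>j. j \<in> {1..N} \<Longrightarrow> loop_stable p \<mu> L q1 U (e j) (a (Suc j)) d2" by blast

  \<comment> \<open>On the core the segments contribute nothing and each loop contributes the limit
    of \<open>2 * ?G \<delta> 1\<close>. The regularized lower bound thus converges to the energy of
    the core.\<close>
  have lim: "(\<lambda>n. 2 * real N * ?G (1 / real (Suc n)) 1) \<longlonglongrightarrow> integral {0..L} (?E U w)"
  proof -
    have s0: "integral {a j..e j} (?E U w) = 0" if j: "j \<in> {1..Suc N}" for j
      by (rule flat_segment_energy[OF U(2,4) _ seg(1)[OF j] _ q(1) seg(2)[OF j]]) (use rng[OF j] p in auto)
    have lj: "(\<lambda>n. 2 * ?G (1 / real (Suc n)) 1) \<longlonglongrightarrow> integral {e j..a (Suc j)} (?E U w)" if j: "j \<in> {1..N}" for j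
      unfolding \<mu>_def
    proof (rule loop_energy_limit[OF profile_subinterval[OF PU rng'(1,2)[OF j]] p \<nu> loop(1,2)[OF j]])
      have "U (e j) = - q1" by (rule seg(2)[of j]) (use seg(1)[of j] j in auto)
      moreover have "U (a (Suc j)) = - q1" by (rule seg(2)[of "Suc j"]) (use seg(1)[of "Suc j"] j in auto)
      ultimately show "U (e j) \<bullet> q1 = -1" "U (a (Suc j)) \<bullet> q1 = -1" using q(1) by (simp_all add: dot_square_norm)
    qed (rule loop(3)[OF j])
    have "(\<lambda>n. \<Sum>j=1..N. 2 * ?G (1 / real (Suc n)) 1) \<longlonglongrightarrow> (\<Sum>j=1..N. integral {e j..a (Suc j)} (?E U w))"
      by (rule tendsto_sum) (rule lj)
    moreover have "integral {0..L} (?E U w) = (\<Sum>j=1..N. integral {e j..a (Suc j)} (?E U w))"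
      using split[OF energy_density_integrable[OF PU, of \<mu>]] s0 by simp
    ultimately show ?thesis by (simp add: mult_ac)
  qed

  define d where "d = min d1 d2"
  have d: "d > 0" using d1(1) d2(1) by (auto simp: d_def)
  have ds: "segment_stable p \<mu> L q1 U (a j) (e j) d" if "j \<in> {1..Suc N}" for j
    by (rule segment_stable_mono[OF d1(2)[OF that]]) (simp add: d_def)
  have dl: "loop_stable p \<mu> L q1 U (e j) (a (Suc j)) d" if "j \<in> {1..N}" for j
    by (rule loop_stable_mono[OF d2(2)[OF that]]) (simp add: d_def)
  obtain \<epsilon> where \<epsilon>: "\<epsilon> > 0" "\<forall>\<eta> \<gamma> V U. \<eta> \<in> W2p p L \<longrightarrow> \<gamma> \<in> W2p p L \<longrightarrow> is_tangent L \<eta> V \<longrightarrow> is_tangent L \<gamma> U \<longrightarrow>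
    W2p_norm p L (\<lambda>s. \<eta> s - \<gamma> s) < \<epsilon> \<longrightarrow> (\<forall>s\<in>{0..L}. norm (V s - U s) < d)"
    using tangent_close[OF p1(1) L d] by blast
  have W2: "\<gamma> \<in> W2p p L" if "\<gamma> \<in> A_pin p P0 P1 L" for \<gamma> using that by (simp add: A_pin_def W2p_arc_def)
  have "bending_energy p L \<eta> \<ge> bending_energy p L \<gamma>"
    if \<eta>: "\<eta> \<in> A_pin p P0 P1 L" and near: "W2p_norm p L (\<lambda>s. \<eta> s - \<gamma> s) < \<epsilon>" for \<eta>
  proof -
    obtain V v where TV: "tangent_field p P0 P1 L \<eta> V v"
      using A_pin_tangent_field[OF \<eta> p1(1) L] by blast
    note V = tangent_fieldD[OF TV]
    have PV: "?prof V v" by (rule tangent_profile[OF TV q(1)])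
    have close: "\<forall>s\<in>{0..L}. norm (V s - U s) < d"
      using \<epsilon>(2) W2[OF \<eta>] W2[OF \<gamma>] V(1) U(1) near by blast
    have low: "2 * real N * ?G \<delta> 1 \<le> integral {0..L} (?E V v)" if \<delta>: "\<delta> > 0" for \<delta>
    proof -
      let ?A = "\<lambda>j. ?G \<delta> (V (a j) \<bullet> q1)" and ?E' = "\<lambda>j. ?G \<delta> (V (e j) \<bullet> q1)"
      have nn: "0 \<le> ?G \<delta> (V s \<bullet> q1)" if "s \<in> {0..L}" for s
      proof (rule integral_nonneg)
        have z: "V s \<bullet> q1 \<le> 1" by (rule profile_range(2)[OF PV that])
        show "calib p \<mu> \<delta> 0 integrable_on {-1..V s \<bullet> q1}"
          by (intro integrable_continuous_real continuous_on_subset[OF calib_continuous[OF p1(2) \<delta>]]) (use z in auto)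
        show "0 \<le> calib p \<mu> \<delta> 0 x" if "x \<in> {-1..V s \<bullet> q1}" for x
          by (rule calib_nonneg[OF p1(2) \<delta>]) (use z that in auto)
      qed
      \<comment> \<open>A pinned curve has free tangents at its ends, so the two outer terms of the
        telescoping sum need not vanish; they are nonnegative.\<close>
      have "2 * real N * ?G \<delta> 1 \<le> 2 * real N * ?G \<delta> 1 + ?A 1 + ?E' (Suc N)"
        using nn[of "a 1"] nn[of "e (Suc N)"] ends L by simp
      also have "\<dots> = (\<Sum>j=1..Suc N. ?A j + ?E' j) + (\<Sum>j=1..N. 2 * ?G \<delta> 1 - ?E' j - ?A (Suc j))"
        by (rule sum_alternating_telescope[symmetric])
      also have "\<dots> \<le> (\<Sum>j=1..Suc N. integral {a j..e j} (?E V v)) + (\<Sum>j=1..N. integral {e j..a (Suc j)} (?E V v))"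
      proof (intro add_mono sum_mono)
        show "?A j + ?E' j \<le> integral {a j..e j} (?E V v)" if "j \<in> {1..Suc N}" for j
          using ds[OF that] PV close \<delta> unfolding segment_stable_def by blast
        show "2 * ?G \<delta> 1 - ?E' j - ?A (Suc j) \<le> integral {e j..a (Suc j)} (?E V v)" if "j \<in> {1..N}" for j
          using dl[OF that] PV V(10) V(5) close \<delta> unfolding loop_stable_def by blast
      qed
      also have "\<dots> = integral {0..L} (?E V v)" by (rule split[OF energy_density_integrable[OF PV], symmetric])
      finally show ?thesis .
    qed
    \<comment> \<open>The right-hand side does not depend on \<open>\<delta>\<close>, so
      \<open>low\<close> passes to the limit. The parts of \<open>tangent_energy\<close> that depend
      only on the endpoints then cancel.\<close>
    have "integral {0..L} (?E U w) \<le> integral {0..L} (?E V v)"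
      by (rule LIMSEQ_le_const2[OF lim]) (auto intro!: low)
    then show ?thesis
      using tangent_energy[OF T L, of \<mu> q1] tangent_energy[OF TV L, of \<mu> q1] by simp
  qed
  then show ?thesis unfolding local_minimizer_def using \<gamma> \<epsilon>(1) by blast
qed

theorem theorem1p3:
  fixes p L :: real and P0 P1 :: "real^2" and N :: nat and \<gamma> :: "real \<Rightarrow> real^2"
  assumes "p > 2" and "L > 0"
    and "L / (p - 1) < norm (P1 - P0)" and "norm (P1 - P0) < L"
    and "N \<ge> 1"
    and "\<gamma> \<in> A_pin p P0 P1 L"
    and "alternating_flat_core p P0 P1 L N \<gamma>"
  shows "local_minimizer p P0 P1 L \<gamma>"
proof -
  note p = assms(1) and L = assms(2) and N = assms(5) and \<gamma> = assms(6)
  have K: "Kp p > 0" by (rule Kp_pos[OF p])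
  obtain \<sigma> l where \<sigma>': "\<forall>j\<in>{1..N}. \<sigma> j \<in> {1, -1}" and l': "\<forall>j\<in>{1..N+1}. l j > 0"
    and fa: "case flat_arc p N \<sigma> l of (_, \<Lambda>, g) \<Rightarrow>
          \<exists>c Q b. c > 0 \<and> orthogonal_transformation Q \<and> (\<forall>s\<in>{0..L}. \<gamma> s = c *\<^sub>R Q (g (\<Lambda> / L * s)) + b)"
    using assms(7) unfolding alternating_flat_core_def by (elim conjE exE) (rule that)
  note \<sigma> = bspec[OF \<sigma>'] and l = bspec[OF l']
  define A where "A = flat_start p l"
  define \<Lambda> where "\<Lambda> = A (N+1) + l (N+1)"
  obtain g where g: "flat_arc p N \<sigma> l = (0, \<Lambda>, g)"
    and gseg: "\<And>j. j \<in> {1..N+1} \<Longrightarrow> \<exists>k. \<forall>s\<in>{A j..A j + l j}. g s = k + vector [- (s - A j), 0]"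
    and gloop: "\<And>j. j \<in> {1..N} \<Longrightarrow> \<exists>k. \<forall>s\<in>{A j + l j..A (Suc j)}. g s = k + loop_curve p (\<sigma> j) (s - (A j + l j + Kp p))"
    using flat_arc_pieces[of p N l \<sigma>] K N l unfolding A_def \<Lambda>_def by (metis less_imp_le)
  obtain c Q b where c: "c > 0" and Q: "orthogonal_transformation Q"
    and \<gamma>g: "\<And>s. s \<in> {0..L} \<Longrightarrow> \<gamma> s = c *\<^sub>R Q (g (\<Lambda> / L * s)) + b"
    using fa unfolding g by auto
  have lin: "linear Q" using Q by (simp add: orthogonal_transformation_def)
  \<comment> \<open>Segments of the model run in the direction \<open>- axis 1 1\<close>; its image
    under \<open>Q\<close> is \<open>- q1\<close>, so \<open>q1\<close> is the direction opposite to
    the segments.\<close>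
  define q1 q2 where "q1 = Q (axis 1 1)" and "q2 = Q (axis 2 1)"
  have Qv: "Q v = (v $ 1) *\<^sub>R q1 + (v $ 2) *\<^sub>R q2" for v
  proof -
    have "v = (v $ 1) *\<^sub>R axis 1 1 + (v $ 2) *\<^sub>R axis 2 1"
      by (simp add: vec_eq_iff forall_2 axis_def)
    then have "Q v = Q ((v $ 1) *\<^sub>R axis 1 1 + (v $ 2) *\<^sub>R axis 2 1)" by simp
    then show ?thesis using lin by (simp add: linear_add linear_cmul q1_def q2_def)
  qed
  have qq: "q1 \<bullet> q1 = 1" "q2 \<bullet> q2 = 1" "q1 \<bullet> q2 = 0"
    using Q by (simp_all add: q1_def q2_def orthogonal_transformation_def inner_axis_axis)
  have qn: "norm q1 = 1" "norm q2 = 1" using qq by (simp_all add: norm_eq_1)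
  have A1: "A 1 = 0" by (simp add: A_def)
  have AS: "A (Suc j) = A j + l j + 2 * Kp p" if "j \<ge> 1" for j using that by (simp add: A_def flat_start_Suc)
  have Amono: "A i \<le> A j" if "i \<le> j" "j \<le> Suc N" for i j
    unfolding A_def using K l that by (intro flat_start_mono[where n=N]) (auto intro: less_imp_le)
  have A0: "0 \<le> A j" if "j \<in> {1..N+1}" for j using Amono[of 1 j] that A1 by simp
  have \<Lambda>0: "\<Lambda> > 0" using A0[of "N+1"] l[of "N+1"] by (simp add: \<Lambda>_def)
  have Ale: "A j + l j \<le> \<Lambda>" if "j \<in> {1..N+1}" for j
  proof (cases "j = N + 1")
    case False
    then have "A j + l j \<le> A (Suc j)" "A (Suc j) \<le> A (N+1)" using AS[of j] Amono[of "Suc j" "N+1"] K that by auto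
    then show ?thesis using l[of "N+1"] by (simp add: \<Lambda>_def)
  qed (simp add: \<Lambda>_def)
  \<comment> \<open>The rate of the reparametrization: dividing a parameter of \<open>g\<close> by
    \<open>\<nu>\<close> gives the arclength parameter of \<open>\<gamma>\<close>.\<close>
  define \<nu> where "\<nu> = \<Lambda> / L"
  have \<nu>: "\<nu> > 0" using \<Lambda>0 L by (simp add: \<nu>_def)
  have \<nu>L: "\<nu> * L = \<Lambda>" using L by (simp add: \<nu>_def)
  define a e m where "a j = A j / \<nu>" and "e j = (A j + l j) / \<nu>" and "m j = (A j + l j + Kp p) / \<nu>" for j
  have rng: "0 \<le> a j \<and> e j \<le> L" if "j \<in> {1..N+1}" for j
    using A0[OF that] Ale[OF that] \<nu> \<nu>L by (auto simp: a_def e_def pos_divide_le_eq mult.commute)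
  have ae: "a j < e j" if "j \<in> {1..N+1}" for j
    using l[OF that] \<nu> by (simp add: a_def e_def divide_strict_right_mono)
  have em: "e j = m j - Kp p / \<nu>" "a (Suc j) = m j + Kp p / \<nu>" if "j \<in> {1..N}" for j
    using AS[of j] that by (auto simp: e_def m_def a_def add_divide_distrib)
  obtain U w where T: "tangent_field p P0 P1 L \<gamma> U w"
    using A_pin_tangent_field[OF \<gamma> _ L] p by force
  note U = tangent_fieldD[OF T]
  have seg: "U s = - (c * \<nu>) *\<^sub>R q1" if j: "j \<in> {1..N+1}" and s: "s \<in> {a j..e j}" for j s
  proof -
    obtain k where k: "\<And>s. s \<in> {A j..A j + l j} \<Longrightarrow> g s = k + vector [- (s - A j), 0]" using gseg[OF j] by blast
    show ?thesis
    proof (rule segment_tangent[OF U(10,6) _ ae[OF j] _ _ s])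
      show "0 \<le> a j" "e j \<le> L" using rng[OF j] by auto
      fix s assume s: "s \<in> {a j..e j}"
      have sL: "s \<in> {0..L}" using s rng[OF j] by auto
      have "\<nu> * s \<in> {A j..A j + l j}" using s \<nu> by (auto simp: a_def e_def field_simps)
      from k[OF this] have "\<gamma> s = c *\<^sub>R Q (k + vector [- (\<nu> * s - A j), 0]) + b"
        using \<gamma>g[OF sL] by (simp add: \<nu>_def)
      also have "Q (k + vector [- (\<nu> * s - A j), 0]) = Q k + (- (\<nu> * s - A j)) *\<^sub>R q1"
        using lin by (simp add: linear_add Qv[of "vector _"] vector_2)
      also have "\<nu> * s - A j = \<nu> * (s - a j)" using \<nu> by (simp add: a_def right_diff_distrib)
      finally show "\<gamma> s = (c *\<^sub>R Q k + b) + (- (c * \<nu>) * (s - a j)) *\<^sub>R q1"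
        by (simp add: scaleR_diff_right mult.assoc)
    qed
  qed
  \<comment> \<open>Unit speed ties the dilation \<open>c\<close> to the reparametrization; it is
    read off at the start of the first segment.\<close>
  have c\<nu>: "c * \<nu> = 1"
  proof -
    have "norm (U (a 1)) = 1" using rng[of 1] ae[of 1] by (intro U(5)) auto
    then show ?thesis using seg[of 1 "a 1"] ae[of 1] c \<nu> qn by simp
  qed
  have "\<gamma> s = (c *\<^sub>R Q k + b) + c *\<^sub>R (loop_curve p (\<sigma> j) (\<nu> * (s - m j)) $ 1 *\<^sub>R q1 + loop_curve p (\<sigma> j) (\<nu> * (s - m j)) $ 2 *\<^sub>R q2)"
    if j: "j \<in> {1..N}" and s: "s \<in> {m j - Kp p / \<nu>..m j + Kp p / \<nu>}"
      and k: "\<forall>s\<in>{A j + l j..A (Suc j)}. g s = k + loop_curve p (\<sigma> j) (s - (A j + l j + Kp p))" for j s k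
  proof -
    have s': "s \<in> {e j..a (Suc j)}" using s em[OF j] by simp
    then have sL: "s \<in> {0..L}" using rng[of j] rng[of "Suc j"] ae[of j] ae[of "Suc j"] j by auto
    have "\<nu> * s \<in> {A j + l j..A (Suc j)}" using s' \<nu> by (auto simp: a_def e_def field_simps)
    then have "\<gamma> s = c *\<^sub>R Q (k + loop_curve p (\<sigma> j) (\<nu> * s - (A j + l j + Kp p))) + b"
      using \<gamma>g[OF sL] k by (simp add: \<nu>_def)
    also have "\<nu> * s - (A j + l j + Kp p) = \<nu> * (s - m j)" using \<nu> by (simp add: m_def right_diff_distrib)
    finally show ?thesis using lin by (simp add: linear_add Qv[of "loop_curve _ _ _"] scaleR_add_right)
  qed
  then have loop: "\<exists>k. \<forall>s\<in>{m j - Kp p / \<nu>..m j + Kp p / \<nu>}.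
      \<gamma> s = k + c *\<^sub>R (loop_curve p (\<sigma> j) (\<nu> * (s - m j)) $ 1 *\<^sub>R q1 + loop_curve p (\<sigma> j) (\<nu> * (s - m j)) $ 2 *\<^sub>R q2)"
    if "j \<in> {1..N}" for j using gloop[OF that] that by blast
  have mrng: "0 \<le> m j - Kp p / \<nu>" "m j + Kp p / \<nu> \<le> L" if j: "j \<in> {1..N}" for j
    using em[OF j] rng[of j] rng[of "Suc j"] ae[of j] ae[of "Suc j"] j by auto
  have tang: "\<And>s. s \<in> {e j<..<a (Suc j)} \<Longrightarrow> U s \<bullet> q1 = 2 * (cos (am1p p (\<nu> * (s - m j))))\<^sup>2 - 1"
    "\<exists>t1 t2. e j < t1 \<and> t1 < t2 \<and> t2 < a (Suc j) \<and> (U t1 \<bullet> q2) * (U t2 \<bullet> q2) < 0" if j: "j \<in> {1..N}" for j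
  proof -
    obtain k where k: "\<And>s. s \<in> {m j - Kp p / \<nu>..m j + Kp p / \<nu>} \<Longrightarrow>
      \<gamma> s = k + c *\<^sub>R (loop_curve p (\<sigma> j) (\<nu> * (s - m j)) $ 1 *\<^sub>R q1 + loop_curve p (\<sigma> j) (\<nu> * (s - m j)) $ 2 *\<^sub>R q2)"
      using loop[OF j] by blast
    note T = loop_tangent[OF p U(10,6) c c\<nu> mrng[OF j] qq \<sigma>[OF j] k]
    show "U s \<bullet> q1 = 2 * (cos (am1p p (\<nu> * (s - m j))))\<^sup>2 - 1" if "s \<in> {e j<..<a (Suc j)}" for s
      using T(1)[of s] that em[OF j] by simp
    show "\<exists>t1 t2. e j < t1 \<and> t1 < t2 \<and> t2 < a (Suc j) \<and> (U t1 \<bullet> q2) * (U t2 \<bullet> q2) < 0"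
      using T(2) em[OF j] by simp
  qed
  have seg': "U s = - q1" if "j \<in> {1..Suc N}" "s \<in> {a j..e j}" for j s
    using seg[of j s] that c\<nu> by simp
  have e: "a 1 = 0" "e (Suc N) = L" using A1 \<nu>L \<nu> by (simp_all add: a_def e_def \<Lambda>_def divide_eq_eq mult.commute)
  show ?thesis
    by (rule local_minimizer_if_alternating[OF p L \<nu> \<gamma> T qn qq(3) e _ _ seg' em tang])
       (use rng ae in auto)
qed

end
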